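(* (HN-filtration) Let $\mathcal L=\text{nmod-}\mathcal M$ or $\text{mod-}\Lambda$, let $Z_\bullet$ be a nonlinear stability function for $\mathcal L$ which is green and let $M\in\mathcal L$ be nonzero. Then there exist a unique sequence of real numbers $t_1<t_2<\cdots<t_m$ and a unique filtration $$0=M_0\subsetneq M_1\subsetneq M_2\subsetneq\cdots\subsetneq M_m=M$$ with the property that $(M_i/M_{i-1},t_i)$ is a $Z_\bullet$-semistable pair for $i=1,2,\dots,m$. Furthermore, $t_1=t_1(M)$.
   Context: Let $K$ be a field. $\mathcal L$ is either (i) $\text{mod-}\Lambda$, the category of finite dimensional right modules over a finite dimensional $K$-algebra $\Lambda$, or (ii) $\text{nmod-}\mathcal M$, where $\mathcal M=(\{F_i\}_{i=1}^n,\{M_{ij}\})$ is a modulated quiver over $K$ (the $F_i$ are finite dimensional division algebras over $K$, the $M_{ij}$ finite dimensional $F_i$-$F_j$-bimodules), $T\mathcal M=\coprod_{k\ge0}T_k\mathcal M$ is its tensor algebra ($T_0\mathcal M=\prod F_i$, $T_k\mathcal M=\coprod M_{j_0j_1}\otimes_{F_{j_1}}\cdots\otimes_{F_{j_{k-1}}} M_{j_{k-1}j_k}$), and $\text{nmod-}\mathcal M$ is the category of finitely generated right $T\mathcal M$-modules on which the ideal $R\mathcal M=\coprod_{k\ge1}T_k\mathcal M$ acts nilpotently. $\mathcal L$ has $n$ simple objects $S_1,\dots,S_n$; $\underline{\dim}\,M\in\mathbb N^n$ records the multiplicities of the $S_i$ in a composition series of $M$, and $K_0\mathcal L=\mathbb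 Z^n$ via $[M]\mapsto\underline{\dim}\,M$. A nonlinear stability function for $\mathcal L$ is a $C^1$ family of additive maps $Z_t:\mathbb Z^n\to\mathbb C$, $t\in\mathbb R$, $Z_t(x)=a_t\cdot x+\sqrt{-1}\,b_t\cdot x$ with $a_t\in\mathbb R^n$, $b_t\in(0,\infty)^n$, such that $a_t,b_t$ have velocity $0$ for $|t|$ large. For $M\ne0$, $\mu_t(M)=\frac{a_t\cdot\underline{\dim}\,M}{b_t\cdot\underline{\dim}\,M}$. A nonzero $M$ is $Z_t$-semistable if $\mu_t(M')\ge\mu_t(M)$ for all nonzero $M'\subsetneq M$. $(M,t)$ is a $Z_\bullet$-semistable pair if $M$ is $Z_{t}$-semistable and $\mu_{t}(M)=t$. $Z_\bullet$ is green if $\frac{d}{dt}\mu_t(M)|_{t=t_0}<1$ for every $Z_\bullet$-semistable pair $(M,t_0)$. For nonzero $M$, $t_0(M)$ is the smallest element of the (closed, bounded, nonempty) set $\{t\in\mathbb R:\mu_t(M)=t\}$, and $t_1(M)$ is the smallest value of $t_0(M')$ over all nonzero submodules $M'\subseteq M$. *)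

theory Defs
  imports
    "HOL-Analysis.Analysis"
    "HOL-Algebra.Module"
    "HOL-Algebra.QuotRing"
    "HOL-Algebra.Generated_Groups"
    "HOL-Algebra.Free_Abelian_Groups"
begin

section \<open>Right modules\<close>

text \<open>
  A right module over a (noncommutative) ring \<open>R\<close> is stored in the library record for modules;
  \<open>r \<odot>\<^bsub>M\<^esub> x\<close> stands for the product \<open>x \<cdot> r\<close>, so the associativity law reads
  \<open>x \<cdot> (r s) = (x \<cdot> r) \<cdot> s\<close>. The multiplication and the unit that the record type inherits
  from rings carry no meaning for a module.
\<close>

locale right_module = abelian_group M
  for R :: "('r, 'x) ring_scheme" (structure) and M :: "('r, 'm) module" (structure) +
  assumes act_closed: "\<lbrakk>r \<in> carrier R; x \<in> carrier M\<rbrakk> \<Longrightarrow> r \<odot>\<^bsub>M\<^esub> x \<in> carrier M"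
    and act_add_scalar: "\<lbrakk>r \<in> carrier R; s \<in> carrier R; x \<in> carrier M\<rbrakk> \<Longrightarrow>
      (r \<oplus>\<^bsub>R\<^esub> s) \<odot>\<^bsub>M\<^esub> x = r \<odot>\<^bsub>M\<^esub> x \<oplus>\<^bsub>M\<^esub> s \<odot>\<^bsub>M\<^esub> x"
    and act_add_vector: "\<lbrakk>r \<in> carrier R; x \<in> carrier M; y \<in> carrier M\<rbrakk> \<Longrightarrow>
      r \<odot>\<^bsub>M\<^esub> (x \<oplus>\<^bsub>M\<^esub> y) = r \<odot>\<^bsub>M\<^esub> x \<oplus>\<^bsub>M\<^esub> r \<odot>\<^bsub>M\<^esub> y"
    and act_mult: "\<lbrakk>r \<in> carrier R; s \<in> carrier R; x \<in> carrier M\<rbrakk> \<Longrightarrow>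
      (r \<otimes>\<^bsub>R\<^esub> s) \<odot>\<^bsub>M\<^esub> x = s \<odot>\<^bsub>M\<^esub> (r \<odot>\<^bsub>M\<^esub> x)"
    and act_one: "x \<in> carrier M \<Longrightarrow> \<one>\<^bsub>R\<^esub> \<odot>\<^bsub>M\<^esub> x = x"

definition submodule_of :: "('r, 'x) ring_scheme \<Rightarrow> ('r, 'm) module \<Rightarrow> 'm set \<Rightarrow> bool" where
  "submodule_of R M H \<longleftrightarrow>
     additive_subgroup H M \<and> (\<forall>r\<in>carrier R. \<forall>x\<in>H. r \<odot>\<^bsub>M\<^esub> x \<in> H)"

definition submod :: "('r, 'm) module \<Rightarrow> 'm set \<Rightarrow> ('r, 'm) module" where
  "submod M H = M\<lparr>carrier := H\<rparr>"

definition quotmod :: "('r, 'm) module \<Rightarrow> 'm set \<Rightarrow> ('r, 'm set) module" where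
  "quotmod M N =
    \<lparr>carrier = a_rcosets\<^bsub>M\<^esub> N, monoid.mult = undefined, one = undefined, ring.zero = N,
     add = set_add M, smult = (\<lambda>r X. \<Union>x\<in>X. N +>\<^bsub>M\<^esub> (r \<odot>\<^bsub>M\<^esub> x))\<rparr>"

definition nonzero_mod :: "('r, 'm) module \<Rightarrow> bool" where
  "nonzero_mod M \<longleftrightarrow> carrier M \<noteq> {\<zero>\<^bsub>M\<^esub>}"

definition simple_mod :: "('r, 'x) ring_scheme \<Rightarrow> ('r, 'm) module \<Rightarrow> bool" where
  "simple_mod R M \<longleftrightarrow>
     nonzero_mod M \<and> (\<forall>H. submodule_of R M H \<longrightarrow> H = {\<zero>\<^bsub>M\<^esub>} \<or> H = carrier M)"

definition mod_iso ::
    "('r, 'x) ring_scheme \<Rightarrow> ('r, 'm) module \<Rightarrow> ('r, 'p) module \<Rightarrow> bool" where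
  "mod_iso R M N \<longleftrightarrow>
     (\<exists>h. bij_betw h (carrier M) (carrier N) \<and>
          (\<forall>x\<in>carrier M. \<forall>y\<in>carrier M. h (x \<oplus>\<^bsub>M\<^esub> y) = h x \<oplus>\<^bsub>N\<^esub> h y) \<and>
          (\<forall>r\<in>carrier R. \<forall>x\<in>carrier M. h (r \<odot>\<^bsub>M\<^esub> x) = r \<odot>\<^bsub>N\<^esub> h x))"

text \<open>
  Finite generation; for a field of scalars this is finite dimensionality.
\<close>

definition finitely_spanned :: "('r, 'x) ring_scheme \<Rightarrow> ('r, 'm, 'y) module_scheme \<Rightarrow> bool" where
  "finitely_spanned R M \<longleftrightarrow>
     (\<exists>X. finite X \<and> X \<subseteq> carrier M \<and>
       (\<forall>x\<in>carrier M. \<exists>c\<in>X \<rightarrow> carrier R. x = (\<Oplus>\<^bsub>M\<^esub>y\<in>X. c y \<odot>\<^bsub>M\<^esub> y)))"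

definition with_scalars ::
    "('m, 'y) ring_scheme \<Rightarrow> ('k \<Rightarrow> 'm \<Rightarrow> 'm) \<Rightarrow> ('k, 'm) module" where
  "with_scalars M act =
    \<lparr>carrier = carrier M, monoid.mult = monoid.mult M, one = one M, ring.zero = ring.zero M, add = add M,
     smult = act\<rparr>"


section \<open>Finite dimensional algebras and their modules\<close>

definition fd_algebra :: "('k, 'x) ring_scheme \<Rightarrow> ('k, 'l) module \<Rightarrow> bool" where
  "fd_algebra K A \<longleftrightarrow>
     field K \<and> ring A \<and> Module.module K A \<and>
     (\<forall>k\<in>carrier K. \<forall>x\<in>carrier A. \<forall>y\<in>carrier A.
        (k \<odot>\<^bsub>A\<^esub> x) \<otimes>\<^bsub>A\<^esub> y = k \<odot>\<^bsub>A\<^esub> (x \<otimes>\<^bsub>A\<^esub> y) \<and>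
        x \<otimes>\<^bsub>A\<^esub> (k \<odot>\<^bsub>A\<^esub> y) = k \<odot>\<^bsub>A\<^esub> (x \<otimes>\<^bsub>A\<^esub> y)) \<and>
     finitely_spanned K A"

text \<open>
  The objects of \<open>mod-A\<close>. The ground field acts on a right \<open>A\<close>-module through its image
  \<open>k \<mapsto> k \<cdot> 1\<close> in \<open>A\<close>.
\<close>

definition fd_right_module ::
    "('k, 'x) ring_scheme \<Rightarrow> ('k, 'l) module \<Rightarrow> ('l, 'm) module \<Rightarrow> bool" where
  "fd_right_module K A M \<longleftrightarrow>
     right_module A M \<and>
     finitely_spanned K (with_scalars M (\<lambda>k x. (k \<odot>\<^bsub>A\<^esub> \<one>\<^bsub>A\<^esub>) \<odot>\<^bsub>M\<^esub> x))"


section \<open>Modulated quivers\<close>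

definition fd_division_algebra :: "('k, 'x) ring_scheme \<Rightarrow> ('k, 'f) module \<Rightarrow> bool" where
  "fd_division_algebra K D \<longleftrightarrow> fd_algebra K D \<and> Units D = carrier D - {\<zero>\<^bsub>D\<^esub>}"

record ('f, 'q) bimodule = "'q ring" +
  lact :: "'f \<Rightarrow> 'q \<Rightarrow> 'q"
  ract :: "'q \<Rightarrow> 'f \<Rightarrow> 'q"

text \<open>
  Finite dimensional \<open>D\<close>-\<open>E\<close>-bimodules over \<open>K\<close>: as usual for bimodules over \<open>K\<close>-algebras,
  the two actions of \<open>K\<close> coincide.
\<close>

locale fd_bimodule = abelian_group V
  for K :: "('k, 'x) ring_scheme" and D E :: "('k, 'f) module" and V :: "('f, 'q) bimodule" +
  assumes lact_closed: "\<lbrakk>d \<in> carrier D; v \<in> carrier V\<rbrakk> \<Longrightarrow> lact V d v \<in> carrier V"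
    and lact_add_scalar: "\<lbrakk>d \<in> carrier D; d' \<in> carrier D; v \<in> carrier V\<rbrakk> \<Longrightarrow>
      lact V (d \<oplus>\<^bsub>D\<^esub> d') v = lact V d v \<oplus>\<^bsub>V\<^esub> lact V d' v"
    and lact_add_vector: "\<lbrakk>d \<in> carrier D; v \<in> carrier V; w \<in> carrier V\<rbrakk> \<Longrightarrow>
      lact V d (v \<oplus>\<^bsub>V\<^esub> w) = lact V d v \<oplus>\<^bsub>V\<^esub> lact V d w"
    and lact_mult: "\<lbrakk>d \<in> carrier D; d' \<in> carrier D; v \<in> carrier V\<rbrakk> \<Longrightarrow>
      lact V (d \<otimes>\<^bsub>D\<^esub> d') v = lact V d (lact V d' v)"
    and lact_one: "v \<in> carrier V \<Longrightarrow> lact V \<one>\<^bsub>D\<^esub> v = v"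
    and ract_closed: "\<lbrakk>e \<in> carrier E; v \<in> carrier V\<rbrakk> \<Longrightarrow> ract V v e \<in> carrier V"
    and ract_add_scalar: "\<lbrakk>e \<in> carrier E; e' \<in> carrier E; v \<in> carrier V\<rbrakk> \<Longrightarrow>
      ract V v (e \<oplus>\<^bsub>E\<^esub> e') = ract V v e \<oplus>\<^bsub>V\<^esub> ract V v e'"
    and ract_add_vector: "\<lbrakk>e \<in> carrier E; v \<in> carrier V; w \<in> carrier V\<rbrakk> \<Longrightarrow>
      ract V (v \<oplus>\<^bsub>V\<^esub> w) e = ract V v e \<oplus>\<^bsub>V\<^esub> ract V w e"
    and ract_mult: "\<lbrakk>e \<in> carrier E; e' \<in> carrier E; v \<in> carrier V\<rbrakk> \<Longrightarrow>
      ract V v (e \<otimes>\<^bsub>E\<^esub> e') = ract V (ract V v e) e'"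
    and ract_one: "v \<in> carrier V \<Longrightarrow> ract V v \<one>\<^bsub>E\<^esub> = v"
    and lact_ract: "\<lbrakk>d \<in> carrier D; e \<in> carrier E; v \<in> carrier V\<rbrakk> \<Longrightarrow>
      ract V (lact V d v) e = lact V d (ract V v e)"
    and K_central: "\<lbrakk>k \<in> carrier K; v \<in> carrier V\<rbrakk> \<Longrightarrow>
      lact V (k \<odot>\<^bsub>D\<^esub> \<one>\<^bsub>D\<^esub>) v = ract V v (k \<odot>\<^bsub>E\<^esub> \<one>\<^bsub>E\<^esub>)"
    and finite_dim: "finitely_spanned K (with_scalars V (\<lambda>k v. lact V (k \<odot>\<^bsub>D\<^esub> \<one>\<^bsub>D\<^esub>) v))"

text \<open>
  The vertices are \<open>0, \<dots>, n - 1\<close>. A common type for all \<open>F\<^sub>i\<close> (and one for all bimodules)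
  is no restriction, since finitely many carriers embed into a sum type.
\<close>

definition modulated_quiver ::
    "('k, 'x) ring_scheme \<Rightarrow> nat \<Rightarrow> (nat \<Rightarrow> ('k, 'f) module) \<Rightarrow>
     (nat \<Rightarrow> nat \<Rightarrow> ('f, 'q) bimodule) \<Rightarrow> bool" where
  "modulated_quiver K n F Q \<longleftrightarrow>
     field K \<and>
     (\<forall>i<n. fd_division_algebra K (F i)) \<and>
     (\<forall>i<n. \<forall>j<n. fd_bimodule K (F i) (F j) (Q i j))"


section \<open>The tensor algebra of a modulated quiver\<close>

text \<open>
  \<open>Vert i f\<close> stands for the element \<open>f\<close> of the factor \<open>F\<^sub>i\<close> of \<open>T\<^sub>0\<close>, and
  \<open>Path [j\<^sub>0, \<dots>, j\<^sub>k] [x\<^sub>1, \<dots>, x\<^sub>k]\<close>, with \<open>k \<ge> 1\<close>, for the pure tensor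
  \<open>x\<^sub>1 \<otimes> \<dots> \<otimes> x\<^sub>k\<close> in the summand of \<open>T\<^sub>k\<close> that belongs to the sequence
  of vertices \<open>j\<^sub>0, \<dots>, j\<^sub>k\<close>.
\<close>

datatype ('f, 'q) tword = Vert nat 'f | Path "nat list" "'q list"

definition path_words :: "nat \<Rightarrow> (nat \<Rightarrow> nat \<Rightarrow> ('f, 'q) bimodule) \<Rightarrow> ('f, 'q) tword set" where
  "path_words n Q =
     {Path js xs | js xs. xs \<noteq> [] \<and> length js = Suc (length xs) \<and> set js \<subseteq> {..<n} \<and>
        (\<forall>r<length xs. xs ! r \<in> carrier (Q (js ! r) (js ! Suc r)))}"

definition twords ::
    "nat \<Rightarrow> (nat \<Rightarrow> ('k, 'f) module) \<Rightarrow> (nat \<Rightarrow> nat \<Rightarrow> ('f, 'q) bimodule) \<Rightarrow> ('f, 'q) tword set" where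
  "twords n F Q = {Vert i f | i f. i < n \<and> f \<in> carrier (F i)} \<union> path_words n Q"

text \<open>
  The defining relations of the groups \<open>F\<^sub>i\<close> (as quotients of the free abelian groups on
  their elements) and of the iterated tensor products: additivity in each factor and
  \<open>x c \<otimes> y = x \<otimes> c y\<close>. A relation only involves words from one summand, so the free
  abelian group on all words modulo all relations is the direct sum of the \<open>F\<^sub>i\<close> and of the
  tensor products over all sequences of vertices.
\<close>

inductive_set trels ::
    "nat \<Rightarrow> (nat \<Rightarrow> ('k, 'f) module) \<Rightarrow> (nat \<Rightarrow> nat \<Rightarrow> ('f, 'q) bimodule) \<Rightarrow>
     (('f, 'q) tword \<Rightarrow>\<^sub>0 int) set"
  for n F Q where
  vert_add:
    "\<lbrakk>i < n; f \<in> carrier (F i); g \<in> carrier (F i)\<rbrakk> \<Longrightarrow>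
     frag_of (Vert i (f \<oplus>\<^bsub>F i\<^esub> g)) - frag_of (Vert i f) - frag_of (Vert i g) \<in> trels n F Q"
| path_add:
    "\<lbrakk>Path js xs \<in> path_words n Q; r < length xs;
      x \<in> carrier (Q (js ! r) (js ! Suc r)); y \<in> carrier (Q (js ! r) (js ! Suc r))\<rbrakk> \<Longrightarrow>
     frag_of (Path js (xs[r := x \<oplus>\<^bsub>Q (js ! r) (js ! Suc r)\<^esub> y]))
       - frag_of (Path js (xs[r := x])) - frag_of (Path js (xs[r := y])) \<in> trels n F Q"
| path_balanced:
    "\<lbrakk>Path js xs \<in> path_words n Q; Suc r < length xs; c \<in> carrier (F (js ! Suc r))\<rbrakk> \<Longrightarrow>
     frag_of (Path js (xs[r := ract (Q (js ! r) (js ! Suc r)) (xs ! r) c]))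
       - frag_of (Path js (xs[Suc r := lact (Q (js ! Suc r) (js ! Suc (Suc r))) c (xs ! Suc r)]))
     \<in> trels n F Q"

fun tword_mult ::
    "(nat \<Rightarrow> ('k, 'f) module) \<Rightarrow> (nat \<Rightarrow> nat \<Rightarrow> ('f, 'q) bimodule) \<Rightarrow>
     ('f, 'q) tword \<Rightarrow> ('f, 'q) tword \<Rightarrow> ('f, 'q) tword \<Rightarrow>\<^sub>0 int" where
  "tword_mult F Q (Vert i f) (Vert j g) =
     (if i = j then frag_of (Vert i (f \<otimes>\<^bsub>F i\<^esub> g)) else 0)"
| "tword_mult F Q (Vert i f) (Path js xs) =
     (if i = hd js then frag_of (Path js (lact (Q (js ! 0) (js ! 1)) f (hd xs) # tl xs)) else 0)"
| "tword_mult F Q (Path js xs) (Vert j g) =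
     (if last js = j
      then frag_of (Path js (butlast xs @ [ract (Q (last (butlast js)) (last js)) (last xs) g]))
      else 0)"
| "tword_mult F Q (Path js xs) (Path ls ys) =
     (if last js = hd ls then frag_of (Path (js @ tl ls) (xs @ ys)) else 0)"

text \<open>
  The free abelian group on the words with the biadditive extension of \<^const>\<open>tword_mult\<close>.
  It need not be a ring before the relations are divided out.
\<close>

definition tword_ring ::
    "nat \<Rightarrow> (nat \<Rightarrow> ('k, 'f) module) \<Rightarrow> (nat \<Rightarrow> nat \<Rightarrow> ('f, 'q) bimodule) \<Rightarrow>
     (('f, 'q) tword \<Rightarrow>\<^sub>0 int) ring" where
  "tword_ring n F Q =
    \<lparr>carrier = carrier (free_Abelian_group (twords n F Q)),
     monoid.mult = (\<lambda>u v. frag_extend (\<lambda>x. frag_extend (\<lambda>y. tword_mult F Q x y) v) u),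
     one = (\<Sum>i<n. frag_of (Vert i \<one>\<^bsub>F i\<^esub>)), ring.zero = 0, add = (+)\<rparr>"

definition tensor_rels ::
    "nat \<Rightarrow> (nat \<Rightarrow> ('k, 'f) module) \<Rightarrow> (nat \<Rightarrow> nat \<Rightarrow> ('f, 'q) bimodule) \<Rightarrow>
     (('f, 'q) tword \<Rightarrow>\<^sub>0 int) set" where
  "tensor_rels n F Q = generate (free_Abelian_group (twords n F Q)) (trels n F Q)"

definition tensor_algebra ::
    "nat \<Rightarrow> (nat \<Rightarrow> ('k, 'f) module) \<Rightarrow> (nat \<Rightarrow> nat \<Rightarrow> ('f, 'q) bimodule) \<Rightarrow>
     (('f, 'q) tword \<Rightarrow>\<^sub>0 int) set ring" where
  "tensor_algebra n F Q = tword_ring n F Q Quot tensor_rels n F Q"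

text \<open>The ideal \<open>\<Coprod>\<^sub>k\<^sub>\<ge>\<^sub>1 T\<^sub>k\<close>.\<close>

definition tensor_radical ::
    "nat \<Rightarrow> (nat \<Rightarrow> ('k, 'f) module) \<Rightarrow> (nat \<Rightarrow> nat \<Rightarrow> ('f, 'q) bimodule) \<Rightarrow>
     (('f, 'q) tword \<Rightarrow>\<^sub>0 int) set set" where
  "tensor_radical n F Q =
     {tensor_rels n F Q +>\<^bsub>tword_ring n F Q\<^esub> u | u. Poly_Mapping.keys u \<subseteq> path_words n Q}"

definition acts_nilpotently :: "'r set \<Rightarrow> ('r, 'm) module \<Rightarrow> bool" where
  "acts_nilpotently I M \<longleftrightarrow>
     (\<exists>N. \<forall>rs. length rs = N \<and> set rs \<subseteq> I \<longrightarrow>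
        (\<forall>x\<in>carrier M. foldl (\<lambda>y r. r \<odot>\<^bsub>M\<^esub> y) x rs = \<zero>\<^bsub>M\<^esub>))"

definition nilpotent_module ::
    "nat \<Rightarrow> (nat \<Rightarrow> ('k, 'f) module) \<Rightarrow> (nat \<Rightarrow> nat \<Rightarrow> ('f, 'q) bimodule) \<Rightarrow>
     ((('f, 'q) tword \<Rightarrow>\<^sub>0 int) set, 'm) module \<Rightarrow> bool" where
  "nilpotent_module n F Q M \<longleftrightarrow>
     right_module (tensor_algebra n F Q) M \<and>
     finitely_spanned (tensor_algebra n F Q) M \<and>
     acts_nilpotently (tensor_radical n F Q) M"


section \<open>Simple objects and dimension vectors\<close>

text \<open>
  A category \<open>\<L>\<close> of finitely generated right modules over \<open>R\<close> is given by a predicate on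
  modules. A predicate passed as an argument lives at a single type of module elements. Every
  finitely generated right \<open>R\<close>-module is a quotient of some \<open>R\<^sup>m\<close>, hence isomorphic to a module
  whose elements are cosets in \<open>R\<^sup>m\<close>, that is, sets of functions \<open>nat \<Rightarrow> 'r\<close>. So
  quantification over modules with elements of the following type is quantification over all
  objects of \<open>\<L>\<close> up to isomorphism.
\<close>

type_synonym 'r univ = "(nat \<Rightarrow> 'r) set"

definition simple_objects ::
    "('r, 'x) ring_scheme \<Rightarrow> (('r, 'r univ) module \<Rightarrow> bool) \<Rightarrow> nat \<Rightarrow>
     (nat \<Rightarrow> ('r, 'r univ) module) \<Rightarrow> bool" where
  "simple_objects R L n S \<longleftrightarrow>
     (\<forall>i<n. L (S i) \<and> simple_mod R (S i)) \<and>
     (\<forall>i<n. \<forall>j<n. mod_iso R (S i) (S j) \<longrightarrow> i = j) \<and>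
     (\<forall>T. L T \<and> simple_mod R T \<longrightarrow> (\<exists>i<n. mod_iso R T (S i)))"

definition composition_series ::
    "('r, 'x) ring_scheme \<Rightarrow> ('r, 'm) module \<Rightarrow> 'm set list \<Rightarrow> bool" where
  "composition_series R M Ns \<longleftrightarrow>
     Ns \<noteq> [] \<and> hd Ns = {\<zero>\<^bsub>M\<^esub>} \<and> last Ns = carrier M \<and>
     (\<forall>N\<in>set Ns. submodule_of R M N) \<and>
     (\<forall>k. Suc k < length Ns \<longrightarrow>
        Ns ! k \<subset> Ns ! Suc k \<and> simple_mod R (quotmod (submod M (Ns ! Suc k)) (Ns ! k)))"

text \<open>
  By the Jordan--Hoelder theorem the choice of the composition series is irrelevant.
\<close>

definition dim_vec ::
    "('r, 'x) ring_scheme \<Rightarrow> (nat \<Rightarrow> ('r, 'r univ) module) \<Rightarrow> ('r, 'm) module \<Rightarrow> nat \<Rightarrow> nat" where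
  "dim_vec R S M i =
     (let Ns = (SOME Ns. composition_series R M Ns)
      in card {k. Suc k < length Ns \<and>
                  mod_iso R (quotmod (submod M (Ns ! Suc k)) (Ns ! k)) (S i)})"


section \<open>Nonlinear stability functions\<close>

text \<open>
  Vectors in \<open>\<real>\<^sup>n\<close> and \<open>\<int>\<^sup>n\<close> are functions on \<^typ>\<open>nat\<close> of which only the values at
  \<open>0, \<dots>, n - 1\<close> matter.
\<close>

definition stability_function ::
    "nat \<Rightarrow> (real \<Rightarrow> (nat \<Rightarrow> int) \<Rightarrow> complex) \<Rightarrow> (real \<Rightarrow> nat \<Rightarrow> real) \<Rightarrow> (real \<Rightarrow> nat \<Rightarrow> real) \<Rightarrow> bool"
  where
  "stability_function n Z a b \<longleftrightarrow>
     (\<forall>t x. Z t x = of_real (\<Sum>i<n. a t i * of_int (x i))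
                    + \<i> * of_real (\<Sum>i<n. b t i * of_int (x i))) \<and>
     (\<forall>i<n. (\<lambda>t. a t i) C1_differentiable_on UNIV \<and> (\<lambda>t. b t i) C1_differentiable_on UNIV) \<and>
     (\<forall>t. \<forall>i<n. b t i > 0) \<and>
     (\<exists>T. \<forall>t. \<bar>t\<bar> > T \<longrightarrow>
        (\<forall>i<n. deriv (\<lambda>s. a s i) t = 0 \<and> deriv (\<lambda>s. b s i) t = 0))"

definition slope ::
    "('r, 'x) ring_scheme \<Rightarrow> nat \<Rightarrow> (nat \<Rightarrow> ('r, 'r univ) module) \<Rightarrow>
     (real \<Rightarrow> nat \<Rightarrow> real) \<Rightarrow> (real \<Rightarrow> nat \<Rightarrow> real) \<Rightarrow> real \<Rightarrow> ('r, 'm) module \<Rightarrow> real" where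
  "slope R n S a b t M =
     (\<Sum>i<n. a t i * real (dim_vec R S M i)) / (\<Sum>i<n. b t i * real (dim_vec R S M i))"

definition semistable ::
    "('r, 'x) ring_scheme \<Rightarrow> nat \<Rightarrow> (nat \<Rightarrow> ('r, 'r univ) module) \<Rightarrow>
     (real \<Rightarrow> nat \<Rightarrow> real) \<Rightarrow> (real \<Rightarrow> nat \<Rightarrow> real) \<Rightarrow> real \<Rightarrow> ('r, 'm) module \<Rightarrow> bool" where
  "semistable R n S a b t M \<longleftrightarrow>
     nonzero_mod M \<and>
     (\<forall>H. submodule_of R M H \<and> H \<noteq> {\<zero>\<^bsub>M\<^esub>} \<and> H \<subset> carrier M \<longrightarrow>
        slope R n S a b t (submod M H) \<ge> slope R n S a b t M)"

definition semistable_pair ::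
    "('r, 'x) ring_scheme \<Rightarrow> nat \<Rightarrow> (nat \<Rightarrow> ('r, 'r univ) module) \<Rightarrow>
     (real \<Rightarrow> nat \<Rightarrow> real) \<Rightarrow> (real \<Rightarrow> nat \<Rightarrow> real) \<Rightarrow> ('r, 'm) module \<Rightarrow> real \<Rightarrow> bool" where
  "semistable_pair R n S a b M t \<longleftrightarrow>
     semistable R n S a b t M \<and> slope R n S a b t M = t"

definition green ::
    "('r, 'x) ring_scheme \<Rightarrow> (('r, 'r univ) module \<Rightarrow> bool) \<Rightarrow> nat \<Rightarrow>
     (nat \<Rightarrow> ('r, 'r univ) module) \<Rightarrow> (real \<Rightarrow> nat \<Rightarrow> real) \<Rightarrow> (real \<Rightarrow> nat \<Rightarrow> real) \<Rightarrow> bool" where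
  "green R L n S a b \<longleftrightarrow>
     (\<forall>M t0. L M \<and> semistable_pair R n S a b M t0 \<longrightarrow>
        deriv (\<lambda>t. slope R n S a b t M) t0 < 1)"

definition first_time ::
    "('r, 'x) ring_scheme \<Rightarrow> nat \<Rightarrow> (nat \<Rightarrow> ('r, 'r univ) module) \<Rightarrow>
     (real \<Rightarrow> nat \<Rightarrow> real) \<Rightarrow> (real \<Rightarrow> nat \<Rightarrow> real) \<Rightarrow> ('r, 'm) module \<Rightarrow> real" where
  "first_time R n S a b M = (LEAST t. slope R n S a b t M = t)"

definition first_sub_time ::
    "('r, 'x) ring_scheme \<Rightarrow> nat \<Rightarrow> (nat \<Rightarrow> ('r, 'r univ) module) \<Rightarrow>
     (real \<Rightarrow> nat \<Rightarrow> real) \<Rightarrow> (real \<Rightarrow> nat \<Rightarrow> real) \<Rightarrow> ('r, 'm) module \<Rightarrow> real" where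
  "first_sub_time R n S a b M =
     (LEAST t. \<exists>H. submodule_of R M H \<and> H \<noteq> {\<zero>\<^bsub>M\<^esub>} \<and> t = first_time R n S a b (submod M H))"

text \<open>
  The list \<open>ts = [t\<^sub>1, \<dots>, t\<^sub>m]\<close> is indexed from 0, while \<open>Ms = [M\<^sub>0, \<dots>, M\<^sub>m]\<close>.
\<close>

definition HN_filtration ::
    "('r, 'x) ring_scheme \<Rightarrow> nat \<Rightarrow> (nat \<Rightarrow> ('r, 'r univ) module) \<Rightarrow>
     (real \<Rightarrow> nat \<Rightarrow> real) \<Rightarrow> (real \<Rightarrow> nat \<Rightarrow> real) \<Rightarrow> ('r, 'm) module \<Rightarrow>
     real list \<Rightarrow> 'm set list \<Rightarrow> bool" where
  "HN_filtration R n S a b M ts Ms \<longleftrightarrow>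
     sorted_wrt (<) ts \<and>
     length Ms = Suc (length ts) \<and>
     hd Ms = {\<zero>\<^bsub>M\<^esub>} \<and> last Ms = carrier M \<and>
     (\<forall>N\<in>set Ms. submodule_of R M N) \<and>
     (\<forall>i<length ts. Ms ! i \<subset> Ms ! Suc i \<and>
        semistable_pair R n S a b (quotmod (submod M (Ms ! Suc i)) (Ms ! i)) (ts ! i))"

end

theory Submission
  imports Defs
begin

text \<open>
  For a submodule \<open>H\<close> of \<open>M\<close> put \<open>F t H = (a\<^sub>t - t b\<^sub>t) \<cdot> dim H\<close>. By Jordan--Hoelder this is a valuation on the
  modular lattice of submodules, and \<open>(B/A, t)\<close> is a semistable pair iff \<open>F t B = F t A\<close> and
  \<open>F t H \<ge> F t A\<close> for all \<open>H\<close> between \<open>A\<close> and \<open>B\<close>. Greenness says that \<open>F t B - F t A\<close> then crosses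
  zero downwards at \<open>t\<close>. Consequently, if all submodules \<open>H\<close> properly above \<open>A\<close> satisfy
  \<open>F u H > F u A\<close> at some time \<open>u\<close>, they do so at all earlier times. The first step of the filtration
  is therefore the largest \<open>H\<close> with \<open>F t H = F t 0\<close> at the first time \<open>t\<close> at which some nonzero \<open>H\<close>
  has this property, and the quotient by it only has later times.
\<close>

section \<open>Harder--Narasimhan chains in a lattice with a time-dependent valuation\<close>

text \<open>\<open>F\<close> linearises the comparison of a slope with \<open>t\<close>: F t B - F t
  A is the slope of B/A minus \<open>t\<close>, times the denominator of that slope, which is
  positive. Unlike the slope it is additive, so statements about semistable subquotients become
  arithmetic in one lattice of submodules. There may be infinitely many submodules, but their
  dimension vectors are bounded by that of \<open>M\<close>. So only finitely many functions of time
  occur, and first or last times of failure are attained. Two obstacles shape the rest.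
  \<open>green\<close> and \<open>simple_objects\<close> speak about modules over a single type of
  elements, while the subquotients of \<open>M\<close> live on others; hence subquotients are copied
  into that type where these assumptions are applied, and dimension vectors are read off from
  intervals of submodules of \<open>M\<close>. In the tensor case \<open>M\<close> is only known to
  be finitely generated and nilpotent; its finite length is obtained by proving that it is finite
  dimensional over \<open>K\<close>.\<close>

locale hn_lattice =
  fixes X :: "'a set set" and join :: "'a set \<Rightarrow> 'a set \<Rightarrow> 'a set" and Top :: "'a set"
    and F :: "real \<Rightarrow> 'a set \<Rightarrow> real" and rank :: "'a set \<Rightarrow> nat"
  assumes inter_closed: "\<lbrakk>A \<in> X; B \<in> X\<rbrakk> \<Longrightarrow> A \<inter> B \<in> X"
    and join_closed: "\<lbrakk>A \<in> X; B \<in> X\<rbrakk> \<Longrightarrow> join A B \<in> X"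
    and join_ub1: "\<lbrakk>A \<in> X; B \<in> X\<rbrakk> \<Longrightarrow> A \<subseteq> join A B"
    and join_ub2: "\<lbrakk>A \<in> X; B \<in> X\<rbrakk> \<Longrightarrow> B \<subseteq> join A B"
    and Top_in: "Top \<in> X"
    and le_Top: "A \<in> X \<Longrightarrow> A \<subseteq> Top"
    and rank_less: "\<lbrakk>A \<in> X; B \<in> X; A \<subset> B\<rbrakk> \<Longrightarrow> rank A < rank B"
    and valuation: "\<lbrakk>A \<in> X; B \<in> X\<rbrakk> \<Longrightarrow> F t (join A B) + F t (A \<inter> B) = F t A + F t B"
    and finite_F: "finite ((\<lambda>A t. F t A) ` X)"
    and continuous_F: "A \<in> X \<Longrightarrow> continuous_on UNIV (\<lambda>t. F t A)"
    and early: "\<lbrakk>A \<in> X; B \<in> X; A \<subset> B\<rbrakk> \<Longrightarrow> \<exists>T. \<forall>t\<le>T. F t A < F t B"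
    and late: "\<lbrakk>A \<in> X; B \<in> X; A \<subset> B\<rbrakk> \<Longrightarrow> \<exists>T. \<forall>t\<ge>T. F t B < F t A"
    and crossing: "\<lbrakk>A \<in> X; B \<in> X; A \<subset> B; F t B = F t A;
        \<And>H. \<lbrakk>H \<in> X; A \<subseteq> H; H \<subseteq> B\<rbrakk> \<Longrightarrow> F t A \<le> F t H\<rbrakk> \<Longrightarrow>
      \<exists>D<0. ((\<lambda>s. F s B - F s A) has_real_derivative D) (at t)"
begin

section \<open>Semistable pieces, chains of pieces and gaps\<close>

definition piece :: "'a set \<Rightarrow> 'a set \<Rightarrow> real \<Rightarrow> bool" where
  "piece A B t \<longleftrightarrow> A \<in> X \<and> B \<in> X \<and> A \<subset> B \<and> F t B = F t A \<and>
     (\<forall>H\<in>X. A \<subseteq> H \<longrightarrow> H \<subseteq> B \<longrightarrow> F t A \<le> F t H)"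

text \<open>The starting submodule is a variable so that the tail of a chain is again a chain: it is
  the filtration of the quotient by the first step, kept inside the same lattice.\<close>

fun hn :: "'a set \<Rightarrow> real list \<Rightarrow> 'a set list \<Rightarrow> bool" where
  "hn A [] Ms \<longleftrightarrow> Ms = [A] \<and> A = Top"
| "hn A (t # ts) Ms \<longleftrightarrow> (\<exists>B Ms'. Ms = A # Ms' \<and> piece A B t \<and> hn B ts Ms' \<and> (\<forall>s\<in>set ts. t < s))"

text \<open>A set of functions of time rather than a family indexed by submodules: it stays finite
  when infinitely many \<open>H\<close> occur, so minima and common neighbourhoods exist.\<close>

definition gaps :: "'a set \<Rightarrow> 'a set \<Rightarrow> (real \<Rightarrow> real) set" where
  "gaps A B = {\<lambda>t. F t H - F t A | H. H \<in> X \<and> A \<subset> H \<and> H \<subseteq> B}"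

lemma finite_gaps: "finite (gaps A B)"
proof -
  have "gaps A B \<subseteq> (\<lambda>f t. f t - F t A) ` ((\<lambda>A t. F t A) ` X)"
    unfolding gaps_def by (auto simp: image_image)
  then show ?thesis
    using finite_F by (meson finite_imageI finite_subset)
qed

lemma continuous_gaps: "\<lbrakk>f \<in> gaps A B; A \<in> X\<rbrakk> \<Longrightarrow> continuous_on UNIV f"
  unfolding gaps_def by (auto intro!: continuous_on_diff continuous_F)

lemma closed_gap_nonpos:
  assumes "A \<in> X" shows "closed {t. \<exists>f\<in>gaps A B. f t \<le> 0}"
proof -
  have "closed {t. f t \<le> 0}" if "f \<in> gaps A B" for f
    using continuous_gaps[OF that assms] by (intro closed_Collect_le) auto
  then have "closed (\<Union>f\<in>gaps A B. {t. f t \<le> 0})"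
    using finite_gaps by (intro closed_UN) auto
  moreover have "(\<Union>f\<in>gaps A B. {t. f t \<le> 0}) = {t. \<exists>f\<in>gaps A B. f t \<le> 0}" by auto
  ultimately show ?thesis by simp
qed

lemma pieceI_of_gaps:
  assumes "A \<in> X" "H \<in> X" "A \<subset> H" "H \<subseteq> B" "F t H = F t A" "\<forall>f\<in>gaps A B. 0 \<le> f t"
  shows "piece A H t"
proof -
  have "F t A \<le> F t G" if "G \<in> X" "A \<subseteq> G" "G \<subseteq> H" for G
  proof (cases "G = A")
    case False
    then have "(\<lambda>t. F t G - F t A) \<in> gaps A B"
      using that assms unfolding gaps_def by blast
    then show ?thesis using assms(6) by auto
  qed simp
  then show ?thesis using assms unfolding piece_def by auto
qed

lemma piece_crossing:
  assumes "piece A B t"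
  obtains e where "e > 0" "\<And>s. \<lbrakk>t - e < s; s < t\<rbrakk> \<Longrightarrow> F s A < F s B"
    "\<And>s. \<lbrakk>t < s; s < t + e\<rbrakk> \<Longrightarrow> F s B < F s A"
proof -
  from assms obtain D where "D < 0" and D: "((\<lambda>s. F s B - F s A) has_real_derivative D) (at t)"
    using crossing[of A B t] unfolding piece_def by auto
  from assms have 0: "F t B - F t A = 0" unfolding piece_def by auto
  from DERIV_neg_dec_left[OF D \<open>D < 0\<close>] obtain d1 where d1: "d1 > 0"
    "\<And>h. \<lbrakk>0 < h; h < d1\<rbrakk> \<Longrightarrow> F t B - F t A < F (t - h) B - F (t - h) A" by auto
  from DERIV_neg_dec_right[OF D \<open>D < 0\<close>] obtain d2 where d2: "d2 > 0"
    "\<And>h. \<lbrakk>0 < h; h < d2\<rbrakk> \<Longrightarrow> F t B - F t A > F (t + h) B - F (t + h) A" by auto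
  show thesis
  proof (rule that[of "min d1 d2"])
    show "F s A < F s B" if "t - min d1 d2 < s" "s < t" for s
      using d1(2)[of "t - s"] that 0 by auto
    show "F s B < F s A" if "t < s" "s < t + min d1 d2" for s
      using d2(2)[of "s - t"] that 0 by auto
  qed (use d1 d2 in auto)
qed

text \<open>If the claim failed, then at the last failure time \<open>s\<close> all gaps are nonnegative and one of
  them vanishes; this one belongs to a semistable piece, so it becomes negative right after \<open>s\<close>.\<close>

lemma gaps_positive_before:
  assumes A: "A \<in> X" and pos: "\<forall>f\<in>gaps A B. 0 < f u" and "t \<le> u" and "f \<in> gaps A B"
  shows "0 < f t"
proof (rule ccontr)
  define Z where "Z = {t. \<exists>f\<in>gaps A B. f t \<le> 0} \<inter> {..u}"
  assume "\<not> 0 < f t"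
  then have ne: "Z \<noteq> {}" using assms(3,4) by (auto simp: Z_def not_less)
  have "closed Z" unfolding Z_def by (intro closed_Int closed_gap_nonpos A closed_atMost)
  moreover have bdd: "bdd_above Z" unfolding Z_def by (auto intro: bdd_aboveI)
  ultimately have sZ: "Sup Z \<in> Z" using ne by (intro closed_contains_Sup)
  define s where "s = Sup Z"
  from sZ obtain g where g: "g \<in> gaps A B" "g s \<le> 0" and "s \<le> u" by (auto simp: Z_def s_def)
  then have "s < u" using pos by (metis less_le not_less)
  have after: "0 < g' r" if "s < r" "r \<le> u" "g' \<in> gaps A B" for r g'
  proof (rule ccontr)
    assume "\<not> 0 < g' r"
    then have "r \<in> Z" using that by (auto simp: Z_def not_less)
    then have "r \<le> s" unfolding s_def using bdd by (rule cSup_upper)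
    then show False using that by simp
  qed
  have ge: "0 \<le> g' s" if "g' \<in> gaps A B" for g'
  proof (rule ccontr)
    assume "\<not> 0 \<le> g' s"
    then have "g' s < 0" by simp
    moreover have "isCont g' s"
      using continuous_gaps[OF that A] by (simp add: continuous_on_eq_continuous_at)
    ultimately have "\<forall>\<^sub>F r in at s. g' r < 0"
      unfolding isCont_def by (metis order_tendstoD(2))
    then obtain d where d: "d > 0" "\<And>r. \<lbrakk>r \<noteq> s; dist r s < d\<rbrakk> \<Longrightarrow> g' r < 0"
      unfolding eventually_at by auto
    \<comment> \<open>Capping at \<open>u\<close> keeps \<open>r\<close> in the range of
      \<open>after\<close>, and \<open>s < u\<close> keeps it to the right of
      \<open>s\<close>.\<close>
    define r where "r = min u (s + d/2)"
    have "g' r < 0" using d \<open>s < u\<close> by (intro d(2)) (auto simp: r_def dist_real_def)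
    moreover have "0 < g' r" using d(1) \<open>s < u\<close> that by (intro after) (auto simp: r_def)
    ultimately show False by simp
  qed
  from g obtain H where H: "H \<in> X" "A \<subset> H" "H \<subseteq> B" "g = (\<lambda>t. F t H - F t A)"
    unfolding gaps_def by auto
  have "F s H = F s A" using ge[OF g(1)] g(2) H by auto
  then have "piece A H s" using H A ge by (intro pieceI_of_gaps) auto
  then obtain e where "e > 0" and e: "\<And>r. \<lbrakk>s < r; r < s + e\<rbrakk> \<Longrightarrow> F r H < F r A"
    by (metis piece_crossing)
  define r where "r = min u (s + e/2)"
  have "F r H < F r A" using \<open>e > 0\<close> \<open>s < u\<close> by (intro e) (auto simp: r_def)
  moreover have "0 < g r" using \<open>e > 0\<close> \<open>s < u\<close> g by (intro after) (auto simp: r_def)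
  ultimately show False using H by simp
qed

text \<open>At \<open>u\<close> itself some gaps vanish, so \<open>gaps_positive_before\<close>
  cannot be started there. A vanishing gap belongs to a piece and is positive shortly before
  \<open>u\<close> by the crossing; a positive gap stays so by continuity. Finiteness gives one
  common time before \<open>u\<close> from which to start.\<close>

lemma piece_gaps_positive_before:
  assumes P: "piece A B u" and "t < u" and f: "f \<in> gaps A B"
  shows "0 < f t"
proof -
  have A: "A \<in> X" using P by (simp add: piece_def)
  have nonneg: "0 \<le> g u" if "g \<in> gaps A B" for g
    using P that unfolding piece_def gaps_def by auto
  have "\<forall>\<^sub>F s in at_left u. 0 < g s" if g: "g \<in> gaps A B" for g
  proof (cases "g u = 0")
    case True
    from g obtain H where H: "H \<in> X" "A \<subset> H" "H \<subseteq> B" "g = (\<lambda>t. F t H - F t A)"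
      unfolding gaps_def by auto
    have "piece A H u" using H A True nonneg by (intro pieceI_of_gaps) auto
    then obtain e where "e > 0" "\<And>s. \<lbrakk>u - e < s; s < u\<rbrakk> \<Longrightarrow> F s A < F s H"
      by (metis piece_crossing)
    then show ?thesis
      unfolding eventually_at_left_field
      by (intro exI[of _ "u - e"]) (auto simp: H)
  next
    case False
    then have "0 < g u" using nonneg[OF g] by simp
    moreover have "(g \<longlongrightarrow> g u) (at_left u)"
      using continuous_gaps[OF g A]
      by (metis UNIV_I at_within_open continuous_on_def open_UNIV filterlim_at_split)
    ultimately show ?thesis by (rule order_tendstoD(1)[rotated])
  qed
  then have "\<forall>\<^sub>F s in at_left u. \<forall>g\<in>gaps A B. 0 < g s"
    using finite_gaps by (simp add: eventually_ball_finite)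
  then obtain b where b: "b < u" "\<And>s. \<lbrakk>b < s; s < u\<rbrakk> \<Longrightarrow> \<forall>g\<in>gaps A B. 0 < g s"
    unfolding eventually_at_left_field by auto
  \<comment> \<open>A time not before \<open>t\<close> that still lies in the interval of positivity
    between \<open>b\<close> and \<open>u\<close>.\<close>
  define s where "s = max t ((b + u) / 2)"
  have "\<forall>g\<in>gaps A B. 0 < g s" using b(1) \<open>t < u\<close> by (intro b(2)) (auto simp: s_def max_def)
  then show ?thesis by (rule gaps_positive_before[OF A]) (auto simp: s_def f)
qed

text \<open>The valuation splits F s H - F s A into (F s (H + B) - F s B) + (F s (H \<inter> B) - F
  s A), where \<open>B\<close> is the first step and + is the join. The first summand is controlled
  by the tail of the chain, the second by the first piece; if the first one degenerates,
  \<open>H\<close> lies below \<open>B\<close> and the first piece alone decides.\<close>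

lemma hn_positive_before:
  "\<lbrakk>hn A ts Ms; \<forall>u\<in>set ts. s < u; H \<in> X; A \<subset> H\<rbrakk> \<Longrightarrow> F s A < F s H"
proof (induction ts arbitrary: A Ms H)
  case Nil
  then show ?case using le_Top by fastforce
next
  case (Cons u ts)
  then obtain B Ms' where P: "piece A B u" and B: "hn B ts Ms'" by auto
  then have X: "A \<in> X" "B \<in> X" "A \<subset> B" by (auto simp: piece_def)
  have below: "F s A < F s G" if "G \<in> X" "A \<subset> G" "G \<subseteq> B" for G
  proof -
    have "(\<lambda>t. F t G - F t A) \<in> gaps A B" using that unfolding gaps_def by blast
    from piece_gaps_positive_before[OF P _ this, of s] Cons.prems(2) show ?thesis by auto
  qed
  have above: "F s B < F s G" if "G \<in> X" "B \<subset> G" for G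
    using Cons.IH[OF B _ that] Cons.prems(2) by auto
  have v: "F s (join H B) + F s (H \<inter> B) = F s H + F s B" using valuation Cons.prems X by blast
  have j: "join H B \<in> X" "H \<subseteq> join H B" "B \<subseteq> join H B" "H \<inter> B \<in> X"
    using Cons.prems X join_closed join_ub1 join_ub2 inter_closed by auto
  show ?case
  proof (cases "join H B = B")
    case True
    then have "H \<subseteq> B" using j by auto
    then show ?thesis using below Cons.prems by auto
  next
    case False
    then have 1: "F s B < F s (join H B)" using j above[of "join H B"] by auto
    have "F s A \<le> F s (H \<inter> B)"
    proof (cases "H \<inter> B = A")
      case False
      then have "A \<subset> H \<inter> B" using Cons.prems X by auto
      then show ?thesis using below[of "H \<inter> B"] j by auto
    qed simp
    then show ?thesis using v 1 by linarith
  qed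
qed

text \<open>At the time \<open>t\<close> of the first piece all later times still lie ahead, so in
  the splitting of \<open>hn_positive_before\<close> the upper summand is strictly positive unless
  \<open>H\<close> is contained in \<open>B\<close>. This makes \<open>B\<close> the largest
  submodule with the value of \<open>A\<close>, which determines it uniquely.\<close>

lemma hn_first_piece:
  assumes "hn A (t # ts) (A # Ms)" "piece A B t" "hn B ts Ms" "H \<in> X" "A \<subseteq> H"
  shows "F t A \<le> F t H" and "F t H = F t A \<Longrightarrow> H \<subseteq> B"
proof -
  have B: "B \<in> X" "A \<in> X" "A \<subset> B" and P: "\<And>H. \<lbrakk>H \<in> X; A \<subseteq> H; H \<subseteq> B\<rbrakk> \<Longrightarrow> F t A \<le> F t H"
    using assms by (auto simp: piece_def)
  have v: "F t (join H B) + F t (H \<inter> B) = F t H + F t B" using valuation assms B by blast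
  have j: "join H B \<in> X" "H \<subseteq> join H B" "B \<subseteq> join H B" "H \<inter> B \<in> X"
    using assms B join_closed join_ub1 join_ub2 inter_closed by auto
  have le: "F t A \<le> F t (H \<inter> B)" using P[of "H \<inter> B"] j assms B by auto
  have less: "F t B < F t (join H B)" if "join H B \<noteq> B"
    using hn_positive_before[OF assms(3), of t "join H B"] assms(1) j that by auto
  show "F t A \<le> F t H" using v le less by (cases "join H B = B") auto
  show "H \<subseteq> B" if "F t H = F t A"
    using v le less that j by (cases "join H B = B") auto
qed

text \<open>If one chain started strictly earlier, then at that time the other chain would force
  \<open>F\<close> to be strictly larger above \<open>A\<close>, contradicting the equality at the
  first step. With equal first times both first steps are the largest submodule with the value of
  \<open>A\<close>, and the tails agree by induction.\<close>

lemma hn_unique: "\<lbrakk>hn A ts Ms; hn A ts' Ms'\<rbrakk> \<Longrightarrow> ts = ts' \<and> Ms = Ms'"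
proof (induction ts arbitrary: A Ms ts' Ms')
  case Nil
  show ?case
  proof (cases ts')
    case Nil
    then show ?thesis using \<open>hn A [] Ms\<close> \<open>hn A ts' Ms'\<close> by simp
  next
    case (Cons t us)
    then show ?thesis using \<open>hn A [] Ms\<close> \<open>hn A ts' Ms'\<close> le_Top by (auto simp: piece_def)
  qed
next
  case (Cons t ts)
  from Cons.prems(1) obtain B Ns where 1: "Ms = A # Ns" "piece A B t" "hn B ts Ns" "\<forall>s\<in>set ts. t < s"
    by auto
  show ?case
  proof (cases ts')
    case Nil
    then show ?thesis using Cons.prems 1 le_Top by (auto simp: piece_def)
  next
    case (Cons t' us)
    with Cons.prems(2) obtain B' Ns' where
      2: "Ms' = A # Ns'" "piece A B' t'" "hn B' us Ns'" "\<forall>s\<in>set us. t' < s"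
      by auto
    have no: "\<not> t < t'"
    proof
      assume "t < t'"
      then have "\<forall>u\<in>set ts'. t < u" using 2(4) Cons by auto
      from hn_positive_before[OF Cons.prems(2) this, of B] 1(2) show False by (simp add: piece_def)
    qed
    have no': "\<not> t' < t"
    proof
      assume "t' < t"
      then have "\<forall>u\<in>set (t # ts). t' < u" using 1(4) by auto
      from hn_positive_before[OF Cons.prems(1) this, of B'] 2(2) show False by (simp add: piece_def)
    qed
    from no no' have tt: "t' = t" by simp
    have "B' \<subseteq> B"
      using hn_first_piece(2)[of A t ts Ns B B'] Cons.prems(1) 1 2 tt by (auto simp: piece_def)
    moreover have "B \<subseteq> B'"
      using hn_first_piece(2)[of A t us Ns' B' B] Cons.prems(2) 1 2 tt Cons by (auto simp: piece_def)
    ultimately have "B' = B" by blast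
    then show ?thesis using Cons.IH[of B Ns us Ns'] 1 2 tt Cons by auto
  qed
qed

text \<open>Describes the first time of a chain as a minimum, the form in which it is compared with
  \<open>first_sub_time\<close>.\<close>

lemma hn_first_time:
  assumes "hn A (t # ts) Ms"
  shows "\<exists>H\<in>X. A \<subset> H \<and> F t H = F t A"
    and "\<lbrakk>H \<in> X; A \<subset> H; F s H = F s A\<rbrakk> \<Longrightarrow> t \<le> s"
proof -
  show "\<exists>H\<in>X. A \<subset> H \<and> F t H = F t A" using assms by (auto simp: piece_def)
  show "t \<le> s" if "H \<in> X" "A \<subset> H" "F s H = F s A"
  proof (rule ccontr)
    assume "\<not> t \<le> s"
    then have "\<forall>u\<in>set (t # ts). s < u" using assms by auto
    from hn_positive_before[OF assms this that(1,2)] that(3) show False by simp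
  qed
qed

text \<open>\<open>t\<close> is the infimum of the times at which some gap above \<open>A\<close> is
  nonpositive: \<open>early\<close> and finiteness bound these times below, \<open>late\<close> for
  \<open>Top\<close> provides one, and closedness makes the infimum one of them. An element of
  maximal rank among those with the value of \<open>A\<close> serves as \<open>B\<close>: anything
  strictly above has larger rank, so it cannot have the same value, and no value is smaller.\<close>

lemma first_piece_exists:
  assumes A: "A \<in> X" "A \<noteq> Top"
  obtains B t where "piece A B t" "\<And>H. \<lbrakk>H \<in> X; B \<subset> H\<rbrakk> \<Longrightarrow> F t B < F t H"
proof -
  have sub: "A \<subset> Top" using A le_Top by auto
  define G where "G = gaps A Top"
  define Z where "Z = {t. \<exists>f\<in>G. f t \<le> 0}"
  have G: "(\<lambda>t. F t H - F t A) \<in> G" if "H \<in> X" "A \<subset> H" for H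
    using that le_Top unfolding G_def gaps_def by blast
  have "\<exists>T. \<forall>f\<in>G. \<forall>t\<le>T. 0 < f t"
  proof -
    have "\<forall>f\<in>G. \<exists>T. \<forall>t\<le>T. 0 < f t"
      using early A unfolding G_def gaps_def by fastforce
    then obtain T where T: "\<And>f t. \<lbrakk>f \<in> G; t \<le> T f\<rbrakk> \<Longrightarrow> 0 < f t" by metis
    show ?thesis
    proof (intro exI ballI allI impI)
      fix f t assume "f \<in> G" "t \<le> Min (T ` G)"
      moreover then have "Min (T ` G) \<le> T f" using finite_gaps by (auto simp: G_def)
      ultimately show "0 < f t" using T by fastforce
    qed
  qed
  then obtain T where T: "\<And>f t. \<lbrakk>f \<in> G; t \<le> T\<rbrakk> \<Longrightarrow> 0 < f t" by blast
  have bdd: "bdd_below Z"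
  proof (rule bdd_belowI[of _ T])
    fix t assume "t \<in> Z"
    then obtain f where "f \<in> G" "\<not> 0 < f t" by (auto simp: Z_def not_less)
    then show "T \<le> t" using T[of f t] by linarith
  qed
  have ne: "Z \<noteq> {}"
  proof -
    from late[OF A(1) Top_in sub] obtain t where "F t Top < F t A" by blast
    then have "t \<in> Z" using G[OF Top_in sub] unfolding Z_def by (auto intro!: bexI[of _ "\<lambda>t. F t Top - F t A"])
    then show ?thesis by auto
  qed
  have "closed Z" unfolding Z_def G_def by (rule closed_gap_nonpos[OF A(1)])
  then have tZ: "Inf Z \<in> Z" using ne bdd by (intro closed_contains_Inf)
  define t where "t = Inf Z"
  have before: "0 < f s" if "f \<in> G" "s < t" for f s
  proof (rule ccontr)
    assume "\<not> 0 < f s"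
    then have "s \<in> Z" using that by (auto simp: Z_def not_less)
    then show False using cInf_lower[OF _ bdd, of s] that by (simp add: t_def)
  qed
  \<comment> \<open>The value at \<open>t\<close> is a limit from the left of positive
    values.\<close>
  have ge: "0 \<le> f t" if "f \<in> G" for f
  proof (rule tendsto_lowerbound)
    show "(f \<longlongrightarrow> f t) (at_left t)"
      using continuous_gaps[OF that[unfolded G_def] A(1)]
      by (metis UNIV_I at_within_open continuous_on_def open_UNIV filterlim_at_split)
    show "\<forall>\<^sub>F s in at_left t. 0 \<le> f s"
      using before[OF that] by (auto simp: eventually_at_filter less_imp_le)
  qed simp
  have geF: "F t A \<le> F t H" if "H \<in> X" "A \<subseteq> H" for H
    using ge[OF G[of H]] that by (cases "A = H") auto
  define Q where "Q = (\<lambda>H. H \<in> X \<and> A \<subset> H \<and> F t H = F t A)"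
  obtain H0 where H0: "Q H0"
  proof -
    from tZ obtain f where f: "f \<in> G" "f t \<le> 0" unfolding t_def Z_def by auto
    then have "f t = 0" using ge by force
    moreover from f(1) obtain H where "H \<in> X" "A \<subset> H" "f = (\<lambda>t. F t H - F t A)"
      unfolding G_def gaps_def by blast
    ultimately have "Q H" unfolding Q_def by simp
    then show ?thesis by (rule that)
  qed
  have bound: "\<forall>H. Q H \<longrightarrow> rank H < Suc (rank Top)"
  proof (intro allI impI)
    fix H assume "Q H"
    then have H: "H \<in> X" "H \<subset> Top \<or> H = Top" using le_Top[of H] unfolding Q_def by blast+
    from H(2) show "rank H < Suc (rank Top)"
    proof
      assume "H \<subset> Top"
      then show ?thesis using rank_less[OF H(1) Top_in] by simp
    qed simp
  qed
  from ex_has_greatest_nat[OF H0 bound]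
  obtain B where B: "Q B" "\<And>H. Q H \<Longrightarrow> rank H \<le> rank B" by blast
  show thesis
  proof (rule that)
    show "piece A B t" using B(1) A geF unfolding piece_def Q_def by auto
    fix H assume H: "H \<in> X" "B \<subset> H"
    then have "A \<subset> H" using B(1) by (auto simp: Q_def)
    moreover have "F t H \<noteq> F t A"
      using B(2)[of H] rank_less[of B H] H B(1) \<open>A \<subset> H\<close> by (auto simp: Q_def)
    ultimately show "F t B < F t H" using geF[of H] H B(1) by (auto simp: Q_def)
  qed
qed

text \<open>Induction on the rank left above \<open>A\<close>. The remaining times exceed
  \<open>t\<close> because at time \<open>t\<close> all gaps above \<open>B\<close> are strictly
  positive, hence also at every earlier time; a piece starting at \<open>B\<close> needs a vanishing
  gap and so must come later.\<close>

lemma hn_exists: "A \<in> X \<Longrightarrow> \<exists>ts Ms. hn A ts Ms"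
proof (induction "rank Top - rank A" arbitrary: A rule: less_induct)
  case less
  show ?case
  proof (cases "A = Top")
    case True
    then have "hn A [] [A]" by simp
    then show ?thesis by blast
  next
    case False
    then obtain B t where P: "piece A B t" and B: "\<And>H. \<lbrakk>H \<in> X; B \<subset> H\<rbrakk> \<Longrightarrow> F t B < F t H"
      using less.prems by (metis first_piece_exists)
    then have X: "B \<in> X" "A \<subset> B" by (auto simp: piece_def)
    have "rank A < rank Top"
      using rank_less[OF less.prems Top_in] le_Top[OF less.prems] False by blast
    then have "rank Top - rank B < rank Top - rank A"
      using rank_less[OF less.prems X] by linarith
    then obtain ts Ms where hn: "hn B ts Ms" using less.hyps X by blast
    have "\<forall>s\<in>set ts. t < s"
    proof (cases ts)
      case (Cons s us)
      then obtain C where C: "piece B C s" and us: "\<forall>r\<in>set us. s < r" using hn by auto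
      have "t < s"
      proof (rule ccontr)
        assume "\<not> t < s"
        then have "s \<le> t" by simp
        moreover have "\<forall>f\<in>gaps B Top. 0 < f t"
        proof
          fix f assume "f \<in> gaps B Top"
          then obtain H where "H \<in> X" "B \<subset> H" "f = (\<lambda>t. F t H - F t B)" unfolding gaps_def by blast
          then show "0 < f t" using B[of H] by simp
        qed
        moreover have "(\<lambda>t. F t C - F t B) \<in> gaps B Top"
          using C le_Top unfolding gaps_def piece_def by blast
        ultimately have "0 < F s C - F s B" using gaps_positive_before[OF X(1)] by blast
        then show False using C by (simp add: piece_def)
      qed
      then show ?thesis using us Cons by fastforce
    qed simp
    then have "hn A (t # ts) (A # Ms)" using P hn by auto
    then show ?thesis by blast
  qed
qed

text \<open>With \<open>A\<close> the zero submodule this is the existence of the first time of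
  \<open>B\<close>, which the \<open>LEAST\<close> in \<open>first_time\<close> presupposes. The
  difference is positive early and negative late, so its zero set is nonempty, closed and bounded
  below.\<close>

lemma first_zero:
  assumes "A \<in> X" "B \<in> X" "A \<subset> B"
  shows "\<exists>t. F t B = F t A \<and> (\<forall>s. F s B = F s A \<longrightarrow> t \<le> s)"
proof -
  define f where "f t = F t B - F t A" for t
  have cont: "continuous_on UNIV f" unfolding f_def using assms by (intro continuous_on_diff continuous_F)
  define Z where "Z = {t. f t = 0}"
  from early[OF assms] obtain T where T: "\<And>t. t \<le> T \<Longrightarrow> 0 < f t" unfolding f_def by auto
  from late[OF assms] obtain T' where T': "\<And>t. T' \<le> t \<Longrightarrow> f t < 0" unfolding f_def by auto
  have "\<exists>x. T \<le> x \<and> x \<le> max T T' \<and> f x = 0"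
    using T[of T] T'[of "max T T'"] cont
    by (intro IVT2') (auto intro: continuous_on_subset less_imp_le)
  then have "Z \<noteq> {}" by (auto simp: Z_def)
  moreover have bdd: "bdd_below Z"
  proof (rule bdd_belowI[of _ T])
    fix t assume "t \<in> Z"
    then show "T \<le> t" using T[of t] by (cases "t \<le> T") (auto simp: Z_def)
  qed
  moreover have "closed Z" unfolding Z_def using cont by (intro closed_Collect_eq) auto
  ultimately have "Inf Z \<in> Z" by (intro closed_contains_Inf)
  moreover have "Inf Z \<le> s" if "f s = 0" for s
    using that bdd by (intro cInf_lower) (auto simp: Z_def)
  ultimately show ?thesis by (auto simp: Z_def f_def intro!: exI[of _ "Inf Z"])
qed

text \<open>Bridge from the recursion, which suits induction, to the indexed lists of
  \<open>HN_filtration\<close>.\<close>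

lemma hn_iff:
  "hn A ts Ms \<longleftrightarrow> sorted_wrt (<) ts \<and> length Ms = Suc (length ts) \<and> hd Ms = A \<and> last Ms = Top \<and>
     (\<forall>N\<in>set Ms. N \<in> X) \<and> (\<forall>i<length ts. piece (Ms ! i) (Ms ! Suc i) (ts ! i))"
proof (induction ts arbitrary: A Ms)
  case Nil
  show ?case using Top_in by (auto simp: length_Suc_conv)
next
  case (Cons t ts)
  show ?case (is "?l \<longleftrightarrow> ?r")
  proof
    assume ?l
    then obtain B Ms' where *: "Ms = A # Ms'" "piece A B t" "hn B ts Ms'" "\<forall>s\<in>set ts. t < s" by auto
    from *(3) have IH: "sorted_wrt (<) ts" "length Ms' = Suc (length ts)" "hd Ms' = B" "last Ms' = Top"
      "\<forall>N\<in>set Ms'. N \<in> X" "\<forall>i<length ts. piece (Ms' ! i) (Ms' ! Suc i) (ts ! i)"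
      unfolding Cons.IH by auto
    have ne: "Ms' \<noteq> []" and 0: "Ms' ! 0 = B" using IH(2,3) by (cases Ms'; simp)+
    have "piece (Ms ! i) (Ms ! Suc i) ((t # ts) ! i)" if "i < length (t # ts)" for i
      using that * IH(6) 0 by (cases i) auto
    moreover have "A \<in> X" using *(2) by (simp add: piece_def)
    ultimately show ?r using * IH ne by auto
  next
    assume r: ?r
    then obtain Ms' where Ms: "Ms = A # Ms'" "length Ms' = Suc (length ts)" by (cases Ms) auto
    then obtain B Ns where Ms': "Ms' = B # Ns" by (cases Ms') auto
    have p: "piece (Ms ! i) (Ms ! Suc i) ((t # ts) ! i)" if "i < length (t # ts)" for i using r that by blast
    have "piece A B t" using p[of 0] Ms Ms' by simp
    moreover have "hn B ts Ms'" unfolding Cons.IH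
      using r Ms Ms' p[of "Suc i" for i] by auto
    ultimately show ?l using r Ms by auto
  qed
qed

end

section \<open>Subquotients of a right module\<close>

context right_module
begin

lemma act_zero: "r \<in> carrier R \<Longrightarrow> r \<odot>\<^bsub>M\<^esub> \<zero>\<^bsub>M\<^esub> = \<zero>\<^bsub>M\<^esub>"
  by (metis act_add_vector act_closed add.l_cancel_one' zero_closed l_zero)

lemma submodule_ofI:
  assumes "H \<subseteq> carrier M" "\<zero>\<^bsub>M\<^esub> \<in> H"
    and "\<And>x y. \<lbrakk>x \<in> H; y \<in> H\<rbrakk> \<Longrightarrow> x \<oplus>\<^bsub>M\<^esub> y \<in> H"
    and "\<And>x. x \<in> H \<Longrightarrow> \<ominus>\<^bsub>M\<^esub> x \<in> H"
    and "\<And>r x. \<lbrakk>r \<in> carrier R; x \<in> H\<rbrakk> \<Longrightarrow> r \<odot>\<^bsub>M\<^esub> x \<in> H"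
  shows "submodule_of R M H"
  unfolding submodule_of_def additive_subgroup_def
  using assms by (auto intro!: add.subgroupI simp: a_inv_def)

lemma submodule_ofD:
  assumes "submodule_of R M H"
  shows "H \<subseteq> carrier M" "\<zero>\<^bsub>M\<^esub> \<in> H" "\<And>x. x \<in> H \<Longrightarrow> x \<in> carrier M"
    and "\<And>x y. \<lbrakk>x \<in> H; y \<in> H\<rbrakk> \<Longrightarrow> x \<oplus>\<^bsub>M\<^esub> y \<in> H"
    and "\<And>x. x \<in> H \<Longrightarrow> \<ominus>\<^bsub>M\<^esub> x \<in> H"
    and "\<And>r x. \<lbrakk>r \<in> carrier R; x \<in> H\<rbrakk> \<Longrightarrow> r \<odot>\<^bsub>M\<^esub> x \<in> H"
proof -
  interpret H: additive_subgroup H M using assms by (simp add: submodule_of_def)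
  show "H \<subseteq> carrier M" "\<zero>\<^bsub>M\<^esub> \<in> H" "\<And>x. x \<in> H \<Longrightarrow> x \<in> carrier M"
    and "\<And>x y. \<lbrakk>x \<in> H; y \<in> H\<rbrakk> \<Longrightarrow> x \<oplus>\<^bsub>M\<^esub> y \<in> H"
    using H.a_subset by auto
  show "\<And>x. x \<in> H \<Longrightarrow> \<ominus>\<^bsub>M\<^esub> x \<in> H" using H.a_inv_closed abelian_group_axioms by auto
  show "\<And>r x. \<lbrakk>r \<in> carrier R; x \<in> H\<rbrakk> \<Longrightarrow> r \<odot>\<^bsub>M\<^esub> x \<in> H"
    using assms by (simp add: submodule_of_def)
qed

lemma submodule_carrier: "submodule_of R M (carrier M)"
  by (rule submodule_ofI) (auto intro: act_closed)

lemma submodule_zero: "submodule_of R M {\<zero>\<^bsub>M\<^esub>}"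
  by (rule submodule_ofI) (auto simp: act_zero)

section \<open>Intersections and sums of submodules\<close>

lemma submodule_inter:
  "\<lbrakk>submodule_of R M A; submodule_of R M B\<rbrakk> \<Longrightarrow> submodule_of R M (A \<inter> B)"
  by (rule submodule_ofI) (auto simp: submodule_ofD(2-6))

lemma set_add_mem: "x \<in> A <+>\<^bsub>M\<^esub> B \<longleftrightarrow> (\<exists>a\<in>A. \<exists>b\<in>B. x = a \<oplus>\<^bsub>M\<^esub> b)"
  by (auto simp: set_add_def')

lemma submodule_sum:
  assumes A: "submodule_of R M A" and B: "submodule_of R M B"
  shows "submodule_of R M (A <+>\<^bsub>M\<^esub> B)" (is ?sub)
    and "A \<subseteq> A <+>\<^bsub>M\<^esub> B" "B \<subseteq> A <+>\<^bsub>M\<^esub> B"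
    and "\<And>C. \<lbrakk>submodule_of R M C; A \<subseteq> C; B \<subseteq> C\<rbrakk> \<Longrightarrow> A <+>\<^bsub>M\<^esub> B \<subseteq> C"
proof -
  note [simp] = submodule_ofD(3)[OF A] submodule_ofD(3)[OF B]
  show ?sub
  proof (rule submodule_ofI)
    show "A <+>\<^bsub>M\<^esub> B \<subseteq> carrier M" by (auto simp: set_add_mem)
    show "\<zero>\<^bsub>M\<^esub> \<in> A <+>\<^bsub>M\<^esub> B"
      unfolding set_add_mem using submodule_ofD(2)[OF A] submodule_ofD(2)[OF B] by force
    show "x \<oplus>\<^bsub>M\<^esub> y \<in> A <+>\<^bsub>M\<^esub> B" if xy: "x \<in> A <+>\<^bsub>M\<^esub> B" "y \<in> A <+>\<^bsub>M\<^esub> B" for x y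
    proof -
      from xy obtain a b a' b' where *: "a \<in> A" "b \<in> B" "x = a \<oplus>\<^bsub>M\<^esub> b" "a' \<in> A" "b' \<in> B" "y = a' \<oplus>\<^bsub>M\<^esub> b'"
        unfolding set_add_mem by auto
      then have "x \<oplus>\<^bsub>M\<^esub> y = (a \<oplus>\<^bsub>M\<^esub> a') \<oplus>\<^bsub>M\<^esub> (b \<oplus>\<^bsub>M\<^esub> b')" by (simp add: a_ac)
      with * show ?thesis unfolding set_add_mem using submodule_ofD(4)[OF A] submodule_ofD(4)[OF B] by blast
    qed
    show "\<ominus>\<^bsub>M\<^esub> x \<in> A <+>\<^bsub>M\<^esub> B" if x: "x \<in> A <+>\<^bsub>M\<^esub> B" for x
    proof -
      from x obtain a b where *: "a \<in> A" "b \<in> B" "x = a \<oplus>\<^bsub>M\<^esub> b"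
        unfolding set_add_mem by auto
      then have "\<ominus>\<^bsub>M\<^esub> x = \<ominus>\<^bsub>M\<^esub> a \<oplus>\<^bsub>M\<^esub> \<ominus>\<^bsub>M\<^esub> b" by (simp add: minus_add)
      with * show ?thesis unfolding set_add_mem using submodule_ofD(5)[OF A] submodule_ofD(5)[OF B] by blast
    qed
    show "r \<odot>\<^bsub>M\<^esub> x \<in> A <+>\<^bsub>M\<^esub> B" if x: "r \<in> carrier R" "x \<in> A <+>\<^bsub>M\<^esub> B" for r x
    proof -
      from x obtain a b where *: "a \<in> A" "b \<in> B" "x = a \<oplus>\<^bsub>M\<^esub> b"
        unfolding set_add_mem by auto
      then have "r \<odot>\<^bsub>M\<^esub> x = r \<odot>\<^bsub>M\<^esub> a \<oplus>\<^bsub>M\<^esub> r \<odot>\<^bsub>M\<^esub> b" using x by (simp add: act_add_vector)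
      with * show ?thesis unfolding set_add_mem
        using x(1) submodule_ofD(6)[OF A] submodule_ofD(6)[OF B] by blast
    qed
  qed
  show "A \<subseteq> A <+>\<^bsub>M\<^esub> B" unfolding set_add_mem subset_iff
    using submodule_ofD(2)[OF B] by (metis r_zero submodule_ofD(3)[OF A])
  show "B \<subseteq> A <+>\<^bsub>M\<^esub> B" unfolding set_add_mem subset_iff
    using submodule_ofD(2)[OF A] by (metis l_zero submodule_ofD(3)[OF B])
  show "A <+>\<^bsub>M\<^esub> B \<subseteq> C" if "submodule_of R M C" "A \<subseteq> C" "B \<subseteq> C" for C
    using that submodule_ofD(4)[OF that(1)] unfolding set_add_mem subset_iff by metis
qed

text \<open>If a + b lies in C with a in A, then b = -a + (a + b) lies in C because A does. This is
  what allows chains to be pushed along sums in \<open>chain_sum_second_iso\<close>.\<close>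

lemma modular_law:
  assumes A: "submodule_of R M A" and B: "submodule_of R M B" and C: "submodule_of R M C" and "A \<subseteq> C"
  shows "(A <+>\<^bsub>M\<^esub> B) \<inter> C = A <+>\<^bsub>M\<^esub> (B \<inter> C)"
proof
  show "(A <+>\<^bsub>M\<^esub> B) \<inter> C \<subseteq> A <+>\<^bsub>M\<^esub> (B \<inter> C)"
  proof
    fix x assume "x \<in> (A <+>\<^bsub>M\<^esub> B) \<inter> C"
    then obtain a b where *: "a \<in> A" "b \<in> B" "x = a \<oplus>\<^bsub>M\<^esub> b" "x \<in> C" by (auto simp: set_add_mem)
    note c = submodule_ofD(3)[OF A] submodule_ofD(3)[OF B]
    have "b = \<ominus>\<^bsub>M\<^esub> a \<oplus>\<^bsub>M\<^esub> x" using * c by (simp add: r_neg1)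
    also have "\<dots> \<in> C" using * \<open>A \<subseteq> C\<close> submodule_ofD(4,5)[OF C] by blast
    finally show "x \<in> A <+>\<^bsub>M\<^esub> (B \<inter> C)" using * by (auto simp: set_add_mem)
  qed
  show "A <+>\<^bsub>M\<^esub> (B \<inter> C) \<subseteq> (A <+>\<^bsub>M\<^esub> B) \<inter> C"
  proof
    fix x assume "x \<in> A <+>\<^bsub>M\<^esub> (B \<inter> C)"
    then obtain a b where *: "a \<in> A" "b \<in> B" "b \<in> C" "x = a \<oplus>\<^bsub>M\<^esub> b" unfolding set_add_mem by blast
    then show "x \<in> (A <+>\<^bsub>M\<^esub> B) \<inter> C"
      using \<open>A \<subseteq> C\<close> submodule_ofD(4)[OF C, of a b] unfolding set_add_mem Int_iff by blast
  qed
qed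

end

text \<open>\<open>p\<close> induces an isomorphism \<open>B/A \<cong> Y\<close>. Presentations describe subquotients living on different
  types of elements by pairs of submodules of one fixed module.\<close>

definition presents ::
    "('r, 'x) ring_scheme \<Rightarrow> ('r, 'm) module \<Rightarrow> 'm set \<Rightarrow> 'm set \<Rightarrow> ('r, 'p) module \<Rightarrow> ('m \<Rightarrow> 'p) \<Rightarrow> bool"
  where
  "presents R M A B Y p \<longleftrightarrow>
     submodule_of R M B \<and> right_module R Y \<and> p ` B = carrier Y \<and>
     (\<forall>x\<in>B. \<forall>y\<in>B. p (x \<oplus>\<^bsub>M\<^esub> y) = p x \<oplus>\<^bsub>Y\<^esub> p y) \<and>
     (\<forall>r\<in>carrier R. \<forall>x\<in>B. p (r \<odot>\<^bsub>M\<^esub> x) = r \<odot>\<^bsub>Y\<^esub> p x) \<and>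
     A = {x \<in> B. p x = \<zero>\<^bsub>Y\<^esub>}"

text \<open>Transporting the module laws along a map requires that sums and products of scalars are
  scalars again. Asking for this closure alone keeps the work small for the tensor algebra, where it
  is checked directly on cosets of words.\<close>

locale closed_right_module = right_module +
  assumes scalar_add_closed: "\<lbrakk>r \<in> carrier R; s \<in> carrier R\<rbrakk> \<Longrightarrow> r \<oplus>\<^bsub>R\<^esub> s \<in> carrier R"
    and scalar_mult_closed: "\<lbrakk>r \<in> carrier R; s \<in> carrier R\<rbrakk> \<Longrightarrow> r \<otimes>\<^bsub>R\<^esub> s \<in> carrier R"
    and scalar_one_closed: "\<one>\<^bsub>R\<^esub> \<in> carrier R"
begin

text \<open>Each law of \<open>Y\<close> is the image of the same law in \<open>B\<close>. Hence
  \<open>submod\<close> and \<open>quotmod\<close> become right modules as soon as a surjection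
  compatible with the operations is exhibited.\<close>

lemma image_right_module:
  assumes B: "submodule_of R M B" and im: "p ` B = carrier Y"
    and add: "\<And>x y. \<lbrakk>x \<in> B; y \<in> B\<rbrakk> \<Longrightarrow> p (x \<oplus>\<^bsub>M\<^esub> y) = p x \<oplus>\<^bsub>Y\<^esub> p y"
    and act: "\<And>r x. \<lbrakk>r \<in> carrier R; x \<in> B\<rbrakk> \<Longrightarrow> p (r \<odot>\<^bsub>M\<^esub> x) = r \<odot>\<^bsub>Y\<^esub> p x"
    and zero: "p \<zero>\<^bsub>M\<^esub> = \<zero>\<^bsub>Y\<^esub>"
  shows "right_module R Y"
proof -
  note D = submodule_ofD[OF B]
  have pB: "x \<in> B \<Longrightarrow> p x \<in> carrier Y" for x using im by blast
  have ag: "abelian_group Y"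
  proof (rule abelian_groupI)
    show "\<And>x y. \<lbrakk>x \<in> carrier Y; y \<in> carrier Y\<rbrakk> \<Longrightarrow> x \<oplus>\<^bsub>Y\<^esub> y \<in> carrier Y"
      using D(4) by (auto simp flip: im add)
    show "\<zero>\<^bsub>Y\<^esub> \<in> carrier Y" using D(2) pB zero by force
    show "\<And>x y z. \<lbrakk>x \<in> carrier Y; y \<in> carrier Y; z \<in> carrier Y\<rbrakk> \<Longrightarrow> (x \<oplus>\<^bsub>Y\<^esub> y) \<oplus>\<^bsub>Y\<^esub> z = x \<oplus>\<^bsub>Y\<^esub> (y \<oplus>\<^bsub>Y\<^esub> z)"
      using D(3,4) by (auto simp: a_assoc simp flip: im add)
    show "\<And>x y. \<lbrakk>x \<in> carrier Y; y \<in> carrier Y\<rbrakk> \<Longrightarrow> x \<oplus>\<^bsub>Y\<^esub> y = y \<oplus>\<^bsub>Y\<^esub> x"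
      using D(3,4) by (auto simp: a_comm simp flip: im add)
    show "\<And>x. x \<in> carrier Y \<Longrightarrow> \<zero>\<^bsub>Y\<^esub> \<oplus>\<^bsub>Y\<^esub> x = x"
      using D(2,3) by (auto simp flip: im add zero)
    show "\<exists>y\<in>carrier Y. y \<oplus>\<^bsub>Y\<^esub> x = \<zero>\<^bsub>Y\<^esub>" if "x \<in> carrier Y" for x
    proof -
      from that obtain b where b: "b \<in> B" "x = p b" by (auto simp flip: im)
      then have "p (\<ominus>\<^bsub>M\<^esub> b) \<oplus>\<^bsub>Y\<^esub> x = \<zero>\<^bsub>Y\<^esub>"
        using D(3,5) by (auto simp: l_neg simp flip: add zero)
      then show ?thesis using pB D(5) b by blast
    qed
  qed
  show ?thesis
  proof (intro right_module.intro ag right_module_axioms.intro)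
    note facts = D(3,4,6) act_add_scalar act_add_vector act_mult act_one pB
      scalar_add_closed scalar_mult_closed scalar_one_closed
    fix r x assume r: "r \<in> carrier R" and x: "x \<in> carrier Y"
    from x obtain a where a: "a \<in> B" "x = p a" by (auto simp flip: im)
    show "r \<odot>\<^bsub>Y\<^esub> x \<in> carrier Y" using r a facts by (simp flip: act)
    show "(r \<oplus>\<^bsub>R\<^esub> s) \<odot>\<^bsub>Y\<^esub> x = r \<odot>\<^bsub>Y\<^esub> x \<oplus>\<^bsub>Y\<^esub> s \<odot>\<^bsub>Y\<^esub> x" if "s \<in> carrier R" for s
      using r a that facts by (simp flip: act add)
    show "(r \<otimes>\<^bsub>R\<^esub> s) \<odot>\<^bsub>Y\<^esub> x = s \<odot>\<^bsub>Y\<^esub> (r \<odot>\<^bsub>Y\<^esub> x)" if "s \<in> carrier R" for s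
      using r a that facts by (simp flip: act)
    show "r \<odot>\<^bsub>Y\<^esub> (x \<oplus>\<^bsub>Y\<^esub> y) = r \<odot>\<^bsub>Y\<^esub> x \<oplus>\<^bsub>Y\<^esub> r \<odot>\<^bsub>Y\<^esub> y" if "y \<in> carrier Y" for y
    proof -
      from that obtain b where "b \<in> B" "y = p b" by (auto simp flip: im)
      then show ?thesis using r a facts by (simp flip: act add)
    qed
  next
    fix x assume x: "x \<in> carrier Y"
    then obtain a where a: "a \<in> B" "x = p a" by (auto simp flip: im)
    then show "\<one>\<^bsub>R\<^esub> \<odot>\<^bsub>Y\<^esub> x = x"
      using D(3) act_one scalar_one_closed by (simp flip: act)
  qed
qed


lemma closed_image:
  "\<lbrakk>right_module R Y\<rbrakk> \<Longrightarrow> closed_right_module R Y"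
  by (intro closed_right_module.intro closed_right_module_axioms.intro
      scalar_add_closed scalar_mult_closed scalar_one_closed)

lemma presentsD:
  assumes "presents R M A B Y p"
  shows "submodule_of R M A" "submodule_of R M B" "A \<subseteq> B" "right_module R Y" "p ` B = carrier Y"
    and "\<And>x y. \<lbrakk>x \<in> B; y \<in> B\<rbrakk> \<Longrightarrow> p (x \<oplus>\<^bsub>M\<^esub> y) = p x \<oplus>\<^bsub>Y\<^esub> p y"
    and "\<And>r x. \<lbrakk>r \<in> carrier R; x \<in> B\<rbrakk> \<Longrightarrow> p (r \<odot>\<^bsub>M\<^esub> x) = r \<odot>\<^bsub>Y\<^esub> p x"
    and "A = {x \<in> B. p x = \<zero>\<^bsub>Y\<^esub>}" "p \<zero>\<^bsub>M\<^esub> = \<zero>\<^bsub>Y\<^esub>"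
    and "\<And>x. x \<in> B \<Longrightarrow> p (\<ominus>\<^bsub>M\<^esub> x) = \<ominus>\<^bsub>Y\<^esub> p x"
    and "\<And>x. x \<in> B \<Longrightarrow> p x \<in> carrier Y"
    and "\<And>x y. \<lbrakk>x \<in> B; y \<in> B\<rbrakk> \<Longrightarrow> p x = p y \<longleftrightarrow> x \<ominus>\<^bsub>M\<^esub> y \<in> A"
proof -
  show B: "submodule_of R M B" and Y: "right_module R Y" and im: "p ` B = carrier Y"
    and A: "A = {x \<in> B. p x = \<zero>\<^bsub>Y\<^esub>}"
    and add: "\<And>x y. \<lbrakk>x \<in> B; y \<in> B\<rbrakk> \<Longrightarrow> p (x \<oplus>\<^bsub>M\<^esub> y) = p x \<oplus>\<^bsub>Y\<^esub> p y"
    and act: "\<And>r x. \<lbrakk>r \<in> carrier R; x \<in> B\<rbrakk> \<Longrightarrow> p (r \<odot>\<^bsub>M\<^esub> x) = r \<odot>\<^bsub>Y\<^esub> p x"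
    using assms unfolding presents_def by auto
  interpret Y: right_module R Y by (rule Y)
  note D = submodule_ofD[OF B]
  show pB: "x \<in> B \<Longrightarrow> p x \<in> carrier Y" for x using im by blast
  show zero: "p \<zero>\<^bsub>M\<^esub> = \<zero>\<^bsub>Y\<^esub>"
    using add[of "\<zero>\<^bsub>M\<^esub>" "\<zero>\<^bsub>M\<^esub>"] D(2) pB by (simp add: Y.add.l_cancel_one')
  show neg: "p (\<ominus>\<^bsub>M\<^esub> x) = \<ominus>\<^bsub>Y\<^esub> p x" if "x \<in> B" for x
    using add[of "\<ominus>\<^bsub>M\<^esub> x" x] that D pB by (metis Y.minus_equality zero l_neg)
  show "A \<subseteq> B" using A by auto
  show "submodule_of R M A"
    unfolding A by (rule submodule_ofI) (use D zero neg add act Y.act_zero in auto)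
  show "p x = p y \<longleftrightarrow> x \<ominus>\<^bsub>M\<^esub> y \<in> A" if "x \<in> B" "y \<in> B" for x y
  proof -
    have "x \<ominus>\<^bsub>M\<^esub> y \<in> B" using that D by (simp add: a_minus_def)
    moreover have "p (x \<ominus>\<^bsub>M\<^esub> y) = p x \<ominus>\<^bsub>Y\<^esub> p y" using that D add neg by (simp add: a_minus_def)
    moreover have "p x \<ominus>\<^bsub>Y\<^esub> p y = \<zero>\<^bsub>Y\<^esub> \<longleftrightarrow> p x = p y"
    proof
      assume "p x \<ominus>\<^bsub>Y\<^esub> p y = \<zero>\<^bsub>Y\<^esub>"
      moreover have "(p x \<ominus>\<^bsub>Y\<^esub> p y) \<oplus>\<^bsub>Y\<^esub> p y = p x"
        using pB that by (simp add: a_minus_def Y.a_assoc Y.l_neg)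
      ultimately show "p x = p y" using pB that by simp
    qed (use pB that in \<open>simp add: a_minus_def Y.r_neg\<close>)
    ultimately show ?thesis using A by auto
  qed
qed

lemma presentsI:
  assumes B: "submodule_of R M B" and im: "p ` B = carrier Y"
    and add: "\<And>x y. \<lbrakk>x \<in> B; y \<in> B\<rbrakk> \<Longrightarrow> p (x \<oplus>\<^bsub>M\<^esub> y) = p x \<oplus>\<^bsub>Y\<^esub> p y"
    and act: "\<And>r x. \<lbrakk>r \<in> carrier R; x \<in> B\<rbrakk> \<Longrightarrow> p (r \<odot>\<^bsub>M\<^esub> x) = r \<odot>\<^bsub>Y\<^esub> p x"
    and ker: "A = {x \<in> B. p x = \<zero>\<^bsub>Y\<^esub>}" and zero: "p \<zero>\<^bsub>M\<^esub> = \<zero>\<^bsub>Y\<^esub>"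
  shows "presents R M A B Y p"
  unfolding presents_def using image_right_module[OF B im add act zero] B im add act ker by blast

lemma presents_id: "submodule_of R M B \<Longrightarrow> presents R M {\<zero>\<^bsub>M\<^esub>} B (submod M B) id"
  by (rule presentsI) (auto simp: submod_def submodule_ofD(2))

section \<open>The correspondence between submodules of a subquotient and submodules in an
  interval\<close>

lemma presents_restrict:
  assumes P: "presents R M A B Y p" and H: "submodule_of R M H" "A \<subseteq> H" "H \<subseteq> B"
  shows "presents R M A H (submod Y (p ` H)) p"
proof -
  note D = presentsD[OF P]
  show ?thesis
  proof (rule presentsI)
    show "A = {x \<in> H. p x = \<zero>\<^bsub>submod Y (p ` H)\<^esub>}" using D(8) H by (auto simp: submod_def)
    show "p (x \<oplus>\<^bsub>M\<^esub> y) = p x \<oplus>\<^bsub>submod Y (p ` H)\<^esub> p y" if "x \<in> H" "y \<in> H" for x y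
      using D(6)[of x y] that H by (auto simp: submod_def)
    show "p (r \<odot>\<^bsub>M\<^esub> x) = r \<odot>\<^bsub>submod Y (p ` H)\<^esub> p x" if "r \<in> carrier R" "x \<in> H" for r x
      using D(7)[of r x] that H by (auto simp: submod_def)
  qed (use H D(9) in \<open>auto simp: submod_def\<close>)
qed

lemma presents_submodule_image:
  assumes P: "presents R M A B Y p" and H: "submodule_of R M H" "H \<subseteq> B"
  shows "submodule_of R Y (p ` H)"
proof -
  note D = presentsD[OF P] and DH = submodule_ofD[OF H(1)]
  interpret Y: right_module R Y by (rule D)
  show ?thesis
  proof (rule Y.submodule_ofI)
    show "p ` H \<subseteq> carrier Y" using D H by blast
    show "\<zero>\<^bsub>Y\<^esub> \<in> p ` H" using D(9) DH(2) by (metis imageI)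
    show "y \<oplus>\<^bsub>Y\<^esub> y' \<in> p ` H" if "y \<in> p ` H" "y' \<in> p ` H" for y y'
    proof -
      from that obtain h h' where "h \<in> H" "h' \<in> H" "y = p h" "y' = p h'" by blast
      then show ?thesis using DH(4)[of h h'] D(6)[of h h'] H by (metis imageI subsetD)
    qed
    show "\<ominus>\<^bsub>Y\<^esub> y \<in> p ` H" if "y \<in> p ` H" for y
    proof -
      from that obtain h where "h \<in> H" "y = p h" by blast
      then show ?thesis using DH(5)[of h] D(10)[of h] H by (metis imageI subsetD)
    qed
    show "r \<odot>\<^bsub>Y\<^esub> y \<in> p ` H" if "r \<in> carrier R" "y \<in> p ` H" for r y
    proof -
      from that obtain h where "h \<in> H" "y = p h" by blast
      then show ?thesis using DH(6)[of r h] D(7)[of r h] H that(1) by (metis imageI subsetD)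
    qed
  qed
qed

lemma presents_preimage:
  assumes P: "presents R M A B Y p" and H: "submodule_of R Y H"
  shows "submodule_of R M {x \<in> B. p x \<in> H}" "A \<subseteq> {x \<in> B. p x \<in> H}" "p ` {x \<in> B. p x \<in> H} = H"
proof -
  note D = presentsD[OF P]
  interpret Y: right_module R Y by (rule D)
  note DH = Y.submodule_ofD[OF H] and DB = submodule_ofD[OF D(2)]
  show "submodule_of R M {x \<in> B. p x \<in> H}"
    by (rule submodule_ofI) (use D(6,7,9,10) DH(2,4-6) DB in auto)
  show "A \<subseteq> {x \<in> B. p x \<in> H}" using D(8) DH(2) by auto
  show "p ` {x \<in> B. p x \<in> H} = H"
  proof
    show "H \<subseteq> p ` {x \<in> B. p x \<in> H}"
    proof
      fix y assume "y \<in> H"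
      then have "y \<in> p ` B" using D(5) DH(1) by auto
      then show "y \<in> p ` {x \<in> B. p x \<in> H}" using \<open>y \<in> H\<close> by auto
    qed
  qed auto
qed

lemma presents_preimage_image:
  assumes P: "presents R M A B Y p" and H: "submodule_of R M H" "A \<subseteq> H" "H \<subseteq> B"
  shows "{x \<in> B. p x \<in> p ` H} = H"
proof
  note D = presentsD[OF P] and DH = submodule_ofD[OF H(1)] and DB = submodule_ofD[OF presentsD(2)[OF P]]
  show "{x \<in> B. p x \<in> p ` H} \<subseteq> H"
  proof clarify
    fix x h assume x: "x \<in> B" "h \<in> H" "p x = p h"
    then have "x \<ominus>\<^bsub>M\<^esub> h \<in> H" using D(12)[of x h] H by blast
    then have "(x \<ominus>\<^bsub>M\<^esub> h) \<oplus>\<^bsub>M\<^esub> h \<in> H" using x DH by blast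
    moreover have "(x \<ominus>\<^bsub>M\<^esub> h) \<oplus>\<^bsub>M\<^esub> h = x" using x DH(3) DB(3) by (simp add: a_minus_def a_assoc l_neg)
    ultimately show "x \<in> H" by simp
  qed
qed (use H in auto)

text \<open>A subquotient of a subquotient of \<open>M\<close> is again described by an interval of
  submodules of \<open>M\<close>. This brings composition series of \<open>Y\<close> back to chains
  in \<open>M\<close>.\<close>

lemma presents_comp:
  assumes P: "presents R M A B Y p" and Q: "presents R Y A' B' W q"
  shows "presents R M {x \<in> B. p x \<in> A'} {x \<in> B. p x \<in> B'} W (q \<circ> p)"
proof -
  note D = presentsD[OF P]
  interpret Y: closed_right_module R Y by (rule closed_image[OF D(4)])
  note E = Y.presentsD[OF Q]
  note pre = presents_preimage[OF P E(2)]
  show ?thesis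
  proof (rule presentsI[OF pre(1)])
    show "(q \<circ> p) ` {x \<in> B. p x \<in> B'} = carrier W"
      unfolding image_comp[symmetric] pre(3) by (rule E)
    show "{x \<in> B. p x \<in> A'} = {x \<in> {x \<in> B. p x \<in> B'}. (q \<circ> p) x = \<zero>\<^bsub>W\<^esub>}"
      using E(3,8) by auto
  qed (use D(6,7,9,11) E(6,7,9) in auto)
qed

lemma presents_quotient:
  assumes A: "submodule_of R M A" and B: "submodule_of R M B" and "A \<subseteq> B"
  shows "presents R M A B (quotmod (submod M B) A) (\<lambda>x. A +>\<^bsub>M\<^esub> x)"
proof -
  interpret A: abelian_subgroup A M
    using A abelian_group_axioms by (auto simp: submodule_of_def intro: abelian_subgroupI3)
  note DA = submodule_ofD[OF A] and DB = submodule_ofD[OF B]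
  have coset: "(+>\<^bsub>submod M B\<^esub>) = (+>\<^bsub>M\<^esub>)" by (auto simp: submod_def a_r_coset_def r_coset_def fun_eq_iff)
  have sum: "(<+>\<^bsub>submod M B\<^esub>) = (<+>\<^bsub>M\<^esub>)" by (auto simp: submod_def set_add_def set_mult_def fun_eq_iff)
  have car: "a_rcosets\<^bsub>submod M B\<^esub> A = (\<lambda>x. A +>\<^bsub>M\<^esub> x) ` B"
    unfolding A_RCOSETS_def' by (auto simp: submod_def a_r_coset_def')
  have eqI: "A +>\<^bsub>M\<^esub> x = A +>\<^bsub>M\<^esub> y" if "x \<in> A +>\<^bsub>M\<^esub> y" "y \<in> carrier M" for x y
    using A.a_repr_independence' that by (metis DA(1) a_r_coset_subset_G subsetD)
  show ?thesis
  proof (rule presentsI[OF B])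
    show "(\<lambda>x. A +>\<^bsub>M\<^esub> x) ` B = carrier (quotmod (submod M B) A)"
      by (simp add: quotmod_def car)
    show "A +>\<^bsub>M\<^esub> (x \<oplus>\<^bsub>M\<^esub> y) = (A +>\<^bsub>M\<^esub> x) \<oplus>\<^bsub>quotmod (submod M B) A\<^esub> (A +>\<^bsub>M\<^esub> y)" if "x \<in> B" "y \<in> B" for x y
      using that DB(3) by (simp add: quotmod_def sum A.a_rcos_sum)
    show "A +>\<^bsub>M\<^esub> (r \<odot>\<^bsub>M\<^esub> x) = r \<odot>\<^bsub>quotmod (submod M B) A\<^esub> (A +>\<^bsub>M\<^esub> x)" if rx: "r \<in> carrier R" "x \<in> B" for r x
    proof -
      have x: "x \<in> carrier M" using rx DB by auto
      \<comment> \<open>\<open>quotmod\<close> lets \<open>r\<close> act by a union over all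
        representatives. The union collapses to one coset, since representatives differ by elements
        of \<open>A\<close> and \<open>r\<close> maps \<open>A\<close> into itself.\<close>
      have "A +>\<^bsub>M\<^esub> (r \<odot>\<^bsub>M\<^esub> y) = A +>\<^bsub>M\<^esub> (r \<odot>\<^bsub>M\<^esub> x)" if "y \<in> A +>\<^bsub>M\<^esub> x" for y
      proof -
        from that obtain a where a: "a \<in> A" "y = a \<oplus>\<^bsub>M\<^esub> x" by (auto simp: a_r_coset_def')
        then have "r \<odot>\<^bsub>M\<^esub> y = r \<odot>\<^bsub>M\<^esub> a \<oplus>\<^bsub>M\<^esub> r \<odot>\<^bsub>M\<^esub> x" using rx x DA by (simp add: act_add_vector)
        then have "r \<odot>\<^bsub>M\<^esub> y \<in> A +>\<^bsub>M\<^esub> (r \<odot>\<^bsub>M\<^esub> x)" using DA(6)[OF rx(1) a(1)] by (auto simp: a_r_coset_def')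
        then show ?thesis using eqI act_closed rx x by blast
      qed
      moreover have "x \<in> A +>\<^bsub>M\<^esub> x" using x A.a_rcos_self by simp
      ultimately have "(\<Union>y\<in>A +>\<^bsub>M\<^esub> x. A +>\<^bsub>M\<^esub> (r \<odot>\<^bsub>M\<^esub> y)) = A +>\<^bsub>M\<^esub> (r \<odot>\<^bsub>M\<^esub> x)" by blast
      moreover have "smult (submod M B) = smult M" by (simp add: submod_def)
      ultimately show ?thesis by (simp add: quotmod_def coset)
    qed
    have self: "A +>\<^bsub>M\<^esub> a = A" if "a \<in> A" for a using that A.a_rcos_const by blast
    show "A = {x \<in> B. A +>\<^bsub>M\<^esub> x = \<zero>\<^bsub>quotmod (submod M B) A\<^esub>}"
    proof -
      have "A +>\<^bsub>M\<^esub> x = A \<Longrightarrow> x \<in> A" if "x \<in> B" for x using A.a_rcos_self[OF DB(3)[OF that]] by simp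
      then show ?thesis using self \<open>A \<subseteq> B\<close> by (auto simp: quotmod_def)
    qed
    show "A +>\<^bsub>M\<^esub> \<zero>\<^bsub>M\<^esub> = \<zero>\<^bsub>quotmod (submod M B) A\<^esub>" using self DA(2) by (simp add: quotmod_def)
  qed
qed

text \<open>\<open>p\<close> and \<open>q\<close> have the same kernel \<open>A\<close>, so
  \<open>q\<close> factors through \<open>p\<close>; the choice of a preimage under \<open>p\<close>
  does not affect the value of \<open>q\<close>.\<close>

lemma presents_mod_iso:
  assumes P: "presents R M A B Y p" and Q: "presents R M A B W q"
  shows "mod_iso R Y W"
proof -
  note D = presentsD[OF P] and E = presentsD[OF Q] and DB = submodule_ofD[OF presentsD(2)[OF P]]
  define h where "h y = q (SOME x. x \<in> B \<and> p x = y)" for y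
  have h: "h (p x) = q x" if "x \<in> B" for x
  proof -
    have "(SOME z. z \<in> B \<and> p z = p x) \<in> B \<and> p (SOME z. z \<in> B \<and> p z = p x) = p x"
      by (rule someI[of _ x]) (use that in auto)
    then show ?thesis unfolding h_def using D(12) E(12) that by blast
  qed
  have inj: "inj_on h (carrier Y)"
  proof (rule inj_onI)
    fix y y' assume "y \<in> carrier Y" "y' \<in> carrier Y" "h y = h y'"
    then obtain x x' where "x \<in> B" "x' \<in> B" "y = p x" "y' = p x'" using D(5) by blast
    then show "y = y'" using h D(12) E(12) \<open>h y = h y'\<close> by metis
  qed
  moreover have "h ` carrier Y = carrier W"
    unfolding D(5)[symmetric] E(5)[symmetric] by (auto simp: h image_image)
  moreover have "h (y \<oplus>\<^bsub>Y\<^esub> y') = h y \<oplus>\<^bsub>W\<^esub> h y'" if yy: "y \<in> carrier Y" "y' \<in> carrier Y" for y y'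
  proof -
    obtain x x' where "x \<in> B" "x' \<in> B" "y = p x" "y' = p x'" using D(5) yy by blast
    then show ?thesis using h DB(4) E(6) by (simp flip: D(6))
  qed
  moreover have "h (r \<odot>\<^bsub>Y\<^esub> y) = r \<odot>\<^bsub>W\<^esub> h y" if ry: "r \<in> carrier R" "y \<in> carrier Y" for r y
  proof -
    obtain x where "x \<in> B" "y = p x" using D(5) ry by blast
    then show ?thesis using h DB(6) E(7) ry by (simp flip: D(7))
  qed
  ultimately show ?thesis unfolding mod_iso_def bij_betw_def by blast
qed

end

lemma mod_iso_trans:
  assumes "mod_iso R X Y" "mod_iso R Y Z"
  shows "mod_iso R X Z"
proof -
  from assms(1) obtain f where f: "bij_betw f (carrier X) (carrier Y)"
      "\<And>x y. \<lbrakk>x \<in> carrier X; y \<in> carrier X\<rbrakk> \<Longrightarrow> f (x \<oplus>\<^bsub>X\<^esub> y) = f x \<oplus>\<^bsub>Y\<^esub> f y"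
      "\<And>r x. \<lbrakk>r \<in> carrier R; x \<in> carrier X\<rbrakk> \<Longrightarrow> f (r \<odot>\<^bsub>X\<^esub> x) = r \<odot>\<^bsub>Y\<^esub> f x"
    unfolding mod_iso_def by blast
  from assms(2) obtain g where g: "bij_betw g (carrier Y) (carrier Z)"
      "\<And>x y. \<lbrakk>x \<in> carrier Y; y \<in> carrier Y\<rbrakk> \<Longrightarrow> g (x \<oplus>\<^bsub>Y\<^esub> y) = g x \<oplus>\<^bsub>Z\<^esub> g y"
      "\<And>r x. \<lbrakk>r \<in> carrier R; x \<in> carrier Y\<rbrakk> \<Longrightarrow> g (r \<odot>\<^bsub>Y\<^esub> x) = r \<odot>\<^bsub>Z\<^esub> g x"
    unfolding mod_iso_def by blast
  have fX: "x \<in> carrier X \<Longrightarrow> f x \<in> carrier Y" for x using f(1) by (auto simp: bij_betw_def)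
  show ?thesis unfolding mod_iso_def
    by (rule exI[of _ "g \<circ> f"]) (use bij_betw_trans[OF f(1) g(1)] f g fX in auto)
qed

section \<open>Jordan--Hoelder multiplicities\<close>

lemma sum_indicator_eq_card:
  "finite A \<Longrightarrow> (\<Sum>k\<in>A. if P k then 1 else 0) = card {k\<in>A. P k}"
  by (simp flip: sum.inter_filter)

context closed_right_module
begin

section \<open>Covers of submodules and simple subquotients\<close>

definition covers :: "'c set \<Rightarrow> 'c set \<Rightarrow> bool" where
  "covers A B \<longleftrightarrow> submodule_of R M A \<and> submodule_of R M B \<and> A \<subset> B \<and>
     (\<forall>H. submodule_of R M H \<longrightarrow> A \<subseteq> H \<longrightarrow> H \<subseteq> B \<longrightarrow> H = A \<or> H = B)"

lemma coversD:
  assumes "covers A B"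
  shows "submodule_of R M A" "submodule_of R M B" "A \<subset> B" "A \<subseteq> B"
    "\<And>H. \<lbrakk>submodule_of R M H; A \<subseteq> H; H \<subseteq> B\<rbrakk> \<Longrightarrow> H = A \<or> H = B"
proof -
  note C = assms[unfolded covers_def]
  show "submodule_of R M A" "submodule_of R M B" "A \<subset> B" using C by simp_all
  then show "A \<subseteq> B" by simp
  show "H = A \<or> H = B" if "submodule_of R M H" "A \<subseteq> H" "H \<subseteq> B" for H
    using C that by simp
qed

lemma preimage_zero:
  assumes "presents R M A B Y p"
  shows "{x \<in> B. p x \<in> {\<zero>\<^bsub>Y\<^esub>}} = A"
  unfolding singleton_iff using presentsD(8)[OF assms] by (rule sym)

lemma preimage_carrier:
  assumes "presents R M A B Y p"
  shows "{x \<in> B. p x \<in> carrier Y} = B"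
  using presentsD(11)[OF assms] by auto

lemma presents_nonzero_iff:
  assumes P: "presents R M A B Y p"
  shows "nonzero_mod Y \<longleftrightarrow> A \<noteq> B"
proof -
  have "A = B \<longleftrightarrow> carrier Y = {\<zero>\<^bsub>Y\<^esub>}"
  proof
    assume "A = B"
    then have "p ` B \<subseteq> {\<zero>\<^bsub>Y\<^esub>}" using preimage_zero[OF P] by auto
    moreover have "\<zero>\<^bsub>Y\<^esub> \<in> p ` B"
      using imageI[OF submodule_ofD(2)[OF presentsD(2)[OF P]], of p] presentsD(9)[OF P] by simp
    ultimately show "carrier Y = {\<zero>\<^bsub>Y\<^esub>}" using presentsD(5)[OF P] by auto
  next
    assume "carrier Y = {\<zero>\<^bsub>Y\<^esub>}"
    then show "A = B" using preimage_zero[OF P] preimage_carrier[OF P] by simp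
  qed
  then show ?thesis by (auto simp: nonzero_mod_def)
qed

lemma presents_simple_iff:
  assumes P: "presents R M A B Y p"
  shows "simple_mod R Y \<longleftrightarrow> covers A B"
proof
  note D = presentsD[OF P]
  assume S: "simple_mod R Y"
  have "A \<noteq> B" using S presents_nonzero_iff[OF P] by (simp add: simple_mod_def)
  moreover have "H = A \<or> H = B" if H: "submodule_of R M H" "A \<subseteq> H" "H \<subseteq> B" for H
  proof -
    have "p ` H = {\<zero>\<^bsub>Y\<^esub>} \<or> p ` H = carrier Y"
      using S presents_submodule_image[OF P H(1,3)] by (simp add: simple_mod_def)
    then show ?thesis
      using preimage_zero[OF P] preimage_carrier[OF P] presents_preimage_image[OF P H] by auto
  qed
  ultimately show "covers A B" using D(1-3) unfolding covers_def by blast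
next
  note D = presentsD[OF P]
  assume C: "covers A B"
  show "simple_mod R Y" unfolding simple_mod_def
  proof (intro conjI allI impI)
    show "nonzero_mod Y" using C presents_nonzero_iff[OF P] by (auto simp: covers_def)
    fix H assume H: "submodule_of R Y H"
    note pre = presents_preimage[OF P H]
    have "{x \<in> B. p x \<in> H} = A \<or> {x \<in> B. p x \<in> H} = B"
      using coversD(5)[OF C pre(1,2)] by blast
    then show "H = {\<zero>\<^bsub>Y\<^esub>} \<or> H = carrier Y"
    proof
      assume A: "{x \<in> B. p x \<in> H} = A"
      then have "H = p ` A" using pre(3) by simp
      also have "\<dots> = {\<zero>\<^bsub>Y\<^esub>}"
      proof
        show "p ` A \<subseteq> {\<zero>\<^bsub>Y\<^esub>}" using preimage_zero[OF P] by auto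
        show "{\<zero>\<^bsub>Y\<^esub>} \<subseteq> p ` A" using imageI[OF submodule_ofD(2)[OF D(1)], of p] D(9) by simp
      qed
      finally show ?thesis by simp
    next
      assume "{x \<in> B. p x \<in> H} = B"
      then show ?thesis using pre(3) D(5) by simp
    qed
  qed
qed

lemma covers_iff_simple:
  "\<lbrakk>submodule_of R M A; submodule_of R M B; A \<subseteq> B\<rbrakk> \<Longrightarrow>
     covers A B \<longleftrightarrow> simple_mod R (quotmod (submod M B) A)"
  using presents_simple_iff presents_quotient by blast

text \<open>Second isomorphism theorem with a common target: elements of \<open>A\<close> die under
  \<open>p\<close>, so its restriction to \<open>B\<close> is still onto, with kernel A \<inter> B.
  As one map onto one module \<open>Y\<close> presents both quotients, simplicity and isomorphism
  type agree at once.\<close>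

lemma presents_second_iso:
  assumes P: "presents R M A (A <+>\<^bsub>M\<^esub> B) Y p" and B: "submodule_of R M B"
  shows "presents R M (A \<inter> B) B Y p"
proof -
  note D = presentsD[OF P]
  note S = submodule_sum[OF D(1) B]
  interpret Y: right_module R Y by (rule D(4))
  show ?thesis
  proof (rule presentsI[OF B])
    show "p ` B = carrier Y"
    proof
      show "p ` B \<subseteq> carrier Y" using D(5) S(3) by blast
      show "carrier Y \<subseteq> p ` B"
      proof
        fix y assume "y \<in> carrier Y"
        then obtain x where x: "x \<in> A <+>\<^bsub>M\<^esub> B" "y = p x" using D(5) by blast
        then obtain a b where ab: "a \<in> A" "b \<in> B" "x = a \<oplus>\<^bsub>M\<^esub> b" by (auto simp: set_add_mem)
        have b: "b \<in> A <+>\<^bsub>M\<^esub> B" using S(3) ab(2) by blast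
        have "p x = p a \<oplus>\<^bsub>Y\<^esub> p b" using D(6)[OF subsetD[OF S(2) ab(1)] b] ab(3) by simp
        also have "p a = \<zero>\<^bsub>Y\<^esub>"
        proof -
          have "a \<in> {x \<in> A <+>\<^bsub>M\<^esub> B. p x = \<zero>\<^bsub>Y\<^esub>}" using ab(1) unfolding D(8)[symmetric] .
          then show ?thesis by simp
        qed
        also have "\<zero>\<^bsub>Y\<^esub> \<oplus>\<^bsub>Y\<^esub> p b = p b" using D(11)[OF b] by (rule Y.l_zero)
        finally have "p x = p b" .
        then show "y \<in> p ` B" using x ab by auto
      qed
    qed
    have "x \<in> A \<longleftrightarrow> p x = \<zero>\<^bsub>Y\<^esub>" if "x \<in> B" for x
      by (subst D(8)) (use S(3) that in auto)
    then show "A \<inter> B = {x \<in> B. p x = \<zero>\<^bsub>Y\<^esub>}" by auto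
    show "p (x \<oplus>\<^bsub>M\<^esub> y) = p x \<oplus>\<^bsub>Y\<^esub> p y" if "x \<in> B" "y \<in> B" for x y
      by (rule D(6)) (use S(3) that in auto)
    show "p (r \<odot>\<^bsub>M\<^esub> x) = r \<odot>\<^bsub>Y\<^esub> p x" if "r \<in> carrier R" "x \<in> B" for r x
      by (rule D(7)) (use S(3) that in auto)
    show "p \<zero>\<^bsub>M\<^esub> = \<zero>\<^bsub>Y\<^esub>" by (rule D(9))
  qed
qed

lemma presents_second_quotient:
  assumes "submodule_of R M A" "submodule_of R M B"
  obtains p where "presents R M A (A <+>\<^bsub>M\<^esub> B) (quotmod (submod M (A <+>\<^bsub>M\<^esub> B)) A) p"
    "presents R M (A \<inter> B) B (quotmod (submod M (A <+>\<^bsub>M\<^esub> B)) A) p"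
  using presents_quotient[OF assms(1) submodule_sum(1,2)[OF assms]] presents_second_iso assms by blast

lemma covers_second_iso:
  assumes "submodule_of R M A" "submodule_of R M B"
  shows "covers (A \<inter> B) B \<longleftrightarrow> covers A (A <+>\<^bsub>M\<^esub> B)"
proof -
  obtain p where "presents R M A (A <+>\<^bsub>M\<^esub> B) (quotmod (submod M (A <+>\<^bsub>M\<^esub> B)) A) p"
    "presents R M (A \<inter> B) B (quotmod (submod M (A <+>\<^bsub>M\<^esub> B)) A) p"
    by (rule presents_second_quotient[OF assms])
  then show ?thesis by (simp only: presents_simple_iff[symmetric])
qed

text \<open>A weight with values 0 and 1, so that its sum along a composition series is the
  multiplicity of \<open>T\<close>.\<close>

definition factor_count :: "('a, 't) module \<Rightarrow> 'c set \<Rightarrow> 'c set \<Rightarrow> nat" where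
  "factor_count T A B = (if mod_iso R (quotmod (submod M B) A) T then 1 else 0)"

lemma presents_mod_iso_iff:
  "\<lbrakk>presents R M A B Y p; presents R M A B W q\<rbrakk> \<Longrightarrow> mod_iso R Y T \<longleftrightarrow> mod_iso R W T"
  using presents_mod_iso mod_iso_trans by metis

lemma factor_count_presented:
  assumes P: "presents R M A B Y p"
  shows "factor_count T A B = (if mod_iso R Y T then 1 else 0)"
  unfolding factor_count_def
  using presents_mod_iso_iff[OF P presents_quotient[OF presentsD(1-3)[OF P]], of T] by simp

text \<open>Jordan--Hoelder holds for every weight on covers with the following property, since two
  covers \<open>X\<close>, \<open>Y\<close> of \<open>A\<close> lead to a common continuation through \<open>X + Y\<close>.\<close>

definition perspective_invariant :: "('c set \<Rightarrow> 'c set \<Rightarrow> nat) \<Rightarrow> bool" where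
  "perspective_invariant c \<longleftrightarrow> (\<forall>A B. submodule_of R M A \<longrightarrow> submodule_of R M B \<longrightarrow>
     c (A \<inter> B) B = c A (A <+>\<^bsub>M\<^esub> B))"

lemma perspective_invariantD:
  "\<lbrakk>perspective_invariant c; submodule_of R M A; submodule_of R M B\<rbrakk> \<Longrightarrow>
     c A (A <+>\<^bsub>M\<^esub> B) = c (A \<inter> B) B"
  unfolding perspective_invariant_def by simp

lemma perspective_invariant_factor_count: "perspective_invariant (factor_count T)"
  unfolding perspective_invariant_def
proof (intro allI impI)
  fix A B assume A: "submodule_of R M A" and B: "submodule_of R M B"
  obtain p where "presents R M A (A <+>\<^bsub>M\<^esub> B) (quotmod (submod M (A <+>\<^bsub>M\<^esub> B)) A) p"
    "presents R M (A \<inter> B) B (quotmod (submod M (A <+>\<^bsub>M\<^esub> B)) A) p"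
    by (rule presents_second_quotient[OF A B])
  then show "factor_count T (A \<inter> B) B = factor_count T A (A <+>\<^bsub>M\<^esub> B)"
    by (simp only: factor_count_presented)
qed

section \<open>Weights summed along chains of covers\<close>

lemma set_add_commute:
  assumes "submodule_of R M A" "submodule_of R M B"
  shows "A <+>\<^bsub>M\<^esub> B = B <+>\<^bsub>M\<^esub> A"
  using submodule_sum[OF assms] submodule_sum[OF assms(2,1)] by (intro equalityI) simp_all

text \<open>A relation and not a function, since the total may a priori depend on the chain; that it
  does not is the Jordan--Hoelder theorem \<open>chain_sum_unique\<close>.\<close>

inductive chain_sum :: "('c set \<Rightarrow> 'c set \<Rightarrow> nat) \<Rightarrow> 'c set \<Rightarrow> 'c set \<Rightarrow> nat \<Rightarrow> bool" for c where
  chain_refl: "submodule_of R M A \<Longrightarrow> chain_sum c A A 0"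
| chain_step: "\<lbrakk>covers A X; chain_sum c X B k\<rbrakk> \<Longrightarrow> chain_sum c A B (c A X + k)"

lemma chain_sumD:
  "chain_sum c A B k \<Longrightarrow> submodule_of R M A \<and> submodule_of R M B \<and> A \<subseteq> B"
  by (induction rule: chain_sum.induct) (auto simp: covers_def)

lemma chain_sum_append:
  "\<lbrakk>chain_sum c A B k; chain_sum c B C l\<rbrakk> \<Longrightarrow> chain_sum c A C (k + l)"
  by (induction rule: chain_sum.induct) (auto simp: add.assoc intro: chain_step)

text \<open>Adding \<open>A\<close> to each member turns a chain from A \<inter> B to
  \<open>B\<close> into a chain from \<open>A\<close> to A + B with the same weights. After one step
  \<open>A\<close> is replaced by A + X, and the modular law gives (A + X) \<inter> B = X, which is
  the hypothesis needed to continue.\<close>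

lemma chain_sum_second_iso:
  assumes c: "perspective_invariant c"
  shows "\<lbrakk>chain_sum c A0 B k; submodule_of R M A; A \<inter> B = A0\<rbrakk> \<Longrightarrow> chain_sum c A (A <+>\<^bsub>M\<^esub> B) k"
proof (induction arbitrary: A rule: chain_sum.induct)
  case (chain_refl B)
  then have "A <+>\<^bsub>M\<^esub> B = A" using submodule_sum[OF chain_refl(2,1)] chain_refl by blast
  then show ?case using chain_refl chain_sum.chain_refl by simp
next
  case (chain_step A0 X B k)
  have B: "submodule_of R M B" "X \<subseteq> B" using chain_sumD[OF chain_step(2)] by auto
  note X = coversD[OF chain_step(1)]
  note SX = submodule_sum[OF chain_step(4) X(2)] and SB = submodule_sum[OF chain_step(4) B(1)]
  have AX: "A \<inter> X = A0" using chain_step X B by blast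
  define A' where "A' = A <+>\<^bsub>M\<^esub> X"
  note S' = submodule_sum[OF SX(1) B(1)]
  have "X <+>\<^bsub>M\<^esub> A = A'"
    unfolding A'_def by (rule set_add_commute[OF X(2) chain_step(4)])
  then have "A' \<inter> B = X <+>\<^bsub>M\<^esub> (A \<inter> B)"
    using modular_law[OF X(2) chain_step(4) B] by simp
  also have "\<dots> = X"
    using submodule_sum(2)[OF X(2) X(1)] submodule_sum(4)[OF X(2) X(1) X(2) order_refl X(4)]
    by (simp add: chain_step(5))
  finally have "A' \<inter> B = X" .
  then have "chain_sum c A' (A' <+>\<^bsub>M\<^esub> B) k" using chain_step(3)[of A'] SX by (simp add: A'_def)
  moreover have "A' <+>\<^bsub>M\<^esub> B = A <+>\<^bsub>M\<^esub> B"
  proof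
    have "A' \<subseteq> A <+>\<^bsub>M\<^esub> B" unfolding A'_def using SX(4)[OF SB(1,2)] SB(3) B(2) by simp
    then show "A' <+>\<^bsub>M\<^esub> B \<subseteq> A <+>\<^bsub>M\<^esub> B" unfolding A'_def using S'(4)[OF SB(1)] SB(3) by simp
    show "A <+>\<^bsub>M\<^esub> B \<subseteq> A' <+>\<^bsub>M\<^esub> B"
      unfolding A'_def using SB(4)[OF S'(1)] S'(2,3) SX(2) by simp
  qed
  moreover have "covers A A'"
    unfolding A'_def using covers_second_iso[OF chain_step(4) X(2)] chain_step(1) AX by simp
  moreover have "c A A' = c A0 X"
    unfolding A'_def using perspective_invariantD[OF c chain_step(4) X(2)] AX by simp
  ultimately show ?case using chain_sum.chain_step by metis
qed

end

text \<open>Finite length, expressed by a strictly monotone function to the natural numbers. It will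
  be supplied by the dimension over \<open>K\<close>.\<close>

locale ranked_module = closed_right_module +
  fixes rank :: "'c set \<Rightarrow> nat"
  assumes rank_less:
    "\<lbrakk>submodule_of R M A; submodule_of R M B; A \<subset> B\<rbrakk> \<Longrightarrow> rank A < rank B"
begin

lemma cover_exists:
  "\<lbrakk>submodule_of R M A; submodule_of R M B; A \<subset> B\<rbrakk> \<Longrightarrow> \<exists>X. covers A X \<and> X \<subseteq> B"
proof (induction "rank B" arbitrary: B rule: less_induct)
  case less
  show ?case
  proof (cases "covers A B")
    case False
    then obtain H where H: "submodule_of R M H" "A \<subset> H" "H \<subset> B"
      using less.prems unfolding covers_def by blast
    then show ?thesis using less.hyps[of H] rank_less[of H B] less.prems by blast
  qed blast
qed

lemma cover_chain_induct [consumes 3, case_names refl step]: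
  assumes "submodule_of R M A" "submodule_of R M B" "A \<subseteq> B"
    and refl: "P B"
    and step: "\<And>A X. \<lbrakk>covers A X; X \<subseteq> B; P X\<rbrakk> \<Longrightarrow> P A"
  shows "P A"
  using assms(1,3)
proof (induction "rank B - rank A" arbitrary: A rule: less_induct)
  case less
  show ?case
  proof (cases "A = B")
    case False
    then obtain X where X: "covers A X" "X \<subseteq> B"
      using cover_exists[OF less.prems(1) assms(2)] less.prems(2) by blast
    have "rank A < rank X" "rank A < rank B"
      using rank_less[OF coversD(1-3)[OF X(1)]] rank_less[OF less.prems(1) assms(2)] less.prems(2) False
      by auto
    then have "rank B - rank X < rank B - rank A" by linarith
    then have "P X" using less.hyps[of X] coversD(2)[OF X(1)] X(2) by blast
    then show ?thesis using step X by blast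
  qed (simp add: refl)
qed

lemma chain_sum_exists:
  assumes "submodule_of R M A" "submodule_of R M B" "A \<subseteq> B"
  shows "\<exists>k. chain_sum c A B k"
  using assms
proof (induction rule: cover_chain_induct)
  case refl
  then show ?case using chain_refl assms by blast
next
  case (step A X)
  then show ?case using chain_step by blast
qed

lemma chain_sum_unique:
  assumes c: "perspective_invariant c"
  shows "\<lbrakk>chain_sum c A B k; chain_sum c A B l\<rbrakk> \<Longrightarrow> k = l"
proof (induction "rank B - rank A" arbitrary: A k l rule: less_induct)
  case less
  have stuck: False if "chain_sum c X A m" "covers A X" for X m
    using chain_sumD[OF that(1)] coversD(3)[OF that(2)] by blast
  from less.prems(1) show ?case
  proof cases
    case chain_refl
    from less.prems(2) show ?thesis
      by cases (use chain_refl stuck in auto)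
  next
    case (chain_step X k')
    note X = this
    from less.prems(2) show ?thesis
    proof cases
      case chain_refl
      then show ?thesis using X stuck by auto
    next
      case (chain_step Y l')
      note Y = this
      note cX = coversD[OF X(2)] and cY = coversD[OF Y(2)]
      have B: "submodule_of R M B" "X \<subseteq> B" "Y \<subseteq> B" using chain_sumD X Y by blast+
      have "rank A < rank X" "rank A < rank Y" "rank A < rank B"
        using rank_less[OF cX(1-3)] rank_less[OF cY(1-3)] rank_less[OF cX(1) B(1)] cX(3) B(2) by auto
      then have "rank B - rank X < rank B - rank A" "rank B - rank Y < rank B - rank A" by linarith+
      note IH = less.hyps[OF this(1)] less.hyps[OF this(2)]
      show ?thesis
      proof (cases "X = Y")
        case True
        then show ?thesis using IH X Y by blast
      next
        case False
        \<comment> \<open>The intersection lies between \<open>A\<close> and its cover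
          \<open>X\<close>. If it were \<open>X\<close>, then \<open>X\<close> would lie in the
          cover \<open>Y\<close> strictly above \<open>A\<close>, forcing X = Y.\<close>
        have XY: "X \<inter> Y = A"
          using cX(5)[OF submodule_inter[OF cX(2) cY(2)]] cY(5)[OF cX(2)] cX cY False by blast
        define W where "W = X <+>\<^bsub>M\<^esub> Y"
        note S = submodule_sum[OF cX(2) cY(2)]
        have W': "W = Y <+>\<^bsub>M\<^esub> X"
          unfolding W_def by (rule set_add_commute[OF cX(2) cY(2)])
        have "W \<subseteq> B" unfolding W_def by (rule S(4)[OF B])
        \<comment> \<open>One chain from \<open>W\<close> up to \<open>B\<close>, prolonged
          downwards to \<open>X\<close> and to \<open>Y\<close>, is compared by induction with both
          given chains. Opposite sides of the diamond \<open>A\<close>, \<open>X\<close>,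
          \<open>Y\<close>, \<open>W\<close> have equal weights, so the totals agree.\<close>
        then obtain m where m: "chain_sum c W B m"
          using chain_sum_exists[of W B c] S(1) B(1) by (auto simp: W_def)
        have YX: "Y \<inter> X = A" using XY by blast
        have "covers X W" using covers_second_iso[OF cX(2) cY(2)] XY Y(2) by (simp add: W_def)
        from IH(1)[OF X(3) chain_sum.chain_step[OF this m]] have "k' = c X W + m" .
        moreover have "covers Y W" using covers_second_iso[OF cY(2) cX(2)] YX X(2) by (simp add: W')
        from IH(2)[OF Y(3) chain_sum.chain_step[OF this m]] have "l' = c Y W + m" .
        moreover have "c X W = c A Y" using perspective_invariantD[OF c cX(2) cY(2)] XY by (simp add: W_def)
        moreover have "c Y W = c A X" using perspective_invariantD[OF c cY(2) cX(2)] YX by (simp add: W')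
        ultimately show ?thesis using X(1) Y(1) by simp
      qed
    qed
  qed
qed

section \<open>Multiplicities as functions of an interval of submodules\<close>

definition mult :: "('c set \<Rightarrow> 'c set \<Rightarrow> nat) \<Rightarrow> 'c set \<Rightarrow> 'c set \<Rightarrow> nat" where
  "mult c A B = (THE k. chain_sum c A B k)"

lemma mult_eq: "\<lbrakk>perspective_invariant c; chain_sum c A B k\<rbrakk> \<Longrightarrow> mult c A B = k"
  unfolding mult_def by (rule the_equality) (auto dest: chain_sum_unique)

lemma chain_sum_mult:
  "\<lbrakk>perspective_invariant c; submodule_of R M A; submodule_of R M B; A \<subseteq> B\<rbrakk> \<Longrightarrow>
     chain_sum c A B (mult c A B)"
  using chain_sum_exists[of A B c] mult_eq[of c A B] by auto

lemma mult_add: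
  assumes "perspective_invariant c" "submodule_of R M A" "submodule_of R M B" "submodule_of R M C" "A \<subseteq> B" "B \<subseteq> C"
  shows "mult c A C = mult c A B + mult c B C"
  by (rule mult_eq[OF assms(1) chain_sum_append[OF chain_sum_mult[OF assms(1-3,5)]
        chain_sum_mult[OF assms(1,3,4,6)]]])

lemma mult_second_iso:
  assumes "perspective_invariant c" "submodule_of R M A" "submodule_of R M B"
  shows "mult c A (A <+>\<^bsub>M\<^esub> B) = mult c (A \<inter> B) B"
  by (rule mult_eq[OF assms(1) chain_sum_second_iso[OF assms(1)
        chain_sum_mult[OF assms(1) submodule_inter[OF assms(2,3)] assms(3) Int_lower2] assms(2) refl]])

text \<open>\<open>dim_vec\<close> picks a composition series by \<open>SOME\<close>, so existence
  is required before its value says anything. Covers are stacked from the zero submodule to the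
  top.\<close>

lemma composition_series_exists: "\<exists>Ns. composition_series R M Ns"
proof -
  define good where "good A Ns \<longleftrightarrow> Ns \<noteq> [] \<and> hd Ns = A \<and> last Ns = carrier M \<and>
    (\<forall>N\<in>set Ns. submodule_of R M N) \<and> (\<forall>k. Suc k < length Ns \<longrightarrow> covers (Ns ! k) (Ns ! Suc k))" for A Ns
  have zero_subset: "{\<zero>\<^bsub>M\<^esub>} \<subseteq> carrier M" by simp
  have "\<exists>Ns. good {\<zero>\<^bsub>M\<^esub>} Ns"
    using submodule_zero submodule_carrier zero_subset
  proof (induction rule: cover_chain_induct)
    case refl
    have "good (carrier M) [carrier M]" by (simp add: good_def submodule_carrier)
    then show ?case by blast
  next
    case (step A X)
    then obtain Ns where Ns: "good X Ns" by blast
    have "good A (A # Ns)" unfolding good_def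
    proof (intro conjI allI impI)
      show "\<forall>N\<in>set (A # Ns). submodule_of R M N" "last (A # Ns) = carrier M"
        using Ns coversD(1)[OF step(1)] by (auto simp: good_def)
      fix k assume k: "Suc k < length (A # Ns)"
      show "covers ((A # Ns) ! k) ((A # Ns) ! Suc k)"
      proof (cases k)
        case 0
        then show ?thesis using Ns step(1) by (cases Ns) (auto simp: good_def)
      next
        case (Suc j)
        then show ?thesis using Ns k by (simp add: good_def)
      qed
    qed simp_all
    then show ?case by blast
  qed
  then obtain Ns where Ns: "good {\<zero>\<^bsub>M\<^esub>} Ns" by blast
  have "composition_series R M Ns" unfolding composition_series_def
  proof (intro conjI allI impI)
    fix k assume k: "Suc k < length Ns"
    then have c: "covers (Ns ! k) (Ns ! Suc k)" using Ns by (simp add: good_def)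
    show "Ns ! k \<subset> Ns ! Suc k" using coversD(3)[OF c] .
    show "simple_mod R (quotmod (submod M (Ns ! Suc k)) (Ns ! k))"
      using covers_iff_simple coversD[OF c] c by blast
  qed (use Ns in \<open>simp_all add: good_def\<close>)
  then show ?thesis by blast
qed

lemma presented_ranked:
  assumes P: "presents R M A B Y p"
  shows "ranked_module R Y (\<lambda>H. rank {x \<in> B. p x \<in> H})"
proof (intro ranked_module.intro closed_image presentsD(4)[OF P] ranked_module_axioms.intro)
  fix H H' assume H: "submodule_of R Y H" "submodule_of R Y H'" "H \<subset> H'"
  note pre = presents_preimage[OF P H(1)] and pre' = presents_preimage[OF P H(2)]
  have "{x \<in> B. p x \<in> H} \<noteq> {x \<in> B. p x \<in> H'}"
  proof
    assume eq: "{x \<in> B. p x \<in> H} = {x \<in> B. p x \<in> H'}"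
    have "H = p ` {x \<in> B. p x \<in> H}" using pre(3) by (rule sym)
    also have "\<dots> = H'" unfolding eq by (rule pre'(3))
    finally show False using H(3) by simp
  qed
  then have "{x \<in> B. p x \<in> H} \<subset> {x \<in> B. p x \<in> H'}" using H(3) by blast
  then show "rank {x \<in> B. p x \<in> H} < rank {x \<in> B. p x \<in> H'}" by (rule rank_less[OF pre(1) pre'(1)])
qed

text \<open>Preimages under \<open>p\<close> turn a series in \<open>Y\<close> into a chain of
  covers in \<open>M\<close> with isomorphic factors, so the factors of \<open>Y\<close> are counted
  in the lattice of \<open>M\<close>.\<close>

lemma chain_sum_of_series:
  assumes P: "presents R M A B Y p"
  shows "\<lbrakk>Ns \<noteq> []; \<forall>N\<in>set Ns. submodule_of R Y N;
      \<forall>k. Suc k < length Ns \<longrightarrow> Ns ! k \<subset> Ns ! Suc k \<and> simple_mod R (quotmod (submod Y (Ns ! Suc k)) (Ns ! k))\<rbrakk>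
    \<Longrightarrow> chain_sum (factor_count T) {x \<in> B. p x \<in> hd Ns} {x \<in> B. p x \<in> last Ns}
         (\<Sum>k<length Ns - 1. if mod_iso R (quotmod (submod Y (Ns ! Suc k)) (Ns ! k)) T then 1 else 0)"
proof (induction Ns)
  case Nil
  then show ?case by simp
next
  case (Cons N Ns)
  interpret Y: closed_right_module R Y by (rule closed_image[OF presentsD(4)[OF P]])
  show ?case
  proof (cases Ns)
    case Nil
    then show ?thesis using Cons.prems(2) presents_preimage[OF P] by (auto intro: chain_refl)
  next
    case (Cons N' Ns')
    have sub: "submodule_of R Y N" "submodule_of R Y N'" using Cons.prems(2) Cons by auto
    have step: "N \<subset> N'" "simple_mod R (quotmod (submod Y N') N)"
      using Cons.prems(3)[rule_format, of 0] Cons by auto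
    have "presents R Y N N' (quotmod (submod Y N') N) (\<lambda>x. N +>\<^bsub>Y\<^esub> x)"
      using Y.presents_quotient sub step(1) by blast
    note pq = presents_comp[OF P this]
    have cov: "covers {x \<in> B. p x \<in> N} {x \<in> B. p x \<in> N'}" using presents_simple_iff[OF pq] step(2) by simp
    have fc: "factor_count T {x \<in> B. p x \<in> N} {x \<in> B. p x \<in> N'} = (if mod_iso R (quotmod (submod Y N') N) T then 1 else 0)"
      by (rule factor_count_presented[OF pq])
    have IH: "chain_sum (factor_count T) {x \<in> B. p x \<in> hd Ns} {x \<in> B. p x \<in> last Ns}
         (\<Sum>k<length Ns - 1. if mod_iso R (quotmod (submod Y (Ns ! Suc k)) (Ns ! k)) T then 1 else 0)"
    proof (rule Cons.IH)
      show "\<forall>k. Suc k < length Ns \<longrightarrow> Ns ! k \<subset> Ns ! Suc k \<and> simple_mod R (quotmod (submod Y (Ns ! Suc k)) (Ns ! k))"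
        using Cons.prems(3)[rule_format, of "Suc k" for k] by auto
    qed (use Cons Cons.prems(2) in auto)
    have "chain_sum (factor_count T) {x \<in> B. p x \<in> N} {x \<in> B. p x \<in> last Ns}
       (factor_count T {x \<in> B. p x \<in> N} {x \<in> B. p x \<in> N'} +
        (\<Sum>k<length Ns - 1. if mod_iso R (quotmod (submod Y (Ns ! Suc k)) (Ns ! k)) T then 1 else 0))"
      using chain_step[OF cov] IH Cons by simp
    moreover have "length (N # Ns) - 1 = Suc (length Ns - 1)" using Cons by simp
    ultimately show ?thesis
      unfolding fc using Cons by (simp add: sum.lessThan_Suc_shift del: sum.lessThan_Suc)
  qed
qed

text \<open>The series chosen by \<open>SOME\<close> in \<open>Y\<close> is irrelevant by
  Jordan--Hoelder. The result depends only on the interval of \<open>Y\<close>, so modules over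
  different types of elements can be compared.\<close>

lemma dim_vec_presented:
  assumes P: "presents R M A B Y p"
  shows "dim_vec R S Y i = mult (factor_count (S i)) A B"
proof -
  interpret Y: ranked_module R Y "\<lambda>H. rank {x \<in> B. p x \<in> H}" by (rule presented_ranked[OF P])
  define Ns where "Ns = (SOME Ns. composition_series R Y Ns)"
  have "composition_series R Y Ns" unfolding Ns_def using Y.composition_series_exists by (rule someI_ex)
  note C = this[unfolded composition_series_def]
  have "chain_sum (factor_count (S i)) A B
         (\<Sum>k<length Ns - 1. if mod_iso R (quotmod (submod Y (Ns ! Suc k)) (Ns ! k)) (S i) then 1 else 0)"
    using chain_sum_of_series[OF P, of Ns "S i"] C preimage_zero[OF P] preimage_carrier[OF P] by simp
  moreover have "(\<Sum>k<length Ns - 1. if mod_iso R (quotmod (submod Y (Ns ! Suc k)) (Ns ! k)) (S i) then 1 else 0)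
      = card {k. Suc k < length Ns \<and> mod_iso R (quotmod (submod Y (Ns ! Suc k)) (Ns ! k)) (S i)}"
  proof -
    have "{k. Suc k < length Ns \<and> mod_iso R (quotmod (submod Y (Ns ! Suc k)) (Ns ! k)) (S i)} =
      {k\<in>{..<length Ns - 1}. mod_iso R (quotmod (submod Y (Ns ! Suc k)) (Ns ! k)) (S i)}" by auto
    then show ?thesis by (simp only: sum_indicator_eq_card finite_lessThan)
  qed
  ultimately show ?thesis
    using mult_eq[OF perspective_invariant_factor_count, of "S i" A B] unfolding dim_vec_def Let_def Ns_def by simp
qed

end

section \<open>Finite dimensional spaces of vectors\<close>

lemma finsum_with_scalars: "finsum (with_scalars V act) = finsum V"
  by (intro ext) (simp add: finsum_def finprod_def with_scalars_def)

text \<open>The action of \<open>K\<close> is a separate parameter because the record of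
  \<open>V\<close> may already carry the action of another ring.\<close>

locale scalar_action = abelian_group V + K: field K
  for K :: "('k, 'x) ring_scheme" and V :: "('v, 'y) ring_scheme" (structure) +
  fixes act :: "'k \<Rightarrow> 'v \<Rightarrow> 'v"
  assumes act_closed: "\<lbrakk>k \<in> carrier K; v \<in> carrier V\<rbrakk> \<Longrightarrow> act k v \<in> carrier V"
    and act_add_scalar: "\<lbrakk>k \<in> carrier K; k' \<in> carrier K; v \<in> carrier V\<rbrakk> \<Longrightarrow>
      act (k \<oplus>\<^bsub>K\<^esub> k') v = act k v \<oplus> act k' v"
    and act_add_vector: "\<lbrakk>k \<in> carrier K; v \<in> carrier V; w \<in> carrier V\<rbrakk> \<Longrightarrow>
      act k (v \<oplus> w) = act k v \<oplus> act k w"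
    and act_mult: "\<lbrakk>k \<in> carrier K; k' \<in> carrier K; v \<in> carrier V\<rbrakk> \<Longrightarrow>
      act (k \<otimes>\<^bsub>K\<^esub> k') v = act k (act k' v)"
    and act_one: "v \<in> carrier V \<Longrightarrow> act \<one>\<^bsub>K\<^esub> v = v"
begin

lemma add_diff_cancel_common:
  assumes "p \<in> carrier V" "u \<in> carrier V" "q \<in> carrier V"
  shows "p \<oplus> u \<oplus> \<ominus> (p \<oplus> q) = u \<oplus> \<ominus> q"
proof -
  have "p \<oplus> u \<oplus> \<ominus> (p \<oplus> q) = (p \<oplus> \<ominus> p) \<oplus> (u \<oplus> \<ominus> q)"
    using assms by (simp add: minus_add a_ac)
  then show ?thesis using assms by (simp add: r_neg)
qed

lemma act_zero_vector: "k \<in> carrier K \<Longrightarrow> act k \<zero> = \<zero>"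
  using act_add_vector[of k \<zero> \<zero>] act_closed[of k \<zero>] by (simp add: add.l_cancel_one')

lemma act_zero_scalar: "v \<in> carrier V \<Longrightarrow> act \<zero>\<^bsub>K\<^esub> v = \<zero>"
  using act_add_scalar[of "\<zero>\<^bsub>K\<^esub>" "\<zero>\<^bsub>K\<^esub>" v] act_closed[of "\<zero>\<^bsub>K\<^esub>" v] by (simp add: add.l_cancel_one')

lemma act_neg_one:
  assumes "v \<in> carrier V" shows "act (\<ominus>\<^bsub>K\<^esub> \<one>\<^bsub>K\<^esub>) v = \<ominus> v"
proof -
  have "act (\<ominus>\<^bsub>K\<^esub> \<one>\<^bsub>K\<^esub>) v \<oplus> v = act (\<ominus>\<^bsub>K\<^esub> \<one>\<^bsub>K\<^esub> \<oplus>\<^bsub>K\<^esub> \<one>\<^bsub>K\<^esub>) v"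
    using assms by (simp add: act_add_scalar act_one)
  also have "\<dots> = \<zero>" using assms by (simp add: K.l_neg act_zero_scalar)
  finally show ?thesis using assms by (simp add: act_closed minus_equality)
qed

section \<open>Subspaces, spans and dimension\<close>

definition subspace :: "'v set \<Rightarrow> bool" where
  "subspace W \<longleftrightarrow> W \<subseteq> carrier V \<and> \<zero> \<in> W \<and> (\<forall>v\<in>W. \<forall>w\<in>W. v \<oplus> w \<in> W) \<and>
     (\<forall>k\<in>carrier K. \<forall>v\<in>W. act k v \<in> W)"

lemma subspaceD:
  assumes "subspace W"
  shows "W \<subseteq> carrier V" "\<zero> \<in> W" "\<lbrakk>v \<in> W; w \<in> W\<rbrakk> \<Longrightarrow> v \<oplus> w \<in> W"
    "\<lbrakk>k \<in> carrier K; v \<in> W\<rbrakk> \<Longrightarrow> act k v \<in> W" "v \<in> W \<Longrightarrow> \<ominus> v \<in> W"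
proof -
  show *: "W \<subseteq> carrier V" "\<zero> \<in> W" "\<lbrakk>v \<in> W; w \<in> W\<rbrakk> \<Longrightarrow> v \<oplus> w \<in> W"
    "\<And>k v. \<lbrakk>k \<in> carrier K; v \<in> W\<rbrakk> \<Longrightarrow> act k v \<in> W" using assms by (simp_all add: subspace_def)
  show "\<ominus> v \<in> W" if "v \<in> W"
    using *(4)[of "\<ominus>\<^bsub>K\<^esub> \<one>\<^bsub>K\<^esub>" v] act_neg_one[of v] subsetD[OF *(1) that] that by simp
qed

inductive_set kspan :: "'v set \<Rightarrow> 'v set" for X where
  kspan_zero: "\<zero> \<in> kspan X"
| kspan_step: "\<lbrakk>y \<in> X; k \<in> carrier K; u \<in> kspan X\<rbrakk> \<Longrightarrow> act k y \<oplus> u \<in> kspan X"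

lemma kspan_mono: "X \<subseteq> X' \<Longrightarrow> kspan X \<subseteq> kspan X'"
proof
  fix x assume "X \<subseteq> X'" "x \<in> kspan X"
  from this(2) show "x \<in> kspan X'"
    by induction (use \<open>X \<subseteq> X'\<close> in \<open>auto intro: kspan_zero kspan_step\<close>)
qed

lemma kspan_least: "\<lbrakk>subspace W; X \<subseteq> W\<rbrakk> \<Longrightarrow> kspan X \<subseteq> W"
proof
  fix x assume W: "subspace W" "X \<subseteq> W" "x \<in> kspan X"
  from W(3) show "x \<in> W"
    by induction (use W(2) subspaceD[OF W(1)] in auto)
qed

lemma kspan_carrier:
  assumes "X \<subseteq> carrier V" "x \<in> kspan X" shows "x \<in> carrier V"
  using assms(2) by induction (use assms(1) act_closed in auto)

lemma subspace_kspan: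
  assumes X: "X \<subseteq> carrier V" shows "subspace (kspan X)"
  unfolding subspace_def
proof (intro conjI ballI)
  show "kspan X \<subseteq> carrier V" "\<zero> \<in> kspan X" using kspan_carrier[OF X] kspan_zero by auto
  show "v \<oplus> w \<in> kspan X" if "v \<in> kspan X" "w \<in> kspan X" for v w
    using that(1)
  proof induction
    case kspan_zero
    then show ?case using that(2) kspan_carrier[OF X] by simp
  next
    case (kspan_step y k u)
    then have "act k y \<oplus> u \<oplus> w = act k y \<oplus> (u \<oplus> w)"
      using kspan_carrier[OF X] that(2) act_closed X by (intro a_assoc) auto
    then show ?case using kspan.kspan_step kspan_step by simp
  qed
  show "act k v \<in> kspan X" if "k \<in> carrier K" "v \<in> kspan X" for k v
    using that(2)
  proof induction
    case kspan_zero
    then show ?case using that(1) by (simp add: act_zero_vector kspan.kspan_zero)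
  next
    case (kspan_step y k' u)
    have y: "y \<in> carrier V" using X kspan_step(1) by auto
    have "act k (act k' y \<oplus> u) = act k (act k' y) \<oplus> act k u"
      using kspan_carrier[OF X] that(1) act_closed kspan_step y by (intro act_add_vector) auto
    also have "act k (act k' y) = act (k \<otimes>\<^bsub>K\<^esub> k') y" using that(1) kspan_step y by (simp add: act_mult)
    finally show ?case using kspan.kspan_step kspan_step that(1) by simp
  qed
qed

lemma kspan_superset: "X \<subseteq> carrier V \<Longrightarrow> X \<subseteq> kspan X"
proof
  fix x assume "X \<subseteq> carrier V" "x \<in> X"
  then show "x \<in> kspan X"
    using kspan_step[of x X "\<one>\<^bsub>K\<^esub>" \<zero>] kspan_zero[of X] act_one[of x] by auto
qed

lemma kspan_insert:
  assumes X: "X \<subseteq> carrier V" and y: "y \<in> carrier V" and "x \<in> kspan (insert y X)"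
  shows "\<exists>k\<in>carrier K. \<exists>u\<in>kspan X. x = act k y \<oplus> u"
  using assms(3)
proof induction
  case kspan_zero
  show ?case
    using act_zero_scalar[OF y] kspan.kspan_zero[of X] K.zero_closed by (metis l_zero zero_closed)
next
  case (kspan_step z k w)
  then obtain l u where lu: "l \<in> carrier K" "u \<in> kspan X" "w = act l y \<oplus> u" by blast
  have u: "u \<in> carrier V" using lu kspan_carrier[OF X] by auto
  have ly: "act l y \<in> carrier V" "act k z \<in> carrier V" using lu act_closed y kspan_step X by auto
  show ?case
  proof (cases "z = y")
    case True
    then have "act k z \<oplus> w = act (k \<oplus>\<^bsub>K\<^esub> l) y \<oplus> u"
      using lu u ly y kspan_step(2) by (simp add: act_add_scalar a_assoc)
    then show ?thesis using lu kspan_step(2) by blast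
  next
    case False
    then have "z \<in> X" using kspan_step by auto
    then have "act k z \<oplus> u \<in> kspan X" using kspan_step(2) lu by (intro kspan.kspan_step)
    moreover have "act k z \<oplus> w = act l y \<oplus> (act k z \<oplus> u)" using lu u ly by (simp add: a_lcomm)
    ultimately show ?thesis using lu by blast
  qed
qed

text \<open>The dimension of a subspace is the number of steps of the flag \<open>U 0 \<subseteq> U 1 \<subseteq> \<dots>\<close> spanned by
  a finite generating sequence at which its intersection with the flag grows.\<close>

definition pivots :: "(nat \<Rightarrow> 'v) \<Rightarrow> nat \<Rightarrow> 'v set \<Rightarrow> nat set" where
  "pivots y d W = {k. k < d \<and> (\<exists>w\<in>W. w \<in> kspan (y ` {..<Suc k}) \<and> w \<notin> kspan (y ` {..<k}))}"

lemma pivots_mono: "W \<subseteq> W' \<Longrightarrow> pivots y d W \<subseteq> pivots y d W'"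
  unfolding pivots_def by blast

lemma finite_pivots: "finite (pivots y d W)"
  unfolding pivots_def by simp

text \<open>Gaussian elimination along the flag, by induction on \<open>k\<close>: an element of
  \<open>W'\<close> at level \<open>k + 1\<close> is reduced to level \<open>k\<close> by
  subtracting a multiple of an element of \<open>W\<close> with the same pivot, and the remainder
  lies in \<open>W\<close> by induction.\<close>

lemma pivots_determine:
  assumes y: "y ` {..<d} \<subseteq> carrier V" "carrier V = kspan (y ` {..<d})"
    and W: "subspace W" "subspace W'" "W \<subseteq> W'" and eq: "pivots y d W' \<subseteq> pivots y d W"
  shows "W' = W"
proof -
  have "\<forall>x\<in>W'. x \<in> kspan (y ` {..<k}) \<longrightarrow> x \<in> W" if "k \<le> d" for k
    using that
  proof (induction k)
    case 0
    have "kspan (y ` {..<0}) \<subseteq> {\<zero>}"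
    proof
      fix x assume "x \<in> kspan (y ` {..<0})" then show "x \<in> {\<zero>}" by cases auto
    qed
    then show ?case using subspaceD(2)[OF W(1)] by auto
  next
    case (Suc k)
    show ?case
    proof (intro ballI impI)
      fix x assume x: "x \<in> W'" "x \<in> kspan (y ` {..<Suc k})"
      show "x \<in> W"
      proof (cases "x \<in> kspan (y ` {..<k})")
        case True
        then show ?thesis using Suc x by auto
      next
        case False
        then have "k \<in> pivots y d W'" using x Suc.prems by (auto simp: pivots_def)
        then obtain w where w: "w \<in> W" "w \<in> kspan (y ` {..<Suc k})" "w \<notin> kspan (y ` {..<k})"
          using eq by (auto simp: pivots_def)
        define U where "U = kspan (y ` {..<k})"
        have yk: "y ` {..<k} \<subseteq> carrier V" "y k \<in> carrier V" using y(1) Suc.prems by auto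
        have U: "subspace U" unfolding U_def by (rule subspace_kspan[OF yk(1)])
        have ins: "y ` {..<Suc k} = insert (y k) (y ` {..<k})" by (simp add: lessThan_Suc)
        obtain c u where cu: "c \<in> carrier K" "u \<in> U" "x = act c (y k) \<oplus> u"
          using kspan_insert[OF yk] x(2) unfolding ins U_def by blast
        obtain e v where ev: "e \<in> carrier K" "v \<in> U" "w = act e (y k) \<oplus> v"
          using kspan_insert[OF yk] w(2) unfolding ins U_def by blast
        have cV: "u \<in> carrier V" "v \<in> carrier V" using subspaceD(1)[OF U] cu ev by auto
        have "e \<noteq> \<zero>\<^bsub>K\<^esub>"
        proof
          assume "e = \<zero>\<^bsub>K\<^esub>"
          then have "w = v" using ev yk(2) cV by (simp add: act_zero_scalar)
          then show False using w(3) ev(2) by (simp add: U_def)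
        qed
        then have ei: "e \<in> Units K" using ev(1) K.field_Units by auto
        \<comment> \<open>Chosen so that \<open>x\<close> and \<open>act f w\<close> have the same
          coefficient at \<open>y k\<close>; their difference then falls into the smaller span
          \<open>U\<close>.\<close>
        define f where "f = c \<otimes>\<^bsub>K\<^esub> inv\<^bsub>K\<^esub> e"
        have f: "f \<in> carrier K" unfolding f_def using cu ei by simp
        have "f \<otimes>\<^bsub>K\<^esub> e = c" unfolding f_def using cu ei ev by (simp add: K.m_assoc K.Units_l_inv)
        then have fw: "act f w = act c (y k) \<oplus> act f v"
          using ev f yk cV act_closed by (simp add: act_add_vector flip: act_mult)
        have fwW: "act f w \<in> W" using subspaceD(4)[OF W(1)] f w(1) by simp
        then have fwW': "act f w \<in> W'" using W(3) by auto
        have aV: "act c (y k) \<in> carrier V" "act f v \<in> carrier V" using act_closed cu yk cV f by auto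
        have fvU: "act f v \<in> U" using subspaceD(4)[OF U] f ev(2) by simp
        have "x \<oplus> \<ominus> act f w = u \<oplus> \<ominus> act f v"
          unfolding fw cu(3) using add_diff_cancel_common[OF aV(1) cV(1) aV(2)] .
        then have d: "x \<oplus> \<ominus> act f w \<in> U" using subspaceD(3,5)[OF U] fvU cu(2) by simp
        have "x \<oplus> \<ominus> act f w \<in> W'" using subspaceD(3,5)[OF W(2)] fwW' x(1) by simp
        then have "x \<oplus> \<ominus> act f w \<in> W" using Suc d by (auto simp: U_def)
        then have "(x \<oplus> \<ominus> act f w) \<oplus> act f w \<in> W" using subspaceD(3)[OF W(1)] fwW by simp
        moreover have "(x \<oplus> \<ominus> act f w) \<oplus> act f w = x"
          using x(1) fwW subspaceD(1)[OF W(2)] subspaceD(1)[OF W(1)] by (simp add: subset_iff a_assoc l_neg)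
        ultimately show ?thesis by simp
      qed
    qed
  qed
  then show ?thesis using subspaceD(1)[OF W(2)] y(2) W(3) by blast
qed

text \<open>The rank is the number of pivots, strictly monotone because equal pivots force equal
  subspaces. Choosing a vector of \<open>W\<close> for every pivot gives a finite set whose span has
  all the pivots of \<open>W\<close>, hence is \<open>W\<close>; this yields generators of
  submodules later on.\<close>

lemma subspace_rank_exists:
  assumes "finite X" "X \<subseteq> carrier V" "carrier V = kspan X"
  shows "\<exists>rank. (\<forall>W W'. subspace W \<longrightarrow> subspace W' \<longrightarrow> W \<subset> W' \<longrightarrow> rank W < (rank W' :: nat)) \<and>
    (\<forall>W. subspace W \<longrightarrow> (\<exists>Y. finite Y \<and> Y \<subseteq> W \<and> W = kspan Y))"
proof -
  obtain y d where yd: "X = y ` {..<d::nat}"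
    using finite_imp_nat_seg_image_inj_on[OF assms(1)] unfolding lessThan_def by blast
  note y = assms(2,3)[unfolded yd]
  show ?thesis
  proof (intro exI[of _ "\<lambda>W. card (pivots y d W)"] conjI allI impI)
    fix W W' assume W: "subspace W" "subspace W'" "W \<subset> W'"
    have "pivots y d W \<subseteq> pivots y d W'" using pivots_mono W by blast
    moreover have "\<not> pivots y d W' \<subseteq> pivots y d W" using pivots_determine[OF y W(1,2)] W(3) by blast
    ultimately show "card (pivots y d W) < card (pivots y d W')"
      by (intro psubset_card_mono finite_pivots) blast
  next
    fix W assume W: "subspace W"
    define Pv where "Pv k w \<longleftrightarrow> w \<in> W \<and> w \<in> kspan (y ` {..<Suc k}) \<and> w \<notin> kspan (y ` {..<k})" for k w
    have "\<forall>k\<in>pivots y d W. \<exists>w. Pv k w" unfolding pivots_def Pv_def by blast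
    then obtain w where w: "\<And>k. k \<in> pivots y d W \<Longrightarrow> Pv k (w k)" by metis
    define Y where "Y = w ` pivots y d W"
    have Y: "finite Y" "Y \<subseteq> W" using finite_pivots w by (auto simp: Y_def Pv_def)
    have YV: "Y \<subseteq> carrier V" using Y(2) subspaceD(1)[OF W] by blast
    have "pivots y d W \<subseteq> pivots y d (kspan Y)"
    proof
      fix k assume k: "k \<in> pivots y d W"
      then have "w k \<in> kspan Y" using kspan_superset[OF YV] by (auto simp: Y_def)
      then show "k \<in> pivots y d (kspan Y)" using k w[OF k] unfolding pivots_def Pv_def by blast
    qed
    then have "W = kspan Y"
      by (rule pivots_determine[OF y subspace_kspan[OF YV] W kspan_least[OF W Y(2)]])
    then show "\<exists>Y. finite Y \<and> Y \<subseteq> W \<and> W = kspan Y" using Y by blast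
  qed
qed

lemma finsum_mem:
  assumes "finite A" "W \<subseteq> carrier V" "\<zero> \<in> W" "\<And>v w. \<lbrakk>v \<in> W; w \<in> W\<rbrakk> \<Longrightarrow> v \<oplus> w \<in> W" "f \<in> A \<rightarrow> W"
  shows "finsum V f A \<in> W"
  using assms(1,5)
proof (induction A)
  case empty
  then show ?case using assms by simp
next
  case (insert x A)
  then have "finsum V f (insert x A) = f x \<oplus> finsum V f A"
    using assms(2) by (intro finsum_insert) auto
  then show ?case using insert assms(4) by auto
qed

lemma kspan_imp_finsum:
  assumes X: "finite X" "X \<subseteq> carrier V" and "x \<in> kspan X"
  shows "\<exists>c\<in>X \<rightarrow> carrier K. x = finsum V (\<lambda>y. act (c y) y) X"
  using assms(3)
proof induction
  case kspan_zero
  have "finsum V (\<lambda>y. act \<zero>\<^bsub>K\<^esub> y) X = finsum V (\<lambda>y. \<zero>) X"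
    using X by (intro finsum_cong') (auto simp: act_zero_scalar)
  then show ?case by (intro bexI[of _ "\<lambda>_. \<zero>\<^bsub>K\<^esub>"]) auto
next
  case (kspan_step y k u)
  then obtain c where c: "c \<in> X \<rightarrow> carrier K" "u = finsum V (\<lambda>y. act (c y) y) X" by blast
  define c' where "c' z = (if y = z then k \<oplus>\<^bsub>K\<^esub> c z else c z)" for z
  have y: "y \<in> carrier V" using kspan_step X by auto
  have c': "c' \<in> X \<rightarrow> carrier K" using c kspan_step(2) by (auto simp: c'_def Pi_iff)
  have cl: "(\<lambda>z. act (c z) z) \<in> X \<rightarrow> carrier V" using act_closed c X by auto
  have kl: "(\<lambda>z. act k z) \<in> X \<rightarrow> carrier V" using act_closed kspan_step X by auto
  have "finsum V (\<lambda>z. act (c' z) z) X = finsum V (\<lambda>z. (if y = z then act k z else \<zero>) \<oplus> act (c z) z) X"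
  proof (rule finsum_cong')
    show "act (c' z) z = (if y = z then act k z else \<zero>) \<oplus> act (c z) z" if "z \<in> X" for z
      using that c X kspan_step(2) cl by (auto simp: c'_def act_add_scalar Pi_iff subset_iff)
  qed (use cl kl in \<open>auto simp: Pi_iff\<close>)
  also have "\<dots> = finsum V (\<lambda>z. if y = z then act k z else \<zero>) X \<oplus> finsum V (\<lambda>z. act (c z) z) X"
    using cl kl by (intro finsum_addf) (auto simp: Pi_iff)
  also have "finsum V (\<lambda>z. if y = z then act k z else \<zero>) X = act k y"
    using kspan_step(1) X kl by (intro add.finprod_singleton) auto
  finally show ?case using c c' by metis
qed

lemma finsum_in_kspan:
  assumes X: "finite X" "X \<subseteq> carrier V" and c: "c \<in> X \<rightarrow> carrier K"
  shows "finsum V (\<lambda>y. act (c y) y) X \<in> kspan X"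
proof (rule finsum_mem[OF X(1)])
  note S = subspace_kspan[OF X(2)]
  show "kspan X \<subseteq> carrier V" "\<zero> \<in> kspan X" "\<And>v w. \<lbrakk>v \<in> kspan X; w \<in> kspan X\<rbrakk> \<Longrightarrow> v \<oplus> w \<in> kspan X"
    using subspaceD(1-3)[OF S] by simp_all
  show "(\<lambda>y. act (c y) y) \<in> X \<rightarrow> kspan X"
  proof
    fix y assume "y \<in> X"
    then show "act (c y) y \<in> kspan X"
      using c kspan_superset[OF X(2)] by (intro subspaceD(4)[OF S]) auto
  qed
qed

lemma carrier_eq_kspan_iff:
  assumes X: "finite X" "X \<subseteq> carrier V"
  shows "carrier V = kspan X \<longleftrightarrow>
    (\<forall>x\<in>carrier V. \<exists>c\<in>X \<rightarrow> carrier K. x = finsum V (\<lambda>y. act (c y) y) X)"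
proof
  assume eq: "carrier V = kspan X"
  show "\<forall>x\<in>carrier V. \<exists>c\<in>X \<rightarrow> carrier K. x = finsum V (\<lambda>y. act (c y) y) X"
  proof
    fix x assume "x \<in> carrier V"
    then have "x \<in> kspan X" by (subst (asm) eq)
    then show "\<exists>c\<in>X \<rightarrow> carrier K. x = finsum V (\<lambda>y. act (c y) y) X" by (rule kspan_imp_finsum[OF X])
  qed
next
  assume *: "\<forall>x\<in>carrier V. \<exists>c\<in>X \<rightarrow> carrier K. x = finsum V (\<lambda>y. act (c y) y) X"
  show "carrier V = kspan X"
  proof
    show "carrier V \<subseteq> kspan X"
    proof
      fix x assume "x \<in> carrier V"
      with * obtain c where c: "c \<in> X \<rightarrow> carrier K" "x = finsum V (\<lambda>y. act (c y) y) X" by blast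
      show "x \<in> kspan X" unfolding c(2) by (rule finsum_in_kspan[OF X c(1)])
    qed
    show "kspan X \<subseteq> carrier V" using kspan_carrier[OF X(2)] by blast
  qed
qed

lemma finitely_spanned_iff_kspan:
  "finitely_spanned K (with_scalars V act) \<longleftrightarrow> (\<exists>X. finite X \<and> X \<subseteq> carrier V \<and> carrier V = kspan X)"
proof -
  have "carrier (with_scalars V act) = carrier V" "smult (with_scalars V act) = act"
    by (simp_all add: with_scalars_def)
  then show ?thesis
    unfolding finitely_spanned_def finsum_with_scalars using carrier_eq_kspan_iff by (simp cong: conj_cong)
qed

end

section \<open>Stability functions and subquotients\<close>

lemma differentiable_on_UNIV_imp_at:
  fixes f :: "real \<Rightarrow> real"
  assumes "f C1_differentiable_on UNIV"
  shows "(f has_real_derivative deriv f t) (at t)"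
  using assms unfolding C1_differentiable_on_def
  by (metis DERIV_imp_deriv UNIV_I has_real_derivative_iff_has_vector_derivative)

text \<open>Both half lines given by the absolute value of \<open>T\<close> are convex and lie where
  the derivative vanishes, also if \<open>T\<close> is negative.\<close>

lemma eventually_constant_of_deriv:
  fixes f :: "real \<Rightarrow> real"
  assumes f: "f C1_differentiable_on UNIV" and T: "\<And>t. \<bar>t\<bar> > T \<Longrightarrow> deriv f t = 0"
  shows "\<exists>c. \<forall>t>\<bar>T\<bar>. f t = c" "\<exists>c. \<forall>t< -\<bar>T\<bar>. f t = c"
proof -
  have D: "(f has_real_derivative 0) (at t within S)" if "\<bar>t\<bar> > T" for t S
    using differentiable_on_UNIV_imp_at[OF f, of t] T[OF that] by (simp add: has_field_derivative_at_within)
  show "\<exists>c. \<forall>t>\<bar>T\<bar>. f t = c"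
    using has_field_derivative_zero_constant[of "{\<bar>T\<bar><..}" f] D by (auto simp: convex_real_interval)
  show "\<exists>c. \<forall>t< -\<bar>T\<bar>. f t = c"
    using has_field_derivative_zero_constant[of "{..< -\<bar>T\<bar>}" f] D by (auto simp: convex_real_interval)
qed

text \<open>Moves a subquotient to another type of elements, so that hypotheses on modules over that
  type become applicable to it.\<close>

lemma presents_transport:
  fixes \<iota> :: "'p \<Rightarrow> 'u" and Y :: "('r, 'p) module"
  assumes M: "closed_right_module R M" and P: "presents R M A B Y p" and inj: "inj_on \<iota> (carrier Y)"
  shows "\<exists>U :: ('r, 'u) module. presents R M A B U (\<iota> \<circ> p)"
proof -
  interpret M: closed_right_module R M by (rule M)
  note D = M.presentsD[OF P]
  interpret Y: right_module R Y by (rule D(4))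
  define \<kappa> where "\<kappa> = the_inv_into (carrier Y) \<iota>"
  have \<kappa>: "\<kappa> (\<iota> y) = y" if "y \<in> carrier Y" for y
    unfolding \<kappa>_def using the_inv_into_f_f[OF inj that] .
  define U :: "('r, 'u) module" where
    "U = \<lparr>carrier = \<iota> ` carrier Y, monoid.mult = undefined, one = undefined, ring.zero = \<iota> \<zero>\<^bsub>Y\<^esub>,
       add = (\<lambda>u v. \<iota> (\<kappa> u \<oplus>\<^bsub>Y\<^esub> \<kappa> v)), smult = (\<lambda>r u. \<iota> (r \<odot>\<^bsub>Y\<^esub> \<kappa> u))\<rparr>"
  have "presents R M A B U (\<iota> \<circ> p)"
  proof (rule M.presentsI[OF D(2)])
    show "(\<iota> \<circ> p) ` B = carrier U" unfolding U_def image_comp[symmetric] D(5) by simp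
    show "(\<iota> \<circ> p) (x \<oplus>\<^bsub>M\<^esub> y) = (\<iota> \<circ> p) x \<oplus>\<^bsub>U\<^esub> (\<iota> \<circ> p) y" if "x \<in> B" "y \<in> B" for x y
      using D(6)[OF that] D(11)[OF that(1)] D(11)[OF that(2)] by (simp add: U_def \<kappa>)
    show "(\<iota> \<circ> p) (r \<odot>\<^bsub>M\<^esub> x) = r \<odot>\<^bsub>U\<^esub> (\<iota> \<circ> p) x" if "r \<in> carrier R" "x \<in> B" for r x
      using D(7)[OF that] D(11)[OF that(2)] by (simp add: U_def \<kappa>)
    have "p x = \<zero>\<^bsub>Y\<^esub> \<longleftrightarrow> \<iota> (p x) = \<iota> \<zero>\<^bsub>Y\<^esub>" if "x \<in> B" for x
      using inj_on_eq_iff[OF inj D(11)[OF that] Y.zero_closed] by simp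
    then have "{x \<in> B. p x = \<zero>\<^bsub>Y\<^esub>} = {x \<in> B. (\<iota> \<circ> p) x = \<zero>\<^bsub>U\<^esub>}" by (auto simp: U_def)
    then show "A = {x \<in> B. (\<iota> \<circ> p) x = \<zero>\<^bsub>U\<^esub>}" by (rule trans[OF D(8)])
    show "(\<iota> \<circ> p) \<zero>\<^bsub>M\<^esub> = \<zero>\<^bsub>U\<^esub>" using D(9) by (simp add: U_def)
  qed
  then show ?thesis by blast
qed

text \<open>\<open>parametrized\<close> records finite generation as a surjection from coefficient
  functions, which is what coding cosets in \<open>'r univ\<close> requires.
  \<open>subquotient_closed\<close> says that the copies of subquotients in that type are objects of
  the category.\<close>

locale stability_setting = ranked_module R M rank
  for R :: "('r, 'x) ring_scheme" (structure) and M :: "('r, 'm) module" (structure) and rank +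
  fixes L :: "('r, 'r univ) module \<Rightarrow> bool" and n :: nat and S :: "nat \<Rightarrow> ('r, 'r univ) module"
    and Z :: "real \<Rightarrow> (nat \<Rightarrow> int) \<Rightarrow> complex" and a b :: "real \<Rightarrow> nat \<Rightarrow> real"
  assumes parametrized: "\<exists>s :: (nat \<Rightarrow> 'r) \<Rightarrow> 'm. carrier M \<subseteq> range s"
    and subquotient_closed: "presents R M A B (Y :: ('r, 'r univ) module) p \<Longrightarrow> L Y"
    and simples: "simple_objects R L n S"
    and stability: "stability_function n Z a b"
    and green: "green R L n S a b"
    and nonzero: "nonzero_mod M"
begin

text \<open>A coset is encoded by the coefficient functions that represent its elements.\<close>

lemma univ_copy:
  assumes "submodule_of R M A" "submodule_of R M B" "A \<subseteq> B"
  obtains U :: "('r, 'r univ) module" and p where "presents R M A B U p"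
proof -
  note P = presents_quotient[OF assms]
  obtain s :: "(nat \<Rightarrow> 'r) \<Rightarrow> 'm" where s: "carrier M \<subseteq> range s" using parametrized by blast
  have "X \<subseteq> carrier M" if "X \<in> carrier (quotmod (submod M B) A)" for X
  proof -
    from that obtain x where "x \<in> B" "X = A +>\<^bsub>M\<^esub> x" using presentsD(5)[OF P] by blast
    then show ?thesis
      using a_r_coset_subset_G submodule_ofD(1)[OF assms(1)] submodule_ofD(3)[OF assms(2)] by simp
  qed
  then have "inj_on (\<lambda>X. s -` X) (carrier (quotmod (submod M B) A))"
    using s by (intro inj_onI) (metis image_vimage_eq inf.absorb1 order_trans)
  from presents_transport[OF closed_right_module_axioms P this] show thesis using that by blast
qed

definition d :: "nat \<Rightarrow> 'm set \<Rightarrow> nat" where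
  "d i H = mult (factor_count (S i)) {\<zero>\<^bsub>M\<^esub>} H"

definition F :: "real \<Rightarrow> 'm set \<Rightarrow> real" where
  "F t H = (\<Sum>i<n. (a t i - t * b t i) * real (d i H))"

definition num :: "real \<Rightarrow> 'm set \<Rightarrow> 'm set \<Rightarrow> real" where
  "num t A B = (\<Sum>i<n. a t i * real (mult (factor_count (S i)) A B))"

definition den :: "real \<Rightarrow> 'm set \<Rightarrow> 'm set \<Rightarrow> real" where
  "den t A B = (\<Sum>i<n. b t i * real (mult (factor_count (S i)) A B))"

section \<open>The valuation \<open>F\<close> and the slopes of subquotients\<close>

lemma zero_sub: "submodule_of R M A \<Longrightarrow> {\<zero>\<^bsub>M\<^esub>} \<subseteq> A"
  using submodule_ofD(2) by simp

lemma d_add: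
  assumes "submodule_of R M A" "submodule_of R M B" "A \<subseteq> B"
  shows "d i B = d i A + mult (factor_count (S i)) A B"
  unfolding d_def
  by (rule mult_add[OF perspective_invariant_factor_count submodule_zero assms(1,2) zero_sub[OF assms(1)] assms(3)])

lemma F_diff:
  assumes "submodule_of R M A" "submodule_of R M B" "A \<subseteq> B"
  shows "F t B - F t A = num t A B - t * den t A B"
  unfolding F_def num_def den_def
  by (simp add: d_add[OF assms] algebra_simps sum.distrib sum_subtractf sum_distrib_left)

lemma slope_presented:
  assumes "presents R M A B Y p"
  shows "slope R n S a b t Y = num t A B / den t A B"
  unfolding slope_def num_def den_def dim_vec_presented[OF assms] ..

text \<open>A cover of \<open>A\<close> inside \<open>B\<close> gives a simple subquotient, whose
  copy is isomorphic to some \<open>S i\<close> because the list of simple objects is complete. This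
  is the source of the positive denominators.\<close>

lemma mult_pos:
  assumes A: "submodule_of R M A" and B: "submodule_of R M B" and "A \<subset> B"
  shows "\<exists>i<n. 0 < mult (factor_count (S i)) A B"
proof -
  obtain X where X: "covers A X" "X \<subseteq> B" using cover_exists[OF assms] by blast
  note cX = coversD[OF X(1)]
  obtain U :: "('r, 'r univ) module" and p where P: "presents R M A X U p"
    by (rule univ_copy[OF cX(1,2,4)])
  have "L U" "simple_mod R U" using subquotient_closed[OF P] presents_simple_iff[OF P] X(1) by simp_all
  then obtain i where i: "i < n" "mod_iso R U (S i)" using simples unfolding simple_objects_def by blast
  have "mult (factor_count (S i)) A X = 1"
    using mult_eq[OF perspective_invariant_factor_count chain_step[OF X(1) chain_refl[OF cX(2)]], of "S i"]
      factor_count_presented[OF P, of "S i"] i(2) by simp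
  then have "0 < mult (factor_count (S i)) A B"
    using mult_add[OF perspective_invariant_factor_count A cX(2) B cX(4) X(2), of "S i"] by simp
  then show ?thesis using i(1) by blast
qed

lemma b_pos: "i < n \<Longrightarrow> 0 < b t i"
  using stability unfolding stability_function_def by blast

lemma weighted_mult_pos:
  assumes "submodule_of R M A" "submodule_of R M B" "A \<subset> B" and w: "\<And>i. i < n \<Longrightarrow> 0 < w i"
  shows "0 < (\<Sum>i<n. w i * real (mult (factor_count (S i)) A B))"
proof -
  obtain i where "i < n" "0 < mult (factor_count (S i)) A B" using mult_pos[OF assms(1-3)] by blast
  then show ?thesis
    using w by (intro sum_pos2[of _ i]) (auto simp: less_imp_le)
qed

lemma den_pos:
  "\<lbrakk>submodule_of R M A; submodule_of R M B; A \<subset> B\<rbrakk> \<Longrightarrow> 0 < den t A B"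
  unfolding den_def by (rule weighted_mult_pos) (auto intro: b_pos)

text \<open>By \<open>F_diff\<close> the difference of \<open>F\<close> is numerator minus
  \<open>t\<close> times denominator, so its sign is that of slope minus \<open>t\<close>.\<close>

lemma slope_eq_iff:
  assumes P: "presents R M A B Y p" and "A \<noteq> B"
  shows "slope R n S a b t Y = t \<longleftrightarrow> F t B = F t A"
    and "slope R n S a b t Y \<ge> t \<longleftrightarrow> F t A \<le> F t B"
proof -
  note D = presentsD(1-3)[OF P]
  have "0 < den t A B" using den_pos D assms(2) by blast
  then show "slope R n S a b t Y = t \<longleftrightarrow> F t B = F t A" "slope R n S a b t Y \<ge> t \<longleftrightarrow> F t A \<le> F t B"
    using F_diff[OF D, of t] by (auto simp: slope_presented[OF P] field_simps)
qed

text \<open>In a pair the slope of \<open>Y\<close> is \<open>t\<close>, so semistability compares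
  the slopes of submodules with the number \<open>t\<close>. The correspondence theorem replaces
  those submodules by intervals starting at \<open>A\<close>.\<close>

lemma semistable_pair_iff:
  assumes P: "presents R M A B Y p"
  shows "semistable_pair R n S a b Y t \<longleftrightarrow> A \<noteq> B \<and> F t B = F t A \<and>
    (\<forall>H. submodule_of R M H \<longrightarrow> A \<subseteq> H \<longrightarrow> H \<subseteq> B \<longrightarrow> F t A \<le> F t H)"
proof
  note D = presentsD(1-3)[OF P]
  assume ss: "semistable_pair R n S a b Y t"
  then have "nonzero_mod Y" and slope: "slope R n S a b t Y = t"
    and sub: "\<And>H. \<lbrakk>submodule_of R Y H; H \<noteq> {\<zero>\<^bsub>Y\<^esub>}; H \<subset> carrier Y\<rbrakk> \<Longrightarrow> t \<le> slope R n S a b t (submod Y H)"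
    unfolding semistable_pair_def semistable_def by auto
  then have AB: "A \<noteq> B" using presents_nonzero_iff[OF P] by simp
  have FB: "F t B = F t A" using slope slope_eq_iff(1)[OF P AB] by simp
  have "F t A \<le> F t H" if H: "submodule_of R M H" "A \<subseteq> H" "H \<subseteq> B" for H
  proof -
    consider "H = A" | "H = B" | "H \<noteq> A" "H \<noteq> B" by blast
    then show ?thesis
    proof cases
      case 3
      note PH = presents_restrict[OF P H]
      note pi = presents_preimage_image[OF P H]
      have "p ` H \<noteq> {\<zero>\<^bsub>Y\<^esub>}" using pi preimage_zero[OF P] 3(1) by auto
      moreover have "p ` H \<subset> carrier Y"
        using pi preimage_carrier[OF P] 3(2) presentsD(5)[OF P] H(3) by auto
      ultimately have "t \<le> slope R n S a b t (submod Y (p ` H))"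
        using sub presents_submodule_image[OF P H(1,3)] by blast
      then show ?thesis using slope_eq_iff(2)[OF PH] 3(1) by blast
    qed (use FB in simp_all)
  qed
  then show "A \<noteq> B \<and> F t B = F t A \<and>
    (\<forall>H. submodule_of R M H \<longrightarrow> A \<subseteq> H \<longrightarrow> H \<subseteq> B \<longrightarrow> F t A \<le> F t H)" using AB FB by blast
next
  assume *: "A \<noteq> B \<and> F t B = F t A \<and>
    (\<forall>H. submodule_of R M H \<longrightarrow> A \<subseteq> H \<longrightarrow> H \<subseteq> B \<longrightarrow> F t A \<le> F t H)"
  then have slope: "slope R n S a b t Y = t" using slope_eq_iff(1)[OF P] by simp
  have "t \<le> slope R n S a b t (submod Y H')"
    if H': "submodule_of R Y H'" "H' \<noteq> {\<zero>\<^bsub>Y\<^esub>}" "H' \<subset> carrier Y" for H'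
  proof -
    note pre = presents_preimage[OF P H'(1)]
    have "{x \<in> B. p x \<in> H'} \<subseteq> B" by blast
    from presents_restrict[OF P pre(1,2) this]
    have PH: "presents R M A {x \<in> B. p x \<in> H'} (submod Y H') p" unfolding pre(3) .
    have "A \<noteq> {x \<in> B. p x \<in> H'}"
    proof
      assume eq: "A = {x \<in> B. p x \<in> H'}"
      have "H' = p ` {x \<in> B. p x \<in> H'}" using pre(3) by (rule sym)
      also have "\<dots> \<subseteq> {\<zero>\<^bsub>Y\<^esub>}" unfolding eq[symmetric] using preimage_zero[OF P] by auto
      finally have "H' \<subseteq> {\<zero>\<^bsub>Y\<^esub>}" .
      moreover have "\<zero>\<^bsub>Y\<^esub> \<in> H'" using right_module.submodule_ofD(2)[OF presentsD(4)[OF P] H'(1)] .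
      ultimately show False using H'(2) by blast
    qed
    then show ?thesis using slope_eq_iff(2)[OF PH] * pre(1,2) by blast
  qed
  then show "semistable_pair R n S a b Y t"
    unfolding semistable_pair_def semistable_def
    using slope presents_nonzero_iff[OF P] * by simp
qed

section \<open>Greenness as a statement about the derivative of \<open>F\<close>\<close>

lemma a_deriv: "i < n \<Longrightarrow> ((\<lambda>t. a t i) has_real_derivative deriv (\<lambda>t. a t i) t) (at t)"
  and b_deriv: "i < n \<Longrightarrow> ((\<lambda>t. b t i) has_real_derivative deriv (\<lambda>t. b t i) t) (at t)"
  using stability differentiable_on_UNIV_imp_at unfolding stability_function_def by blast+

lemma num_den_deriv:
  obtains N' D' where "((\<lambda>t. num t A B) has_real_derivative N') (at t)"
    "((\<lambda>t. den t A B) has_real_derivative D') (at t)"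
proof -
  have "((\<lambda>t. num t A B) has_real_derivative
      (\<Sum>i<n. deriv (\<lambda>t. a t i) t * real (mult (factor_count (S i)) A B))) (at t)"
    unfolding num_def by (intro DERIV_sum DERIV_cmult_right a_deriv) simp
  moreover have "((\<lambda>t. den t A B) has_real_derivative
      (\<Sum>i<n. deriv (\<lambda>t. b t i) t * real (mult (factor_count (S i)) A B))) (at t)"
    unfolding den_def by (intro DERIV_sum DERIV_cmult_right b_deriv) simp
  ultimately show thesis using that by blast
qed

text \<open>Write the slope as N/D. Where N = t D, its derivative is (N' - t D')/D, and greenness
  makes this less than 1. Multiplying by D > 0 gives N' - t D' - D < 0, and the left side is the
  derivative of N - t D, the difference of \<open>F\<close>.\<close>

lemma crossing_derivative:
  assumes A: "submodule_of R M A" and B: "submodule_of R M B" and "A \<subset> B" and eq: "F t B = F t A"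
    and ge: "\<And>H. \<lbrakk>submodule_of R M H; A \<subseteq> H; H \<subseteq> B\<rbrakk> \<Longrightarrow> F t A \<le> F t H"
  shows "\<exists>D<0. ((\<lambda>s. F s B - F s A) has_real_derivative D) (at t)"
proof -
  have AB: "A \<subseteq> B" "A \<noteq> B" using \<open>A \<subset> B\<close> by auto
  \<comment> \<open>Greenness is assumed over this type only, so it is applied to a copy of
    B/A.\<close>
  obtain U :: "('r, 'r univ) module" and p where P: "presents R M A B U p"
    by (rule univ_copy[OF A B AB(1)])
  have "semistable_pair R n S a b U t" using semistable_pair_iff[OF P] AB eq ge by blast
  then have less: "deriv (\<lambda>s. slope R n S a b s U) t < 1"
    using green subquotient_closed[OF P] unfolding green_def by blast
  obtain N' D' where N: "((\<lambda>t. num t A B) has_real_derivative N') (at t)"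
    and D: "((\<lambda>t. den t A B) has_real_derivative D') (at t)" by (rule num_den_deriv)
  have pos: "0 < den t A B" by (rule den_pos[OF A B \<open>A \<subset> B\<close>])
  have nt: "num t A B = t * den t A B" using F_diff[OF A B AB(1), of t] eq by simp
  have "((\<lambda>s. num s A B / den s A B) has_real_derivative
      (N' * den t A B - num t A B * D') / (den t A B * den t A B)) (at t)"
    using DERIV_divide[OF N D] pos by simp
  then have "deriv (\<lambda>s. slope R n S a b s U) t = (N' * den t A B - num t A B * D') / (den t A B * den t A B)"
    unfolding slope_presented[OF P] by (rule DERIV_imp_deriv)
  also have "\<dots> = (N' - t * D') / den t A B" using pos unfolding nt by (simp add: field_simps)
  finally have "N' - t * D' < den t A B" using less pos by (simp only: pos_divide_less_eq mult_1)
  moreover have "((\<lambda>s. num s A B - s * den s A B) has_real_derivative N' - (1 * den t A B + D' * t)) (at t)"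
    by (intro DERIV_diff N DERIV_mult DERIV_ident D)
  ultimately show ?thesis unfolding F_diff[OF A B AB(1)]
    by (intro exI[of _ "N' - (1 * den t A B + D' * t)"]) (auto simp: algebra_simps)
qed

lemma F_deriv_exists: "\<exists>D. ((\<lambda>t. F t H) has_real_derivative D) (at t)"
proof -
  have "((\<lambda>t. F t H) has_real_derivative (\<Sum>i<n. (deriv (\<lambda>t. a t i) t -
      (1 * b t i + deriv (\<lambda>t. b t i) t * t)) * real (d i H))) (at t)"
    unfolding F_def
    by (intro DERIV_sum DERIV_cmult_right DERIV_diff DERIV_mult DERIV_ident a_deriv b_deriv) simp_all
  then show ?thesis by blast
qed

section \<open>Continuity and behaviour for large times\<close>

lemma continuous_on_F: "continuous_on UNIV (\<lambda>t. F t H)"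
  using F_deriv_exists by (meson DERIV_isCont continuous_at_imp_continuous_on)

lemma eventually_constant:
  obtains T where "\<And>i. i < n \<Longrightarrow> \<exists>c. \<forall>t>T. a t i = c" "\<And>i. i < n \<Longrightarrow> \<exists>c. \<forall>t>T. b t i = c"
    "\<And>i. i < n \<Longrightarrow> \<exists>c. \<forall>t< -T. a t i = c" "\<And>i. i < n \<Longrightarrow> \<exists>c. \<forall>t< -T. b t i = c"
proof -
  from stability obtain T where T: "\<And>t i. \<lbrakk>\<bar>t\<bar> > T; i < n\<rbrakk> \<Longrightarrow> deriv (\<lambda>s. a s i) t = 0 \<and> deriv (\<lambda>s. b s i) t = 0"
    unfolding stability_function_def by blast
  have C: "i < n \<Longrightarrow> (\<lambda>t. a t i) C1_differentiable_on UNIV" "i < n \<Longrightarrow> (\<lambda>t. b t i) C1_differentiable_on UNIV" for i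
    using stability unfolding stability_function_def by blast+
  show thesis
    by (rule that[of "\<bar>T\<bar>"]) (use eventually_constant_of_deriv[OF C(1)] eventually_constant_of_deriv[OF C(2)] T in auto)
qed

text \<open>While the coefficients are constant, the difference of \<open>F\<close> is a line in
  \<open>t\<close> whose slope is minus the denominator, hence strictly decreasing; \<open>c\<close>
  is its zero. The point \<open>u\<close> fixes the constant values.\<close>

lemma linear_sign:
  assumes A: "submodule_of R M A" and B: "submodule_of R M B" and "A \<subset> B"
    and aI: "\<And>i. i < n \<Longrightarrow> \<exists>c. \<forall>t\<in>I. a t i = c" and bI: "\<And>i. i < n \<Longrightarrow> \<exists>c. \<forall>t\<in>I. b t i = c"
    and "u \<in> I"
  shows "\<exists>c. \<forall>t\<in>I. (c < t \<longrightarrow> F t B < F t A) \<and> (t < c \<longrightarrow> F t A < F t B)"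
proof -
  have AB: "A \<subseteq> B" using \<open>A \<subset> B\<close> by auto
  have a: "a t i = a u i" and b: "b t i = b u i" if "t \<in> I" "i < n" for t i
    using aI[OF that(2)] bI[OF that(2)] that(1) \<open>u \<in> I\<close> by auto
  have num: "num t A B = num u A B" and den: "den t A B = den u A B" if "t \<in> I" for t
    unfolding num_def den_def using a[OF that] b[OF that] by (auto intro!: sum.cong)
  have pos: "0 < den u A B" by (rule den_pos[OF A B \<open>A \<subset> B\<close>])
  have eq: "F t B - F t A = num u A B - t * den u A B" if "t \<in> I" for t
    using F_diff[OF A B AB, of t] num[OF that] den[OF that] by simp
  show ?thesis
  proof (intro exI[of _ "num u A B / den u A B"] ballI conjI impI)
    fix t assume t: "t \<in> I"
    show "F t B < F t A" if "num u A B / den u A B < t" using eq[OF t] that pos by (simp add: field_simps)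
    show "F t A < F t B" if "t < num u A B / den u A B" using eq[OF t] that pos by (simp add: field_simps)
  qed
qed

lemma F_early:
  assumes "submodule_of R M A" "submodule_of R M B" "A \<subset> B"
  shows "\<exists>T. \<forall>t\<le>T. F t A < F t B"
proof -
  obtain T where T: "\<And>i. i < n \<Longrightarrow> \<exists>c. \<forall>t< -T. a t i = c" "\<And>i. i < n \<Longrightarrow> \<exists>c. \<forall>t< -T. b t i = c"
    using eventually_constant by metis
  have "\<exists>c. \<forall>t\<in>{..< -T}. (c < t \<longrightarrow> F t B < F t A) \<and> (t < c \<longrightarrow> F t A < F t B)"
    by (rule linear_sign[OF assms, where u = "-T-1"]) (use T in \<open>simp_all add: Ball_def\<close>)
  then obtain c where "\<And>t. \<lbrakk>t < -T; t < c\<rbrakk> \<Longrightarrow> F t A < F t B" by auto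
  then show ?thesis by (intro exI[of _ "min (-T) c - 1"]) auto
qed

lemma F_late:
  assumes "submodule_of R M A" "submodule_of R M B" "A \<subset> B"
  shows "\<exists>T. \<forall>t\<ge>T. F t B < F t A"
proof -
  obtain T where T: "\<And>i. i < n \<Longrightarrow> \<exists>c. \<forall>t>T. a t i = c" "\<And>i. i < n \<Longrightarrow> \<exists>c. \<forall>t>T. b t i = c"
    using eventually_constant by metis
  have "\<exists>c. \<forall>t\<in>{T<..}. (c < t \<longrightarrow> F t B < F t A) \<and> (t < c \<longrightarrow> F t A < F t B)"
    by (rule linear_sign[OF assms, where u = "T+1"]) (use T in \<open>simp_all add: Ball_def\<close>)
  then obtain c where "\<And>t. \<lbrakk>T < t; c < t\<rbrakk> \<Longrightarrow> F t B < F t A" by auto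
  then show ?thesis by (intro exI[of _ "max T c + 1"]) auto
qed

text \<open>The multiplicities of a submodule are bounded by those of \<open>M\<close>, so finitely
  many vectors occur. They are restricted to the first \<open>n\<close> places, which are all that
  \<open>F\<close> sees, to lie in a finite product.\<close>

lemma finite_F_functions: "finite ((\<lambda>A t. F t A) ` {H. submodule_of R M H})"
proof -
  define G where "G v t = (\<Sum>i<n. (a t i - t * b t i) * real (v i))" for v :: "nat \<Rightarrow> nat" and t
  define V where "V = (\<Pi>\<^sub>E i\<in>{..<n}. {..d i (carrier M)})"
  have "finite V" unfolding V_def by (intro finite_PiE) auto
  moreover have "(\<lambda>A t. F t A) ` {H. submodule_of R M H} \<subseteq> G ` V"
  proof clarify
    fix H assume H: "submodule_of R M H"
    have "d i H \<le> d i (carrier M)" for i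
      using d_add[OF H submodule_carrier submodule_ofD(1)[OF H]] by simp
    then have "restrict (\<lambda>i. d i H) {..<n} \<in> V" unfolding V_def by auto
    moreover have "(\<lambda>t. F t H) = G (restrict (\<lambda>i. d i H) {..<n})"
      unfolding F_def G_def by (intro ext sum.cong) auto
    ultimately show "(\<lambda>t. F t H) \<in> G ` V" by blast
  qed
  ultimately show ?thesis by (meson finite_imageI finite_subset)
qed

text \<open>The second isomorphism theorem gives the identity for each multiplicity separately, and
  \<open>F\<close> is linear in them.\<close>

lemma F_valuation:
  assumes A: "submodule_of R M A" and B: "submodule_of R M B"
  shows "F t (A <+>\<^bsub>M\<^esub> B) + F t (A \<inter> B) = F t A + F t B"
proof -
  note S = submodule_sum[OF A B] and I = submodule_inter[OF A B]
  have "d i (A <+>\<^bsub>M\<^esub> B) + d i (A \<inter> B) = d i A + d i B" for i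
    using d_add[OF A S(1,2), of i] d_add[OF I B Int_lower2, of i]
      mult_second_iso[OF perspective_invariant_factor_count A B, of "S i"] by simp
  then have "real (d i (A <+>\<^bsub>M\<^esub> B)) + real (d i (A \<inter> B)) = real (d i A) + real (d i B)" for i
    by (metis of_nat_add)
  then show ?thesis unfolding F_def
    by (simp flip: sum.distrib distrib_left)
qed

section \<open>Transfer from the lattice of submodules to \<open>M\<close>\<close>

sublocale hn: hn_lattice "{H. submodule_of R M H}" "(<+>\<^bsub>M\<^esub>)" "carrier M" F rank
proof
  show "\<And>A B. \<lbrakk>A \<in> {H. submodule_of R M H}; B \<in> {H. submodule_of R M H}; A \<subset> B\<rbrakk> \<Longrightarrow> rank A < rank B"
    using rank_less by simp
  show "\<And>A B. \<lbrakk>A \<in> {H. submodule_of R M H}; B \<in> {H. submodule_of R M H}; A \<subset> B\<rbrakk> \<Longrightarrow> \<exists>T. \<forall>t\<le>T. F t A < F t B"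
    using F_early by simp
  show "\<And>A B. \<lbrakk>A \<in> {H. submodule_of R M H}; B \<in> {H. submodule_of R M H}; A \<subset> B\<rbrakk> \<Longrightarrow> \<exists>T. \<forall>t\<ge>T. F t B < F t A"
    using F_late by simp
  show "\<exists>D<0. ((\<lambda>s. F s B - F s A) has_real_derivative D) (at t)"
    if "A \<in> {H. submodule_of R M H}" "B \<in> {H. submodule_of R M H}" "A \<subset> B" "F t B = F t A"
      "\<And>H. \<lbrakk>H \<in> {H. submodule_of R M H}; A \<subseteq> H; H \<subseteq> B\<rbrakk> \<Longrightarrow> F t A \<le> F t H" for A B t
    by (rule crossing_derivative) (use that in auto)
  show "finite ((\<lambda>A t. F t A) ` {H. submodule_of R M H})" by (rule finite_F_functions)
qed (use submodule_inter submodule_sum submodule_carrier submodule_ofD(1) F_valuation continuous_on_F in simp_all)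

lemma HN_filtration_iff: "HN_filtration R n S a b M ts Ms \<longleftrightarrow> hn.hn {\<zero>\<^bsub>M\<^esub>} ts Ms"
proof -
  have "semistable_pair R n S a b (quotmod (submod M B) A) t \<longleftrightarrow> hn.piece A B t"
    if "submodule_of R M A" "submodule_of R M B" "A \<subset> B" for A B t
    using semistable_pair_iff[OF presents_quotient[OF that(1,2)], of t] that
    unfolding hn.piece_def by auto
  moreover have "A \<subset> B" if "hn.piece A B t" for A B t using that by (simp add: hn.piece_def)
  ultimately have eq: "A \<subset> B \<and> semistable_pair R n S a b (quotmod (submod M B) A) t \<longleftrightarrow> hn.piece A B t"
    if "submodule_of R M A" "submodule_of R M B" for A B t using that by blast
  have "(\<forall>i<length ts. Ms ! i \<subset> Ms ! Suc i \<and>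
        semistable_pair R n S a b (quotmod (submod M (Ms ! Suc i)) (Ms ! i)) (ts ! i)) \<longleftrightarrow>
      (\<forall>i<length ts. hn.piece (Ms ! i) (Ms ! Suc i) (ts ! i))"
    if "length Ms = Suc (length ts)" "\<forall>N\<in>set Ms. submodule_of R M N"
    using eq that by simp
  then show ?thesis
    unfolding HN_filtration_def hn.hn_iff mem_Collect_eq by blast
qed

text \<open>Viewing \<open>H\<close> as the subquotient of \<open>H\<close> by zero turns the
  equation in \<open>first_time\<close> into a zero of a difference of \<open>F\<close>. A smallest
  zero exists, so the \<open>LEAST\<close> is attained.\<close>

lemma first_time_submod:
  assumes H: "submodule_of R M H" "H \<noteq> {\<zero>\<^bsub>M\<^esub>}"
  shows "F (first_time R n S a b (submod M H)) H = F (first_time R n S a b (submod M H)) {\<zero>\<^bsub>M\<^esub>}"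
    and "F s H = F s {\<zero>\<^bsub>M\<^esub>} \<Longrightarrow> first_time R n S a b (submod M H) \<le> s"
proof -
  have "{\<zero>\<^bsub>M\<^esub>} \<subset> H" using zero_sub[OF H(1)] H(2) by blast
  then obtain t where t: "F t H = F t {\<zero>\<^bsub>M\<^esub>}" "\<And>s. F s H = F s {\<zero>\<^bsub>M\<^esub>} \<Longrightarrow> t \<le> s"
    using hn.first_zero[of "{\<zero>\<^bsub>M\<^esub>}" H] H(1) submodule_zero by auto
  have "slope R n S a b s (submod M H) = s \<longleftrightarrow> F s H = F s {\<zero>\<^bsub>M\<^esub>}" for s
    using slope_eq_iff(1)[OF presents_id[OF H(1)]] H(2) by simp
  then have "first_time R n S a b (submod M H) = t"
    unfolding first_time_def using t by (intro Least_equality) simp_all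
  then show "F (first_time R n S a b (submod M H)) H = F (first_time R n S a b (submod M H)) {\<zero>\<^bsub>M\<^esub>}"
    "F s H = F s {\<zero>\<^bsub>M\<^esub>} \<Longrightarrow> first_time R n S a b (submod M H) \<le> s" using t by simp_all
qed

theorem HN_filtration_unique_existence:
  "\<exists>!(ts, Ms). HN_filtration R n S a b M ts Ms"
proof -
  obtain ts Ms where ex: "hn.hn {\<zero>\<^bsub>M\<^esub>} ts Ms" using hn.hn_exists[of "{\<zero>\<^bsub>M\<^esub>}"] submodule_zero by auto
  show ?thesis
  proof (rule ex1I[of _ "(ts, Ms)"])
    show "case (ts, Ms) of (ts, Ms) \<Rightarrow> HN_filtration R n S a b M ts Ms" using ex by (simp add: HN_filtration_iff)
    fix x assume "case x of (ts, Ms) \<Rightarrow> HN_filtration R n S a b M ts Ms"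
    then show "x = (ts, Ms)" using hn.hn_unique[OF ex] by (auto simp: HN_filtration_iff)
  qed
qed

text \<open>The first time bounds the first time of each nonzero submodule from below. A submodule
  whose \<open>F\<close> has the value of zero at that time attains the bound, so the
  \<open>LEAST\<close> over submodules is this time.\<close>

theorem HN_filtration_first_time:
  assumes HN: "HN_filtration R n S a b M ts Ms"
  shows "ts \<noteq> [] \<and> hd ts = first_sub_time R n S a b M"
proof -
  have hn: "hn.hn {\<zero>\<^bsub>M\<^esub>} ts Ms" using HN by (simp add: HN_filtration_iff)
  have ne: "ts \<noteq> []" using hn nonzero by (cases ts) (auto simp: nonzero_mod_def)
  then obtain t us where ts: "ts = t # us" by (cases ts) auto
  note first = hn.hn_first_time[OF hn[unfolded ts]]
  have le: "t \<le> first_time R n S a b (submod M H)" if H: "submodule_of R M H" "H \<noteq> {\<zero>\<^bsub>M\<^esub>}" for H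
    using first(2)[of H] first_time_submod(1)[OF H] zero_sub[OF H(1)] H by auto
  obtain H where H: "submodule_of R M H" "{\<zero>\<^bsub>M\<^esub>} \<subset> H" "F t H = F t {\<zero>\<^bsub>M\<^esub>}" using first(1) by blast
  then have "first_time R n S a b (submod M H) = t"
    using first_time_submod(2)[of H t] le[of H] by force
  then have "first_sub_time R n S a b M = t"
    unfolding first_sub_time_def using H(1,2) le by (intro Least_equality) auto
  then show ?thesis using ts by simp
qed

end

section \<open>Modules that are finite dimensional over a field\<close>

text \<open>Common interface of the two cases: \<open>K\<close> acts on modules through a map into
  \<open>R\<close>, namely scalar multiples of the unit of the algebra, or diagonal elements of
  degree zero in the tensor algebra.\<close>

locale scalar_ring_hom = K: field K
  for K :: "('k, 'x) ring_scheme" and R :: "('r, 'y) ring_scheme" and \<phi> :: "'k \<Rightarrow> 'r" +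
  assumes add_closed: "\<lbrakk>r \<in> carrier R; s \<in> carrier R\<rbrakk> \<Longrightarrow> r \<oplus>\<^bsub>R\<^esub> s \<in> carrier R"
    and mult_closed: "\<lbrakk>r \<in> carrier R; s \<in> carrier R\<rbrakk> \<Longrightarrow> r \<otimes>\<^bsub>R\<^esub> s \<in> carrier R"
    and one_closed: "\<one>\<^bsub>R\<^esub> \<in> carrier R"
    and hom_closed: "k \<in> carrier K \<Longrightarrow> \<phi> k \<in> carrier R"
    and hom_add: "\<lbrakk>k \<in> carrier K; k' \<in> carrier K\<rbrakk> \<Longrightarrow> \<phi> (k \<oplus>\<^bsub>K\<^esub> k') = \<phi> k \<oplus>\<^bsub>R\<^esub> \<phi> k'"
    and hom_mult: "\<lbrakk>k \<in> carrier K; k' \<in> carrier K\<rbrakk> \<Longrightarrow> \<phi> (k \<otimes>\<^bsub>K\<^esub> k') = \<phi> k \<otimes>\<^bsub>R\<^esub> \<phi> k'"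
    and hom_one: "\<phi> \<one>\<^bsub>K\<^esub> = \<one>\<^bsub>R\<^esub>"
begin

definition scalars :: "('r, 'm) module \<Rightarrow> ('k, 'm) module" where
  "scalars M = with_scalars M (\<lambda>k x. \<phi> k \<odot>\<^bsub>M\<^esub> x)"

lemma closed_right_module: "right_module R M \<Longrightarrow> closed_right_module R M"
  by (intro closed_right_module.intro closed_right_module_axioms.intro add_closed mult_closed one_closed)

lemma scalar_action:
  assumes "right_module R M"
  shows "scalar_action K M (\<lambda>k x. \<phi> k \<odot>\<^bsub>M\<^esub> x)"
proof -
  interpret M: right_module R M by (rule assms)
  show ?thesis
  proof (intro scalar_action.intro scalar_action_axioms.intro)
    \<comment> \<open>A right module composes scalars in the opposite order; commutativity of
      \<open>K\<close> repairs this.\<close>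
    show "\<phi> (k \<otimes>\<^bsub>K\<^esub> k') \<odot>\<^bsub>M\<^esub> x = \<phi> k \<odot>\<^bsub>M\<^esub> (\<phi> k' \<odot>\<^bsub>M\<^esub> x)"
      if "k \<in> carrier K" "k' \<in> carrier K" "x \<in> carrier M" for k k' x
      using that by (simp add: K.m_comm[of k k'] hom_mult hom_closed M.act_mult)
  qed (auto simp: hom_closed hom_add hom_one M.act_closed M.act_add_scalar M.act_add_vector M.act_one
      intro: M.abelian_group_axioms K.field_axioms)
qed

lemma submodule_subspace:
  assumes "right_module R M" "submodule_of R M H"
  shows "scalar_action.subspace K M (\<lambda>k x. \<phi> k \<odot>\<^bsub>M\<^esub> x) H"
proof -
  interpret M: right_module R M by (rule assms)
  interpret A: scalar_action K M "\<lambda>k x. \<phi> k \<odot>\<^bsub>M\<^esub> x" by (rule scalar_action[OF assms(1)])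
  show ?thesis unfolding A.subspace_def using M.submodule_ofD[OF assms(2)] hom_closed by auto
qed

lemma ranked_module_exists:
  assumes M: "right_module R M" and fin: "finitely_spanned K (scalars M)"
  shows "\<exists>rank. ranked_module R M rank"
proof -
  interpret A: scalar_action K M "\<lambda>k x. \<phi> k \<odot>\<^bsub>M\<^esub> x" by (rule scalar_action[OF M])
  obtain X where X: "finite X" "X \<subseteq> carrier M" "carrier M = A.kspan X"
    using fin unfolding scalars_def A.finitely_spanned_iff_kspan by blast
  obtain rank :: "_ \<Rightarrow> nat" where r: "\<And>W W'. \<lbrakk>A.subspace W; A.subspace W'; W \<subset> W'\<rbrakk> \<Longrightarrow> rank W < rank W'"
    using A.subspace_rank_exists[OF X] by blast
  have "ranked_module R M rank"
    by (intro ranked_module.intro closed_right_module M ranked_module_axioms.intro r submodule_subspace[OF M])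
  then show ?thesis by blast
qed

text \<open>The submodule \<open>B\<close> is a subspace of a finite dimensional space, hence
  spanned by a finite set over \<open>K\<close>; its image under \<open>p\<close> spans
  \<open>Y\<close>.\<close>

lemma finitely_spanned_subquotient:
  assumes M: "right_module R M" and fin: "finitely_spanned K (scalars M)"
    and P: "presents R M A B Y p"
  shows "finitely_spanned K (scalars Y)"
proof -
  interpret M: closed_right_module R M by (rule closed_right_module[OF M])
  note D = M.presentsD[OF P]
  interpret A: scalar_action K M "\<lambda>k x. \<phi> k \<odot>\<^bsub>M\<^esub> x" by (rule scalar_action[OF M])
  interpret Y: scalar_action K Y "\<lambda>k x. \<phi> k \<odot>\<^bsub>Y\<^esub> x" by (rule scalar_action[OF D(4)])
  obtain X where X: "finite X" "X \<subseteq> carrier M" "carrier M = A.kspan X"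
    using fin unfolding scalars_def A.finitely_spanned_iff_kspan by blast
  obtain G where G: "finite G" "G \<subseteq> B" "B = A.kspan G"
    using A.subspace_rank_exists[OF X] submodule_subspace[OF M D(2)] by blast
  have pG: "p ` G \<subseteq> carrier Y" using G(2) D(11) by blast
  have "p x \<in> Y.kspan (p ` G) \<and> x \<in> B" if "x \<in> A.kspan G" for x
    using that
  proof induction
    case kspan_zero
    then show ?case using D(9) Y.kspan_zero M.submodule_ofD(2)[OF D(2)] by simp
  next
    case (kspan_step y k u)
    then have *: "y \<in> B" "u \<in> B" "\<phi> k \<in> carrier R" "\<phi> k \<odot>\<^bsub>M\<^esub> y \<in> B"
      using G(2) hom_closed M.submodule_ofD(6)[OF D(2)] by auto
    then have "p (\<phi> k \<odot>\<^bsub>M\<^esub> y \<oplus>\<^bsub>M\<^esub> u) = \<phi> k \<odot>\<^bsub>Y\<^esub> p y \<oplus>\<^bsub>Y\<^esub> p u"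
      using D(6)[of "\<phi> k \<odot>\<^bsub>M\<^esub> y" u] D(7)[of "\<phi> k" y] by simp
    then show ?case
      using Y.kspan_step[of "p y" "p ` G" k "p u"] kspan_step M.submodule_ofD(4)[OF D(2)] * by simp
  qed
  then have "p ` B \<subseteq> Y.kspan (p ` G)" using G(3) by blast
  then have "carrier Y = Y.kspan (p ` G)" using D(5) Y.kspan_carrier[OF pG] by blast
  then show ?thesis
    unfolding scalars_def Y.finitely_spanned_iff_kspan using G(1) pG by blast
qed

lemma finitely_spanned_of_scalars:
  assumes fin: "finitely_spanned K (scalars M)"
  shows "finitely_spanned R M"
proof -
  have c: "carrier (scalars M) = carrier M" "smult (scalars M) = (\<lambda>k x. \<phi> k \<odot>\<^bsub>M\<^esub> x)" "finsum (scalars M) = finsum M"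
    by (simp_all add: scalars_def finsum_with_scalars) (simp_all add: with_scalars_def)
  from fin obtain X where X: "finite X" "X \<subseteq> carrier M"
    "\<And>x. x \<in> carrier M \<Longrightarrow> \<exists>c\<in>X \<rightarrow> carrier K. x = finsum M (\<lambda>y. \<phi> (c y) \<odot>\<^bsub>M\<^esub> y) X"
    unfolding finitely_spanned_def c by blast
  have "\<exists>c\<in>X \<rightarrow> carrier R. x = finsum M (\<lambda>y. c y \<odot>\<^bsub>M\<^esub> y) X" if x: "x \<in> carrier M" for x
  proof -
    from X(3)[OF x] obtain c where "c \<in> X \<rightarrow> carrier K" "x = finsum M (\<lambda>y. \<phi> (c y) \<odot>\<^bsub>M\<^esub> y) X" by blast
    then show ?thesis using hom_closed by (intro bexI[of _ "\<lambda>y. \<phi> (c y)"]) auto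
  qed
  then show ?thesis unfolding finitely_spanned_def using X(1,2) by blast
qed

text \<open>An injective numbering of the generators lets a function on the naturals serve as a
  family of coefficients.\<close>

lemma parametrization_exists:
  fixes M :: "('r, 'm) module"
  assumes M: "right_module R M" and fin: "finitely_spanned R M"
  shows "\<exists>s :: (nat \<Rightarrow> 'r) \<Rightarrow> 'm. carrier M \<subseteq> range s"
proof -
  interpret M: right_module R M by (rule M)
  from fin obtain X where X: "finite X" "X \<subseteq> carrier M"
    "\<And>x. x \<in> carrier M \<Longrightarrow> \<exists>c\<in>X \<rightarrow> carrier R. x = finsum M (\<lambda>y. c y \<odot>\<^bsub>M\<^esub> y) X"
    unfolding finitely_spanned_def by blast
  obtain g :: "'m \<Rightarrow> nat" where g: "inj_on g X" using finite_imp_inj_to_nat_seg[OF X(1)] by blast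
  define s where "s f = finsum M (\<lambda>y. f (g y) \<odot>\<^bsub>M\<^esub> y) X" for f :: "nat \<Rightarrow> 'r"
  have "x \<in> range s" if x: "x \<in> carrier M" for x
  proof -
    from X(3)[OF x] obtain c where c: "c \<in> X \<rightarrow> carrier R" "x = finsum M (\<lambda>y. c y \<odot>\<^bsub>M\<^esub> y) X" by blast
    have "s (\<lambda>i. c (the_inv_into X g i)) = x"
      unfolding s_def c(2) using c(1) X(2) g
      by (intro M.finsum_cong') (auto simp: the_inv_into_f_f intro!: M.act_closed)
    then show ?thesis by blast
  qed
  then show ?thesis by blast
qed

lemma HN_filtration_finite_dimensional:
  fixes M :: "('r, 'm) module"
  assumes M: "right_module R M" and fin: "finitely_spanned K (scalars M)"
    and L: "\<And>A B Y p. presents R M A B (Y :: ('r, 'r univ) module) p \<Longrightarrow> L Y"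
    and "simple_objects R L n S" "stability_function n Z a b" "green R L n S a b" "nonzero_mod M"
  shows "(\<exists>!(ts, Ms). HN_filtration R n S a b M ts Ms) \<and>
     (\<forall>ts Ms. HN_filtration R n S a b M ts Ms \<longrightarrow> ts \<noteq> [] \<and> hd ts = first_sub_time R n S a b M)"
proof -
  obtain rank where "ranked_module R M rank" using ranked_module_exists[OF M fin] by blast
  then interpret stability_setting R M rank L n S Z a b
    by (intro stability_setting.intro stability_setting_axioms.intro L assms(4-7)
        parametrization_exists[OF M finitely_spanned_of_scalars[OF fin]])
  show ?thesis using HN_filtration_unique_existence HN_filtration_first_time by blast
qed

end

lemma HN_filtration_fd_algebra:
  fixes A :: "('k, 'l) module" and M :: "('l, 'm) module"
  assumes A: "fd_algebra K A" and M: "fd_right_module K A M"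
    and "simple_objects A (fd_right_module K A) n S" "stability_function n Z a b"
      "green A (fd_right_module K A) n S a b" "nonzero_mod M"
  shows "(\<exists>!(ts, Ms). HN_filtration A n S a b M ts Ms) \<and>
     (\<forall>ts Ms. HN_filtration A n S a b M ts Ms \<longrightarrow> ts \<noteq> [] \<and> hd ts = first_sub_time A n S a b M)"
proof -
  interpret K: field K using A by (simp add: fd_algebra_def)
  interpret A: ring A using A by (simp add: fd_algebra_def)
  interpret A: Module.module K A using A by (simp add: fd_algebra_def)
  have m: "(k \<odot>\<^bsub>A\<^esub> x) \<otimes>\<^bsub>A\<^esub> y = k \<odot>\<^bsub>A\<^esub> (x \<otimes>\<^bsub>A\<^esub> y)"
    if "k \<in> carrier K" "x \<in> carrier A" "y \<in> carrier A" for k x y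
    using A that by (simp add: fd_algebra_def)
  interpret \<phi>: scalar_ring_hom K A "\<lambda>k. k \<odot>\<^bsub>A\<^esub> \<one>\<^bsub>A\<^esub>"
    by unfold_locales (auto simp: A.smult_l_distr A.smult_assoc1 m)
  have M': "right_module A M" "finitely_spanned K (\<phi>.scalars M)"
    using M by (simp_all add: fd_right_module_def \<phi>.scalars_def)
  show ?thesis
  proof (rule \<phi>.HN_filtration_finite_dimensional[OF M' _ assms(3-6)])
    fix C B Y p assume P: "presents A M C B (Y :: ('l, 'l univ) module) p"
    then have "right_module A Y" by (simp add: presents_def)
    then show "fd_right_module K A Y"
      using \<phi>.finitely_spanned_subquotient[OF M' P] by (simp add: fd_right_module_def \<phi>.scalars_def)
  qed
qed

section \<open>The relations of the tensor algebra form a two-sided ideal\<close>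

lemma path_words_iff:
  "Path js xs \<in> path_words n Q \<longleftrightarrow> xs \<noteq> [] \<and> length js = Suc (length xs) \<and> set js \<subseteq> {..<n} \<and>
     (\<forall>r<length xs. xs ! r \<in> carrier (Q (js ! r) (js ! Suc r)))"
  by (auto simp: path_words_def)

lemma path_words_update:
  "\<lbrakk>Path js xs \<in> path_words n Q; x \<in> carrier (Q (js ! r) (js ! Suc r))\<rbrakk> \<Longrightarrow>
     Path js (xs[r := x]) \<in> path_words n Q"
  by (cases "r < length xs") (auto simp: path_words_iff nth_list_update)

lemma path_vertex:
  "\<lbrakk>Path js xs \<in> path_words n Q; r \<le> length xs\<rbrakk> \<Longrightarrow> js ! r < n"
  by (metis le_imp_less_Suc lessThan_iff nth_mem path_words_iff subsetD)

lemma path_append_nth: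
  assumes "Path js xs \<in> path_words n Q" "Path ls ys \<in> path_words n Q" "js ! length xs = ls ! 0"
  shows "r \<le> length xs \<Longrightarrow> (js @ tl ls) ! r = js ! r"
    and "r \<le> length ys \<Longrightarrow> (js @ tl ls) ! (length xs + r) = ls ! r"
proof -
  have l: "length js = Suc (length xs)" "length ls = Suc (length ys)" using assms by (auto simp: path_words_iff)
  show "r \<le> length xs \<Longrightarrow> (js @ tl ls) ! r = js ! r" using l by (simp add: nth_append)
  show "r \<le> length ys \<Longrightarrow> (js @ tl ls) ! (length xs + r) = ls ! r"
    using l assms(3) by (cases r) (auto simp: nth_append nth_tl)
qed

lemma path_words_append:
  assumes P: "Path js xs \<in> path_words n Q" "Path ls ys \<in> path_words n Q" "js ! length xs = ls ! 0"
  shows "Path (js @ tl ls) (xs @ ys) \<in> path_words n Q"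
proof -
  note nth = path_append_nth[OF P]
  have "(xs @ ys) ! r \<in> carrier (Q ((js @ tl ls) ! r) ((js @ tl ls) ! Suc r))" if r: "r < length (xs @ ys)" for r
  proof (cases "r < length xs")
    case True
    then show ?thesis using P(1) nth(1)[of r] nth(1)[of "Suc r"] by (auto simp: path_words_iff nth_append)
  next
    case False
    then obtain q where "r = length xs + q" using le_Suc_ex not_less by blast
    then show ?thesis using r P(2) nth(2)[of q] nth(2)[of "Suc q"] by (auto simp: path_words_iff)
  qed
  moreover have "set (tl ls) \<subseteq> set ls" by (cases ls) auto
  ultimately show ?thesis using P by (auto simp: path_words_iff)
qed

text \<open>The relations modify lists at a position, whereas \<open>tword_mult\<close> takes heads
  and ends of lists. This lemma and the next two restate the products with positions, so that
  multiplied relations can be recognised as relations.\<close>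

lemma tword_mult_Vert_Path:
  assumes "Path js xs \<in> path_words n Q"
  shows "tword_mult F Q (Vert i f) (Path js xs) =
    (if i = js ! 0 then frag_of (Path js (xs[0 := lact (Q (js ! 0) (js ! Suc 0)) f (xs ! 0)])) else 0)"
proof -
  obtain j js' x xs' where "js = j # js'" "xs = x # xs'"
    using assms by (cases js; cases xs) (auto simp: path_words_iff)
  then show ?thesis by simp
qed

lemma tword_mult_Path_Vert:
  assumes "Path js xs \<in> path_words n Q" and l: "length xs = Suc l"
  shows "tword_mult F Q (Path js xs) (Vert j g) =
    (if js ! Suc l = j then frag_of (Path js (xs[l := ract (Q (js ! l) (js ! Suc l)) (xs ! l) g])) else 0)"
proof -
  have js: "length js = Suc (Suc l)" using assms by (simp add: path_words_iff)
  then have ne: "js \<noteq> []" "xs \<noteq> []" "butlast js \<noteq> []" using l by (auto simp: length_Suc_conv)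
  have "last js = js ! Suc l" "last (butlast js) = js ! l" "last xs = xs ! l"
    using ne js l by (simp_all add: last_conv_nth nth_butlast)
  moreover have "butlast xs @ [y] = xs[l := y]" for y
  proof -
    have "xs[l := y] = (butlast xs @ [last xs])[l := y]" using ne by simp
    also have "\<dots> = butlast xs @ [y]" using l by (simp only: list_update_append length_butlast) simp
    finally show ?thesis ..
  qed
  ultimately show ?thesis by simp
qed

lemma tword_mult_Path_Path:
  assumes "Path js xs \<in> path_words n Q" "Path ls ys \<in> path_words n Q"
  shows "tword_mult F Q (Path js xs) (Path ls ys) =
    (if js ! length xs = ls ! 0 then frag_of (Path (js @ tl ls) (xs @ ys)) else 0)"
proof -
  have "js \<noteq> []" "ls \<noteq> []" "length js = Suc (length xs)" using assms by (auto simp: path_words_iff)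
  then have "last js = js ! length xs" "hd ls = ls ! 0" by (simp_all add: last_conv_nth hd_conv_nth)
  then show ?thesis by simp
qed

declare tword_mult.simps(2-4) [simp del]

locale modulated =
  fixes K :: "('k, 'x) ring_scheme" and n :: nat and F :: "nat \<Rightarrow> ('k, 'f) module"
    and Q :: "nat \<Rightarrow> nat \<Rightarrow> ('f, 'q) bimodule"
  assumes modulated_quiver: "modulated_quiver K n F Q"
begin

abbreviation "W \<equiv> twords n F Q"
abbreviation "T0 \<equiv> tword_ring n F Q"
abbreviation "I \<equiv> tensor_rels n F Q"
abbreviation "T \<equiv> tensor_algebra n F Q"

lemma field_K: "field K"
  using modulated_quiver by (simp add: modulated_quiver_def)

lemma F_algebra: "i < n \<Longrightarrow> fd_algebra K (F i)"
  using modulated_quiver by (simp add: modulated_quiver_def fd_division_algebra_def)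

lemma F_ring: "i < n \<Longrightarrow> ring (F i)"
  using F_algebra by (simp add: fd_algebra_def)

lemma F_module: "i < n \<Longrightarrow> Module.module K (F i)"
  using F_algebra by (simp add: fd_algebra_def)

lemma Q_bimodule: "\<lbrakk>i < n; j < n\<rbrakk> \<Longrightarrow> fd_bimodule K (F i) (F j) (Q i j)"
  using modulated_quiver by (simp add: modulated_quiver_def)

lemma Vert_in: "\<lbrakk>i < n; f \<in> carrier (F i)\<rbrakk> \<Longrightarrow> Vert i f \<in> W"
  by (auto simp: twords_def)

lemma Path_in: "Path js xs \<in> path_words n Q \<Longrightarrow> Path js xs \<in> W"
  by (auto simp: twords_def)

lemma twords_cases:
  assumes "w \<in> W"
  obtains (Vert) i f where "w = Vert i f" "i < n" "f \<in> carrier (F i)"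
    | (Path) js xs where "w = Path js xs" "Path js xs \<in> path_words n Q"
  using assms unfolding twords_def by (cases w) (auto simp: path_words_def)

lemma path_bimodule:
  "\<lbrakk>Path js xs \<in> path_words n Q; r < length xs\<rbrakk> \<Longrightarrow>
     fd_bimodule K (F (js ! r)) (F (js ! Suc r)) (Q (js ! r) (js ! Suc r)) \<and> xs ! r \<in> carrier (Q (js ! r) (js ! Suc r))"
  using Q_bimodule path_vertex[of js xs n Q r] path_vertex[of js xs n Q "Suc r"] by (auto simp: path_words_iff)

definition tmul :: "(('f, 'q) tword \<Rightarrow>\<^sub>0 int) \<Rightarrow> (('f, 'q) tword \<Rightarrow>\<^sub>0 int) \<Rightarrow> (('f, 'q) tword \<Rightarrow>\<^sub>0 int)" where
  "tmul u v = frag_extend (\<lambda>x. frag_extend (\<lambda>y. tword_mult F Q x y) v) u"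

lemma tmul_frag_of [simp]: "tmul (frag_of v) (frag_of w) = tword_mult F Q v w"
  by (simp add: tmul_def)

lemma tmul_zero_left [simp]: "tmul 0 v = 0"
  by (simp add: tmul_def)

lemma tmul_diff_left: "tmul (u - u') v = tmul u v - tmul u' v"
  by (simp add: tmul_def frag_extend_diff)

lemma tmul_add_left: "tmul (u + u') v = tmul u v + tmul u' v"
  by (simp add: tmul_def frag_extend_add)

lemma tmul_zero_right [simp]: "tmul u 0 = 0"
  unfolding tmul_def by (simp add: frag_extend_eq_0)

text \<open>Additivity on the left is immediate from the outer \<open>frag_extend\<close>; on the
  right it is reached by induction over the left factor.\<close>

lemma tmul_diff_right: "tmul u (v - v') = tmul u v - tmul u v'"
proof -
  have "Poly_Mapping.keys u \<subseteq> UNIV" by simp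
  then show ?thesis
  proof (induction u rule: frag_induction)
    case (one x)
    then show ?case by (simp add: tmul_def frag_extend_diff)
  next
    case (diff a b)
    then show ?case by (simp add: tmul_diff_left)
  qed simp
qed

lemma tmul_add_right: "tmul u (v + v') = tmul u v + tmul u v'"
  using tmul_diff_right[of u v "- v'"] tmul_diff_right[of u 0 v'] by simp

lemma zero_in_I: "0 \<in> I"
  unfolding tensor_rels_def using generate.one[of "free_Abelian_group W"] by simp

lemma trels_in_I: "r \<in> trels n F Q \<Longrightarrow> r \<in> I"
  unfolding tensor_rels_def by (rule generate.incl)

lemma add_in_I: "\<lbrakk>u \<in> I; v \<in> I\<rbrakk> \<Longrightarrow> u + v \<in> I"
  unfolding tensor_rels_def using generate.eng[of u "free_Abelian_group W" _ v] by simp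

text \<open>The product with a word vanishes when the vertices do not match, and otherwise is a
  relation again: additivity at a vertex passes into additivity in a path through the bimodule
  action, concatenation only shifts nothing to the left of it, and a vertex at the end acts on the
  last factor.\<close>

lemma rel_mult_word:
  assumes r: "r \<in> trels n F Q" and w: "w \<in> W"
  shows "tmul r (frag_of w) \<in> I"
  using r
proof cases
  case (vert_add i f g)
  interpret Fi: ring "F i" using F_ring vert_add by simp
  from w show ?thesis
  proof (cases rule: twords_cases)
    case (Vert j h)
    show ?thesis
    proof (cases "j = i")
      case True
      then show ?thesis
        using Vert vert_add trels_in_I[OF trels.vert_add[of i n "f \<otimes>\<^bsub>F i\<^esub> h" F "g \<otimes>\<^bsub>F i\<^esub> h" Q]]
        by (simp add: tmul_diff_left Fi.l_distr)
    qed (use Vert vert_add in \<open>auto simp: tmul_diff_left zero_in_I\<close>)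
  next
    case (Path js xs)
    show ?thesis
    proof (cases "i = js ! 0")
      case True
      have 0: "0 < length xs" using Path(2) by (auto simp: path_words_iff)
      then interpret B: fd_bimodule K "F (js ! 0)" "F (js ! Suc 0)" "Q (js ! 0) (js ! Suc 0)"
        using path_bimodule[OF Path(2), of 0] by simp
      have x: "xs ! 0 \<in> carrier (Q (js ! 0) (js ! Suc 0))" using path_bimodule[OF Path(2) 0] by simp
      show ?thesis
        using trels_in_I[OF trels.path_add[OF Path(2) 0, of "lact (Q (js ! 0) (js ! Suc 0)) f (xs ! 0)" "lact (Q (js ! 0) (js ! Suc 0)) g (xs ! 0)" F]]
          vert_add Path True x
        by (simp add: tmul_diff_left tword_mult_Vert_Path B.lact_closed B.lact_add_scalar)
    qed (use Path vert_add in \<open>simp add: tmul_diff_left tword_mult_Vert_Path zero_in_I\<close>)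
  qed
next
  case (path_add js xs r x y)
  note pw = path_add(2) and rl = path_add(3)
  let ?q = "Q (js ! r) (js ! Suc r)"
  interpret B: fd_bimodule K "F (js ! r)" "F (js ! Suc r)" ?q using path_bimodule[OF pw rl] by simp
  have upd: "Path js (xs[r := z]) \<in> path_words n Q" if "z \<in> carrier ?q" for z
    using path_words_update[OF pw that] .
  have xy: "x \<oplus>\<^bsub>?q\<^esub> y \<in> carrier ?q" using path_add by simp
  from w show ?thesis
  proof (cases rule: twords_cases)
    case (Vert j g)
    obtain l where l: "length xs = Suc l" using rl by (cases "length xs") auto
    show ?thesis
    proof (cases "js ! Suc l = j")
      case j: True
      interpret E: fd_bimodule K "F (js ! l)" "F (js ! Suc l)" "Q (js ! l) (js ! Suc l)"
        using path_bimodule[OF pw, of l] l by simp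
      have xl: "xs ! l \<in> carrier (Q (js ! l) (js ! Suc l))" using path_bimodule[OF pw, of l] l by simp
      show ?thesis
      proof (cases "r = l")
        case True
        show ?thesis
          using trels_in_I[OF trels.path_add[OF pw rl, of "ract ?q x g" "ract ?q y g" F]] path_add Vert j[symmetric] True l upd xy
          by (simp add: tmul_diff_left tword_mult_Path_Vert[where l = l and n = n] E.ract_closed E.ract_add_vector)
      next
        case False
        have "Path js (xs[l := ract (Q (js ! l) (js ! Suc l)) (xs ! l) g]) \<in> path_words n Q"
          using path_words_update[OF pw] E.ract_closed xl Vert j by simp
        from trels_in_I[OF trels.path_add[OF this, of r x y F]] show ?thesis
          using path_add Vert j False l upd xy
          by (simp add: tmul_diff_left tword_mult_Path_Vert[where l = l and n = n] list_update_swap)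
      qed
    qed (use Vert path_add l upd xy in \<open>simp add: tmul_diff_left tword_mult_Path_Vert[where l = l and n = n] zero_in_I\<close>)
  next
    case (Path ls ys)
    show ?thesis
    proof (cases "js ! length xs = ls ! 0")
      case True
      note nth = path_append_nth(1)[OF pw Path(2) True]
      have "(js @ tl ls) ! r = js ! r" "(js @ tl ls) ! Suc r = js ! Suc r" using nth[of r] nth[of "Suc r"] rl by simp_all
      with trels_in_I[OF trels.path_add[OF path_words_append[OF pw Path(2) True], of r x y F]] show ?thesis
        using path_add Path True upd xy
        by (simp add: tmul_diff_left tword_mult_Path_Path[where n = n] list_update_append1)
    qed (use Path path_add upd xy in \<open>simp add: tmul_diff_left tword_mult_Path_Path[where n = n] zero_in_I\<close>)
  qed
next
  case (path_balanced js xs r c)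
  note pw = path_balanced(2)
  have rl: "r < length xs" "Suc r < length xs" using path_balanced by auto
  let ?q = "Q (js ! r) (js ! Suc r)" and ?q' = "Q (js ! Suc r) (js ! Suc (Suc r))"
  interpret B: fd_bimodule K "F (js ! r)" "F (js ! Suc r)" ?q using path_bimodule[OF pw rl(1)] by simp
  interpret B': fd_bimodule K "F (js ! Suc r)" "F (js ! Suc (Suc r))" ?q' using path_bimodule[OF pw rl(2)] by simp
  have x: "xs ! r \<in> carrier ?q" "xs ! Suc r \<in> carrier ?q'"
    using path_bimodule[OF pw rl(1)] path_bimodule[OF pw rl(2)] by simp_all
  have upd: "Path js (xs[r := ract ?q (xs ! r) c]) \<in> path_words n Q"
    "Path js (xs[Suc r := lact ?q' c (xs ! Suc r)]) \<in> path_words n Q"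
    using path_words_update[OF pw B.ract_closed[OF path_balanced(4) x(1)]]
      path_words_update[OF pw B'.lact_closed[OF path_balanced(4) x(2)]] .
  from w show ?thesis
  proof (cases rule: twords_cases)
    case (Vert j g)
    obtain l where l: "length xs = Suc l" using rl by (cases "length xs") auto
    have rnl: "r \<noteq> l" using l rl by simp
    show ?thesis
    proof (cases "js ! Suc l = j")
      case j: True
      let ?ql = "Q (js ! l) (js ! Suc l)"
      interpret E: fd_bimodule K "F (js ! l)" "F (js ! Suc l)" ?ql
        using path_bimodule[OF pw, of l] l by simp
      have xl: "xs ! l \<in> carrier ?ql" using path_bimodule[OF pw, of l] l by simp
      define xs' where "xs' = xs[l := ract ?ql (xs ! l) g]"
      have pw': "Path js xs' \<in> path_words n Q" unfolding xs'_def
        using path_words_update[OF pw] E.ract_closed xl Vert j by simp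
      have rel: "frag_of (Path js (xs'[r := ract ?q (xs' ! r) c])) - frag_of (Path js (xs'[Suc r := lact ?q' c (xs' ! Suc r)])) \<in> I"
        by (rule trels_in_I, rule trels.path_balanced[where js = js and xs = xs' and r = r and c = c])
          (use pw' rl path_balanced(4) in \<open>simp_all add: xs'_def\<close>)
      have 1: "xs'[r := ract ?q (xs' ! r) c] = xs[r := ract ?q (xs ! r) c, l := ract ?ql (xs ! l) g]"
        using rnl by (simp add: xs'_def list_update_swap)
      \<comment> \<open>Here two actions can meet on one factor: if \<open>Suc r = l\<close>, then
        \<open>c\<close> acts on it from the left and \<open>g\<close> from the right, and the
        bimodule law \<open>lact_ract\<close> lets them commute.\<close>
      have 2: "xs'[Suc r := lact ?q' c (xs' ! Suc r)] =
        xs[Suc r := lact ?q' c (xs ! Suc r), l := ract ?ql (xs[Suc r := lact ?q' c (xs ! Suc r)] ! l) g]"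
      proof (cases "Suc r = l")
        case True
        have "lact ?q' c (ract ?ql (xs ! l) g) = ract ?ql (lact ?q' c (xs ! l)) g"
          using E.lact_ract[of c g "xs ! l"] path_balanced(4) Vert j xl True by simp
        then show ?thesis using True l by (simp add: xs'_def)
      next
        case False
        then show ?thesis by (simp add: xs'_def list_update_swap)
      qed
      show ?thesis
        using rel path_balanced(1) Vert(1) j l upd rnl unfolding 1 2
        by (simp add: tmul_diff_left tword_mult_Path_Vert[where l = l and n = n])
    qed (use Vert path_balanced(1) l upd in \<open>simp add: tmul_diff_left tword_mult_Path_Vert[where l = l and n = n] zero_in_I\<close>)
  next
    case (Path ls ys)
    show ?thesis
    proof (cases "js ! length xs = ls ! 0")
      case True
      note nth = path_append_nth(1)[OF pw Path(2) True]
      have "(js @ tl ls) ! r = js ! r" "(js @ tl ls) ! Suc r = js ! Suc r" "(js @ tl ls) ! Suc (Suc r) = js ! Suc (Suc r)"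
        using nth[of r] nth[of "Suc r"] nth[of "Suc (Suc r)"] rl by simp_all
      with trels_in_I[OF trels.path_balanced[OF path_words_append[OF pw Path(2) True], of r c F]] show ?thesis
        using path_balanced(1,4) rl Path True upd
        by (simp add: tmul_diff_left tword_mult_Path_Path[where n = n] list_update_append1 nth_append)
    qed (use Path path_balanced(1) upd in \<open>simp add: tmul_diff_left tword_mult_Path_Path[where n = n] zero_in_I\<close>)
  qed
qed

text \<open>The mirror image of \<open>rel_mult_word\<close>: a vertex now acts on the first factor,
  and a path on the left shifts all positions in the relation by its length.\<close>

lemma word_mult_rel:
  assumes r: "r \<in> trels n F Q" and w: "w \<in> W"
  shows "tmul (frag_of w) r \<in> I"
  using r
proof cases
  case (vert_add i f g)
  interpret Fi: ring "F i" using F_ring vert_add by simp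
  from w show ?thesis
  proof (cases rule: twords_cases)
    case (Vert j h)
    then show ?thesis
      using vert_add trels_in_I[OF trels.vert_add[of i n "h \<otimes>\<^bsub>F i\<^esub> f" F "h \<otimes>\<^bsub>F i\<^esub> g" Q]]
      by (auto simp add: tmul_diff_right Fi.r_distr zero_in_I)
  next
    case (Path js xs)
    obtain l where l: "length xs = Suc l" using Path(2) by (cases "length xs") (auto simp: path_words_iff)
    show ?thesis
    proof (cases "js ! Suc l = i")
      case True
      have ll: "l < length xs" using l by simp
      interpret B: fd_bimodule K "F (js ! l)" "F i" "Q (js ! l) i"
        using path_bimodule[OF Path(2) ll] True by simp
      have x: "xs ! l \<in> carrier (Q (js ! l) i)" using path_bimodule[OF Path(2) ll] True by simp
      show ?thesis
        using trels_in_I[OF trels.path_add[OF Path(2) ll, of "ract (Q (js ! l) i) (xs ! l) f" "ract (Q (js ! l) i) (xs ! l) g" F]]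
          vert_add Path True x l
        by (simp add: tmul_diff_right tword_mult_Path_Vert[where l = l and n = n] B.ract_closed B.ract_add_scalar)
    qed (use Path vert_add l in \<open>simp add: tmul_diff_right tword_mult_Path_Vert[where l = l and n = n] zero_in_I\<close>)
  qed
next
  case (path_add js xs r x y)
  note pw = path_add(2) and rl = path_add(3)
  let ?q = "Q (js ! r) (js ! Suc r)"
  interpret B: fd_bimodule K "F (js ! r)" "F (js ! Suc r)" ?q using path_bimodule[OF pw rl] by simp
  have upd: "Path js (xs[r := z]) \<in> path_words n Q" if "z \<in> carrier ?q" for z
    using path_words_update[OF pw that] .
  have xy: "x \<oplus>\<^bsub>?q\<^esub> y \<in> carrier ?q" using path_add by simp
  from w show ?thesis
  proof (cases rule: twords_cases)
    case (Vert j g)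
    have l: "0 < length xs" using rl by linarith
    let ?qa = "Q (js ! 0) (js ! Suc 0)"
    show ?thesis
    proof (cases "j = js ! 0")
      case j: True
      interpret E: fd_bimodule K "F (js ! 0)" "F (js ! Suc 0)" ?qa
        using path_bimodule[OF pw l] by simp
      have xl: "xs ! 0 \<in> carrier ?qa" using path_bimodule[OF pw l] by simp
      show ?thesis
      proof (cases "r = 0")
        case True
        show ?thesis
          using trels_in_I[OF trels.path_add[OF pw rl, of "lact ?q g x" "lact ?q g y" F]] path_add Vert j True l upd xy
          by (simp add: tmul_diff_right tword_mult_Vert_Path[where n = n] E.lact_closed E.lact_add_vector)
      next
        case False
        have "Path js (xs[0 := lact ?qa g (xs ! 0)]) \<in> path_words n Q"
          using path_words_update[OF pw] E.lact_closed xl Vert j by simp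
        from trels_in_I[OF trels.path_add[OF this, of r x y F]] show ?thesis
          using path_add Vert j False l upd xy
          by (simp add: tmul_diff_right tword_mult_Vert_Path[where n = n] list_update_swap)
      qed
    qed (use Vert path_add l upd xy in \<open>simp add: tmul_diff_right tword_mult_Vert_Path[where n = n] zero_in_I\<close>)
  next
    case (Path ls ys)
    show ?thesis
    proof (cases "ls ! length ys = js ! 0")
      case True
      note nth = path_append_nth(2)[OF Path(2) pw True]
      have "(ls @ tl js) ! (length ys + r) = js ! r" "(ls @ tl js) ! Suc (length ys + r) = js ! Suc r"
        using nth[of r] nth[of "Suc r"] rl by simp_all
      with trels_in_I[OF trels.path_add[OF path_words_append[OF Path(2) pw True], of "length ys + r" x y F]] show ?thesis
        using path_add Path True upd xy
        by (simp add: tmul_diff_right tword_mult_Path_Path[where n = n] list_update_append)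
    qed (use Path path_add upd xy in \<open>simp add: tmul_diff_right tword_mult_Path_Path[where n = n] zero_in_I\<close>)
  qed
next
  case (path_balanced js xs r c)
  note pw = path_balanced(2)
  have rl: "r < length xs" "Suc r < length xs" using path_balanced by auto
  let ?q = "Q (js ! r) (js ! Suc r)" and ?q' = "Q (js ! Suc r) (js ! Suc (Suc r))"
  interpret B: fd_bimodule K "F (js ! r)" "F (js ! Suc r)" ?q using path_bimodule[OF pw rl(1)] by simp
  interpret B': fd_bimodule K "F (js ! Suc r)" "F (js ! Suc (Suc r))" ?q' using path_bimodule[OF pw rl(2)] by simp
  have x: "xs ! r \<in> carrier ?q" "xs ! Suc r \<in> carrier ?q'"
    using path_bimodule[OF pw rl(1)] path_bimodule[OF pw rl(2)] by simp_all
  have upd: "Path js (xs[r := ract ?q (xs ! r) c]) \<in> path_words n Q"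
    "Path js (xs[Suc r := lact ?q' c (xs ! Suc r)]) \<in> path_words n Q"
    using path_words_update[OF pw B.ract_closed[OF path_balanced(4) x(1)]]
      path_words_update[OF pw B'.lact_closed[OF path_balanced(4) x(2)]] .
  from w show ?thesis
  proof (cases rule: twords_cases)
    case (Vert j g)
    have l: "0 < length xs" using rl by linarith
    show ?thesis
    proof (cases "j = js ! 0")
      case j: True
      let ?qa = "Q (js ! 0) (js ! Suc 0)"
      interpret E: fd_bimodule K "F (js ! 0)" "F (js ! Suc 0)" ?qa
        using path_bimodule[OF pw l] by simp
      have xl: "xs ! 0 \<in> carrier ?qa" using path_bimodule[OF pw l] by simp
      define xs' where "xs' = xs[0 := lact ?qa g (xs ! 0)]"
      have pw': "Path js xs' \<in> path_words n Q" unfolding xs'_def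
        using path_words_update[OF pw] E.lact_closed xl Vert j by simp
      have rel: "frag_of (Path js (xs'[r := ract ?q (xs' ! r) c])) - frag_of (Path js (xs'[Suc r := lact ?q' c (xs' ! Suc r)])) \<in> I"
        by (rule trels_in_I, rule trels.path_balanced[where js = js and xs = xs' and r = r and c = c])
          (use pw' rl path_balanced(4) in \<open>simp_all add: xs'_def\<close>)
      \<comment> \<open>For \<open>r = 0\<close> the factor receives \<open>g\<close> from the left
        and \<open>c\<close> from the right; \<open>lact_ract\<close> again lets them
        commute.\<close>
      have 1: "xs'[r := ract ?q (xs' ! r) c] =
        xs[r := ract ?q (xs ! r) c, 0 := lact ?qa g (xs[r := ract ?q (xs ! r) c] ! 0)]"
      proof (cases "r = 0")
        case True
        have "ract ?qa (lact ?qa g (xs ! 0)) c = lact ?qa g (ract ?qa (xs ! 0) c)"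
          using E.lact_ract[of g c "xs ! 0"] path_balanced(4) Vert j xl True by simp
        then show ?thesis using True l by (simp add: xs'_def)
      next
        case False
        then show ?thesis by (simp add: xs'_def list_update_swap)
      qed
      have 2: "xs'[Suc r := lact ?q' c (xs' ! Suc r)] = xs[Suc r := lact ?q' c (xs ! Suc r), 0 := lact ?qa g (xs ! 0)]"
        by (simp add: xs'_def list_update_swap)
      show ?thesis
        using rel path_balanced(1) Vert(1) j l upd unfolding 1 2
        by (simp add: tmul_diff_right tword_mult_Vert_Path[where n = n])
    qed (use Vert path_balanced(1) l upd in \<open>simp add: tmul_diff_right tword_mult_Vert_Path[where n = n] zero_in_I\<close>)
  next
    case (Path ls ys)
    show ?thesis
    proof (cases "ls ! length ys = js ! 0")
      case True
      note nth = path_append_nth(2)[OF Path(2) pw True]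
      have "(ls @ tl js) ! (length ys + r) = js ! r" "(ls @ tl js) ! Suc (length ys + r) = js ! Suc r"
          "(ls @ tl js) ! Suc (Suc (length ys + r)) = js ! Suc (Suc r)"
        using nth[of r] nth[of "Suc r"] nth[of "Suc (Suc r)"] rl by simp_all
      with trels_in_I[OF trels.path_balanced[OF path_words_append[OF Path(2) pw True], of "length ys + r" c F]] show ?thesis
        using path_balanced(1,4) rl Path True upd
        by (simp add: tmul_diff_right tword_mult_Path_Path[where n = n] list_update_append nth_append)
    qed (use Path path_balanced(1) upd in \<open>simp add: tmul_diff_right tword_mult_Path_Path[where n = n] zero_in_I\<close>)
  qed
qed

end

section \<open>Scalars in the tensor algebra\<close>

text \<open>A bilinear map sends two finitely spanned spaces into the span of the finitely many
  products of generators. It is applied to the actions of the \<open>F i\<close> and of the arrows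
  on \<open>M\<close>.\<close>

lemma kspan_bilinear:
  assumes V: "scalar_action K V aV" and M: "scalar_action K M aM"
    and B: "B \<subseteq> carrier V" and Y: "Y \<subseteq> carrier M"
    and closed: "\<And>v x. \<lbrakk>v \<in> carrier V; x \<in> carrier M\<rbrakk> \<Longrightarrow> \<beta> v x \<in> carrier M"
    and addl: "\<And>v w x. \<lbrakk>v \<in> carrier V; w \<in> carrier V; x \<in> carrier M\<rbrakk> \<Longrightarrow> \<beta> (v \<oplus>\<^bsub>V\<^esub> w) x = \<beta> v x \<oplus>\<^bsub>M\<^esub> \<beta> w x"
    and addr: "\<And>v x y. \<lbrakk>v \<in> carrier V; x \<in> carrier M; y \<in> carrier M\<rbrakk> \<Longrightarrow> \<beta> v (x \<oplus>\<^bsub>M\<^esub> y) = \<beta> v x \<oplus>\<^bsub>M\<^esub> \<beta> v y"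
    and scall: "\<And>k v x. \<lbrakk>k \<in> carrier K; v \<in> carrier V; x \<in> carrier M\<rbrakk> \<Longrightarrow> \<beta> (aV k v) x = aM k (\<beta> v x)"
    and scalr: "\<And>k v x. \<lbrakk>k \<in> carrier K; v \<in> carrier V; x \<in> carrier M\<rbrakk> \<Longrightarrow> \<beta> v (aM k x) = aM k (\<beta> v x)"
    and v: "v \<in> scalar_action.kspan K V aV B" and x: "x \<in> scalar_action.kspan K M aM Y"
  shows "\<beta> v x \<in> scalar_action.kspan K M aM ((\<lambda>(v, x). \<beta> v x) ` (B \<times> Y))"
proof -
  interpret V: scalar_action K V aV by (rule V)
  interpret M: scalar_action K M aM by (rule M)
  define Z where "Z = (\<lambda>(v, x). \<beta> v x) ` (B \<times> Y)"
  have Z: "Z \<subseteq> carrier M" using B Y closed by (auto simp: Z_def)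
  note S = M.subspaceD[OF M.subspace_kspan[OF Z]]
  have r0: "\<beta> v \<zero>\<^bsub>M\<^esub> = \<zero>\<^bsub>M\<^esub>" if "v \<in> carrier V" for v
    using addr[OF that M.zero_closed M.zero_closed] closed[OF that M.zero_closed] by (simp add: M.add.l_cancel_one')
  have l0: "\<beta> \<zero>\<^bsub>V\<^esub> x = \<zero>\<^bsub>M\<^esub>" if "x \<in> carrier M" for x
    using addl[OF V.zero_closed V.zero_closed that] closed[OF V.zero_closed that] by (simp add: M.add.l_cancel_one')
  have b: "\<beta> b x \<in> M.kspan Z" if b: "b \<in> B" and "x \<in> M.kspan Y" for b x
    using that(2)
  proof induction
    case kspan_zero
    then show ?case using r0 B b S(2) by auto
  next
    case (kspan_step y k u)
    have c: "b \<in> carrier V" "y \<in> carrier M" "u \<in> carrier M"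
      using b B kspan_step Y M.kspan_carrier[OF Y] by auto
    have "\<beta> b y \<in> Z" using b kspan_step(1) by (auto simp: Z_def)
    then have "aM k (\<beta> b y) \<oplus>\<^bsub>M\<^esub> \<beta> b u \<in> M.kspan Z"
      using kspan_step by (intro M.kspan_step) auto
    then show ?case using c kspan_step(2) by (simp add: addr scalr M.act_closed)
  qed
  have xM: "x \<in> carrier M" by (rule M.kspan_carrier[OF Y x])
  from v have "\<beta> v x \<in> M.kspan Z"
  proof induction
    case kspan_zero
    then show ?case using l0 xM S(2) by simp
  next
    case (kspan_step y k u)
    have c: "y \<in> carrier V" "u \<in> carrier V" using kspan_step B V.kspan_carrier[OF B] by auto
    have "aM k (\<beta> y x) \<oplus>\<^bsub>M\<^esub> \<beta> u x \<in> M.kspan Z"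
      using S(3,4) b[OF kspan_step(1) x] kspan_step by simp
    then show ?case using c xM kspan_step(2) by (simp add: addl scall V.act_closed)
  qed
  then show ?thesis by (simp add: Z_def)
qed

context modulated
begin

section \<open>The quotient by the relations and its multiplication\<close>

lemma carrier_T0: "carrier T0 = {u. Poly_Mapping.keys u \<subseteq> W}"
  by (auto simp: tword_ring_def free_Abelian_group_def)

lemma T0_simps [simp]: "add T0 = (+)" "ring.zero T0 = 0" "monoid.mult T0 = tmul"
  by (auto simp: tword_ring_def tmul_def fun_eq_iff)

lemma keys_add_W: "\<lbrakk>Poly_Mapping.keys u \<subseteq> W; Poly_Mapping.keys v \<subseteq> W\<rbrakk> \<Longrightarrow> Poly_Mapping.keys (u + v) \<subseteq> W"
  using keys_add[of u v] by blast

lemma keys_diff_W: "\<lbrakk>Poly_Mapping.keys u \<subseteq> W; Poly_Mapping.keys v \<subseteq> W\<rbrakk> \<Longrightarrow> Poly_Mapping.keys (u - v) \<subseteq> W"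
  using keys_diff[of u v] by blast

lemma keys_frag_of_W: "w \<in> W \<Longrightarrow> Poly_Mapping.keys (frag_of w) \<subseteq> W"
  by simp

lemma trels_carrier: "r \<in> trels n F Q \<Longrightarrow> Poly_Mapping.keys r \<subseteq> W"
proof (induction rule: trels.induct)
  case (vert_add i f g)
  interpret ring "F i" using F_ring vert_add by simp
  show ?case using vert_add by (intro keys_diff_W keys_frag_of_W Vert_in) auto
next
  case (path_add js xs r x y)
  interpret B: fd_bimodule K "F (js ! r)" "F (js ! Suc r)" "Q (js ! r) (js ! Suc r)"
    using path_bimodule[OF path_add(1,2)] by simp
  show ?case using path_add
    by (intro keys_diff_W keys_frag_of_W Path_in path_words_update[OF path_add(1)]) auto
next
  case (path_balanced js xs r c)
  interpret B: fd_bimodule K "F (js ! r)" "F (js ! Suc r)" "Q (js ! r) (js ! Suc r)"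
    using path_bimodule[OF path_balanced(1), of r] path_balanced(2) by simp
  interpret B': fd_bimodule K "F (js ! Suc r)" "F (js ! Suc (Suc r))" "Q (js ! Suc r) (js ! Suc (Suc r))"
    using path_bimodule[OF path_balanced(1,2)] by simp
  show ?case
    using path_balanced path_bimodule[OF path_balanced(1), of r] path_bimodule[OF path_balanced(1,2)]
    by (intro keys_diff_W keys_frag_of_W Path_in path_words_update[OF path_balanced(1)] B.ract_closed B'.lact_closed) auto
qed

lemma subgroup_I: "subgroup I (free_Abelian_group W)"
  unfolding tensor_rels_def
proof (rule group.generate_is_subgroup[OF group_free_Abelian_group])
  show "trels n F Q \<subseteq> carrier (free_Abelian_group W)" using trels_carrier by (intro subsetI) simp
qed

lemma I_keys: "u \<in> I \<Longrightarrow> Poly_Mapping.keys u \<subseteq> W"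
  using subgroup.mem_carrier[OF subgroup_I] by simp

lemma uminus_in_I: "u \<in> I \<Longrightarrow> - u \<in> I"
  using subgroup.m_inv_closed[OF subgroup_I] I_keys by fastforce

lemma diff_in_I: "\<lbrakk>u \<in> I; v \<in> I\<rbrakk> \<Longrightarrow> u - v \<in> I"
  using add_in_I[of u "- v"] uminus_in_I by simp

lemma sum_in_I: "(\<And>i. i \<in> A \<Longrightarrow> f i \<in> I) \<Longrightarrow> sum f A \<in> I"
  by (induction A rule: infinite_finite_induct) (auto simp: zero_in_I add_in_I)

lemma tmul_I_right:
  assumes u: "u \<in> I" and v: "Poly_Mapping.keys v \<subseteq> W"
  shows "tmul u v \<in> I"
  using v
proof (induction v rule: frag_induction)
  case (one w)
  from u show ?case unfolding tensor_rels_def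
  proof (induction rule: generate.induct)
    case (inv h)
    then have "tmul (- h) (frag_of w) = - tmul h (frag_of w)" using tmul_diff_left[of 0 h] by simp
    then show ?case using inv rel_mult_word one uminus_in_I trels_carrier by (simp flip: tensor_rels_def)
  next
    case (eng h1 h2)
    then show ?case by (simp flip: tensor_rels_def add: tmul_add_left add_in_I)
  qed (use rel_mult_word one zero_in_I in \<open>simp_all flip: tensor_rels_def\<close>)
qed (simp_all add: zero_in_I tmul_diff_right diff_in_I)

lemma tmul_I_left:
  assumes v: "v \<in> I" and u: "Poly_Mapping.keys u \<subseteq> W"
  shows "tmul u v \<in> I"
  using u
proof (induction u rule: frag_induction)
  case (one w)
  from v show ?case unfolding tensor_rels_def
  proof (induction rule: generate.induct)
    case (inv h)
    then have "tmul (frag_of w) (- h) = - tmul (frag_of w) h" using tmul_diff_right[of "frag_of w" 0 h] by simp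
    then show ?case using inv word_mult_rel one uminus_in_I trels_carrier by (simp flip: tensor_rels_def)
  next
    case (eng h1 h2)
    then show ?case by (simp flip: tensor_rels_def add: tmul_add_right add_in_I)
  qed (use word_mult_rel one zero_in_I in \<open>simp_all flip: tensor_rels_def\<close>)
qed (simp_all add: zero_in_I tmul_diff_left diff_in_I)

lemma tword_mult_closed:
  assumes v: "v \<in> W" and w: "w \<in> W"
  shows "Poly_Mapping.keys (tword_mult F Q v w) \<subseteq> W"
  using v
proof (cases rule: twords_cases)
  case V: (Vert i f)
  interpret Fi: ring "F i" using F_ring V by simp
  from w show ?thesis
  proof (cases rule: twords_cases)
    case (Vert j g)
    show ?thesis
    proof (cases "j = i")
      case True
      then show ?thesis using Vert V Vert_in[of i "f \<otimes>\<^bsub>F i\<^esub> g"] by simp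
    qed (use Vert V in auto)
  next
    case (Path js xs)
    have 0: "0 < length xs" using Path by (auto simp: path_words_iff)
    then interpret B: fd_bimodule K "F (js ! 0)" "F (js ! Suc 0)" "Q (js ! 0) (js ! Suc 0)"
      using path_bimodule[OF Path(2), of 0] by simp
    show ?thesis
      using Path V path_bimodule[OF Path(2) 0]
      by (auto simp: tword_mult_Vert_Path intro!: Path_in path_words_update B.lact_closed)
  qed
next
  case P: (Path js xs)
  from w show ?thesis
  proof (cases rule: twords_cases)
    case (Vert j g)
    obtain l where l: "length xs = Suc l" using P(2) by (cases "length xs") (auto simp: path_words_iff)
    then have ll: "l < length xs" by simp
    interpret B: fd_bimodule K "F (js ! l)" "F (js ! Suc l)" "Q (js ! l) (js ! Suc l)"
      using path_bimodule[OF P(2) ll] by simp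
    show ?thesis
      using Vert P l path_bimodule[OF P(2) ll]
      by (auto simp: tword_mult_Path_Vert[where l = l and n = n] intro!: Path_in path_words_update B.ract_closed)
  next
    case (Path ls ys)
    then show ?thesis
      using P by (auto simp: tword_mult_Path_Path[where n = n] intro!: Path_in path_words_append)
  qed
qed

lemma tmul_closed:
  assumes u: "Poly_Mapping.keys u \<subseteq> W" and v: "Poly_Mapping.keys v \<subseteq> W"
  shows "Poly_Mapping.keys (tmul u v) \<subseteq> W"
  using u
proof (induction u rule: frag_induction)
  case (one w)
  from v show ?case
    by (induction v rule: frag_induction)
      (simp_all add: tmul_diff_right keys_diff_W tword_mult_closed one)
qed (simp_all add: tmul_diff_left keys_diff_W)

definition E :: "(('f, 'q) tword \<Rightarrow>\<^sub>0 int) \<Rightarrow> (('f, 'q) tword \<Rightarrow>\<^sub>0 int) set" where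
  "E u = I +>\<^bsub>T0\<^esub> u"

lemma E_def': "E u = {h + u | h. h \<in> I}"
  by (auto simp: E_def a_r_coset_def')

lemma E_eqI:
  assumes "u - v \<in> I" shows "E u = E v"
proof -
  have "h + u \<in> E v" if "h \<in> I" for h
    using add_in_I[OF that assms] by (force simp: E_def')
  moreover have "h + v \<in> E u" if "h \<in> I" for h
    using diff_in_I[OF that assms] by (force simp: E_def')
  ultimately show ?thesis unfolding E_def'[of u] E_def'[of v] by (auto simp: E_def')
qed

lemma carrier_T: "carrier T = E ` {u. Poly_Mapping.keys u \<subseteq> W}"
  unfolding tensor_algebra_def FactRing_def A_RCOSETS_def' E_def by (auto simp: carrier_T0 a_r_coset_def')

lemma E_closed: "Poly_Mapping.keys u \<subseteq> W \<Longrightarrow> E u \<in> carrier T"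
  by (auto simp: carrier_T)

lemma E_add: "E u \<oplus>\<^bsub>T\<^esub> E v = E (u + v)"
proof -
  have "E u \<oplus>\<^bsub>T\<^esub> E v = {x + y | x y. x \<in> E u \<and> y \<in> E v}"
    by (auto simp: tensor_algebra_def FactRing_def set_add_def')
  also have "\<dots> = E (u + v)"
  proof
    show "{x + y | x y. x \<in> E u \<and> y \<in> E v} \<subseteq> E (u + v)"
      using add_in_I by (force simp: E_def' algebra_simps)
    show "E (u + v) \<subseteq> {x + y | x y. x \<in> E u \<and> y \<in> E v}"
    proof
      fix z assume "z \<in> E (u + v)"
      then obtain h where h: "h \<in> I" "z = (h + u) + (0 + v)" by (auto simp: E_def' algebra_simps)
      then have "h + u \<in> E u" "0 + v \<in> E v" using zero_in_I unfolding E_def' by blast+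
      then show "z \<in> {x + y | x y. x \<in> E u \<and> y \<in> E v}" using h(2) by blast
    qed
  qed
  finally show ?thesis .
qed

text \<open>The quotient multiplies cosets by a union over all products of representatives. Because
  the relations absorb multiplication on both sides, all these products lie in one coset.\<close>

lemma E_mult:
  assumes u: "Poly_Mapping.keys u \<subseteq> W" and v: "Poly_Mapping.keys v \<subseteq> W"
  shows "E u \<otimes>\<^bsub>T\<^esub> E v = E (tmul u v)"
proof -
  have "E (tmul x y) = E (tmul u v)" if "x \<in> E u" "y \<in> E v" for x y
  proof -
    from that obtain h k where h: "h \<in> I" "x = h + u" and k: "k \<in> I" "y = k + v" by (auto simp: E_def')
    have "tmul x y - tmul u v = tmul h y + tmul u k" unfolding h(2) k(2)
      by (simp add: tmul_add_left tmul_add_right)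
    also have "\<dots> \<in> I"
      using tmul_I_right[OF h(1)] tmul_I_left[OF k(1) u] keys_add_W[OF I_keys[OF k(1)] v] k(2)
      by (auto intro!: add_in_I)
    finally show ?thesis by (rule E_eqI)
  qed
  moreover have "u \<in> E u" "v \<in> E v" using zero_in_I unfolding E_def' by force+
  ultimately have "(\<Union>x\<in>E u. \<Union>y\<in>E v. E (tmul x y)) = E (tmul u v)" by blast
  then show ?thesis by (simp add: tensor_algebra_def FactRing_def rcoset_mult_def E_def)
qed

text \<open>A representative of the diagonal image of the scalar \<open>k\<close> in the product of
  the \<open>F i\<close>.\<close>

definition \<kappa> :: "'k \<Rightarrow> (('f, 'q) tword \<Rightarrow>\<^sub>0 int)" where
  "\<kappa> k = (\<Sum>i<n. frag_of (Vert i (k \<odot>\<^bsub>F i\<^esub> \<one>\<^bsub>F i\<^esub>)))"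

lemma F_scalar_mult:
  assumes "i < n" "k \<in> carrier K" "f \<in> carrier (F i)"
  shows "(k \<odot>\<^bsub>F i\<^esub> \<one>\<^bsub>F i\<^esub>) \<otimes>\<^bsub>F i\<^esub> f = k \<odot>\<^bsub>F i\<^esub> f" "f \<otimes>\<^bsub>F i\<^esub> (k \<odot>\<^bsub>F i\<^esub> \<one>\<^bsub>F i\<^esub>) = k \<odot>\<^bsub>F i\<^esub> f"
    "k \<odot>\<^bsub>F i\<^esub> \<one>\<^bsub>F i\<^esub> \<in> carrier (F i)"
proof -
  interpret Fi: ring "F i" using F_ring assms by simp
  interpret Fm: Module.module K "F i" using F_module assms by simp
  show "(k \<odot>\<^bsub>F i\<^esub> \<one>\<^bsub>F i\<^esub>) \<otimes>\<^bsub>F i\<^esub> f = k \<odot>\<^bsub>F i\<^esub> f" "f \<otimes>\<^bsub>F i\<^esub> (k \<odot>\<^bsub>F i\<^esub> \<one>\<^bsub>F i\<^esub>) = k \<odot>\<^bsub>F i\<^esub> f"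
    using F_algebra[OF assms(1)] assms unfolding fd_algebra_def by simp_all
  show "k \<odot>\<^bsub>F i\<^esub> \<one>\<^bsub>F i\<^esub> \<in> carrier (F i)" using assms by simp
qed

lemma keys_sum_W: "(\<And>i. i \<in> A \<Longrightarrow> Poly_Mapping.keys (f i) \<subseteq> W) \<Longrightarrow> Poly_Mapping.keys (sum f A) \<subseteq> W"
proof (induction A rule: infinite_finite_induct)
  case (insert x A)
  then show ?case using keys_add_W[of "f x" "sum f A"] by simp
qed simp_all

lemma \<kappa>_closed:
  assumes "k \<in> carrier K" shows "Poly_Mapping.keys (\<kappa> k) \<subseteq> W"
  unfolding \<kappa>_def
proof (rule keys_sum_W)
  fix i assume "i \<in> {..<n}"
  then have i: "i < n" by simp
  interpret ring "F i" by (rule F_ring[OF i])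
  show "Poly_Mapping.keys (frag_of (Vert i (k \<odot>\<^bsub>F i\<^esub> \<one>\<^bsub>F i\<^esub>))) \<subseteq> W"
    by (intro keys_frag_of_W Vert_in i F_scalar_mult(3)[OF i assms one_closed])
qed

lemma tmul_sum_left: "tmul (sum f A) v = (\<Sum>i\<in>A. tmul (f i) v)"
  by (induction A rule: infinite_finite_induct) (simp_all add: tmul_add_left)

lemma tmul_sum_right: "tmul u (sum f A) = (\<Sum>i\<in>A. tmul u (f i))"
  by (induction A rule: infinite_finite_induct) (simp_all add: tmul_add_right)

lemma \<kappa>_tmul_Vert:
  assumes "i < n" "k \<in> carrier K" "f \<in> carrier (F i)"
  shows "tmul (\<kappa> k) (frag_of (Vert i f)) = frag_of (Vert i (k \<odot>\<^bsub>F i\<^esub> f))"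
    "tmul (frag_of (Vert i f)) (\<kappa> k) = frag_of (Vert i (k \<odot>\<^bsub>F i\<^esub> f))"
proof -
  have "tmul (\<kappa> k) (frag_of (Vert i f)) =
      (\<Sum>j<n. if j = i then frag_of (Vert i ((k \<odot>\<^bsub>F i\<^esub> \<one>\<^bsub>F i\<^esub>) \<otimes>\<^bsub>F i\<^esub> f)) else 0)"
    unfolding \<kappa>_def tmul_sum_left by (intro sum.cong) auto
  then show "tmul (\<kappa> k) (frag_of (Vert i f)) = frag_of (Vert i (k \<odot>\<^bsub>F i\<^esub> f))"
    using assms by (simp add: F_scalar_mult)
  have "tmul (frag_of (Vert i f)) (\<kappa> k) =
      (\<Sum>j<n. if j = i then frag_of (Vert i (f \<otimes>\<^bsub>F i\<^esub> (k \<odot>\<^bsub>F i\<^esub> \<one>\<^bsub>F i\<^esub>))) else 0)"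
    unfolding \<kappa>_def tmul_sum_right by (intro sum.cong) auto
  then show "tmul (frag_of (Vert i f)) (\<kappa> k) = frag_of (Vert i (k \<odot>\<^bsub>F i\<^esub> f))"
    using assms by (simp add: F_scalar_mult)
qed

lemma arrow_in: "\<lbrakk>i < n; j < n; q \<in> carrier (Q i j)\<rbrakk> \<Longrightarrow> Path [i, j] [q] \<in> path_words n Q"
  by (simp add: path_words_iff)

text \<open>Scalars commute with arrows because both actions of \<open>K\<close> on a bimodule agree
  (\<open>K_central\<close>). Longer paths are products of arrows, so this together with vertices
  covers all generators.\<close>

lemma \<kappa>_tmul_arrow:
  assumes "i < n" "j < n" "k \<in> carrier K" "q \<in> carrier (Q i j)"
  shows "tmul (\<kappa> k) (frag_of (Path [i, j] [q])) = frag_of (Path [i, j] [lact (Q i j) (k \<odot>\<^bsub>F i\<^esub> \<one>\<^bsub>F i\<^esub>) q])"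
    "tmul (frag_of (Path [i, j] [q])) (\<kappa> k) = frag_of (Path [i, j] [lact (Q i j) (k \<odot>\<^bsub>F i\<^esub> \<one>\<^bsub>F i\<^esub>) q])"
proof -
  interpret B: fd_bimodule K "F i" "F j" "Q i j" by (rule Q_bimodule[OF assms(1,2)])
  have "tmul (\<kappa> k) (frag_of (Path [i, j] [q])) =
      (\<Sum>m<n. if m = i then frag_of (Path [i, j] [lact (Q i j) (k \<odot>\<^bsub>F i\<^esub> \<one>\<^bsub>F i\<^esub>) q]) else 0)"
    unfolding \<kappa>_def tmul_sum_left by (intro sum.cong) (auto simp: tword_mult.simps)
  then show "tmul (\<kappa> k) (frag_of (Path [i, j] [q])) = frag_of (Path [i, j] [lact (Q i j) (k \<odot>\<^bsub>F i\<^esub> \<one>\<^bsub>F i\<^esub>) q])"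
    using assms by simp
  have "tmul (frag_of (Path [i, j] [q])) (\<kappa> k) =
      (\<Sum>m<n. if m = j then frag_of (Path [i, j] [ract (Q i j) q (k \<odot>\<^bsub>F j\<^esub> \<one>\<^bsub>F j\<^esub>)]) else 0)"
    unfolding \<kappa>_def tmul_sum_right by (intro sum.cong) (auto simp: tword_mult.simps)
  then show "tmul (frag_of (Path [i, j] [q])) (\<kappa> k) = frag_of (Path [i, j] [lact (Q i j) (k \<odot>\<^bsub>F i\<^esub> \<one>\<^bsub>F i\<^esub>) q])"
    using assms by (simp add: B.K_central)
qed

text \<open>Unit and products are already preserved by the representatives; sums are preserved only
  modulo the relations \<open>vert_add\<close>.\<close>

lemma scalar_ring_hom_T: "scalar_ring_hom K T (\<lambda>k. E (\<kappa> k))"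
proof -
  interpret K: field K by (rule field_K)
  have oneT: "\<one>\<^bsub>T\<^esub> = E (\<Sum>i<n. frag_of (Vert i \<one>\<^bsub>F i\<^esub>))"
    by (simp add: tensor_algebra_def FactRing_def E_def) (simp add: tword_ring_def)
  have one: "\<one>\<^bsub>T\<^esub> = E (\<kappa> \<one>\<^bsub>K\<^esub>)"
    unfolding oneT \<kappa>_def
  proof (intro arg_cong[where f = E] sum.cong refl)
    fix i assume "i \<in> {..<n}"
    then interpret Fm: Module.module K "F i" using F_module by simp
    interpret Fi: ring "F i" using F_ring \<open>i \<in> {..<n}\<close> by simp
    show "frag_of (Vert i \<one>\<^bsub>F i\<^esub>) = frag_of (Vert i (\<one>\<^bsub>K\<^esub> \<odot>\<^bsub>F i\<^esub> \<one>\<^bsub>F i\<^esub>))" by simp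
  qed
  show ?thesis
  proof (intro scalar_ring_hom.intro scalar_ring_hom_axioms.intro field_K)
    show "r \<oplus>\<^bsub>T\<^esub> s \<in> carrier T" "r \<otimes>\<^bsub>T\<^esub> s \<in> carrier T" if "r \<in> carrier T" "s \<in> carrier T" for r s
    proof -
      from that obtain u v where "Poly_Mapping.keys u \<subseteq> W" "Poly_Mapping.keys v \<subseteq> W" "r = E u" "s = E v"
        unfolding carrier_T by blast
      then show "r \<oplus>\<^bsub>T\<^esub> s \<in> carrier T" "r \<otimes>\<^bsub>T\<^esub> s \<in> carrier T"
        by (simp_all add: E_add E_mult E_closed keys_add_W tmul_closed)
    qed
    show "\<one>\<^bsub>T\<^esub> \<in> carrier T" unfolding one by (intro E_closed \<kappa>_closed K.one_closed)
    show "E (\<kappa> k) \<in> carrier T" if "k \<in> carrier K" for k by (intro E_closed \<kappa>_closed that)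
    show "E (\<kappa> (k \<oplus>\<^bsub>K\<^esub> k')) = E (\<kappa> k) \<oplus>\<^bsub>T\<^esub> E (\<kappa> k')" if "k \<in> carrier K" "k' \<in> carrier K" for k k'
    proof -
      have "\<kappa> (k \<oplus>\<^bsub>K\<^esub> k') - (\<kappa> k + \<kappa> k') = (\<Sum>i<n. frag_of (Vert i ((k \<oplus>\<^bsub>K\<^esub> k') \<odot>\<^bsub>F i\<^esub> \<one>\<^bsub>F i\<^esub>)) -
          frag_of (Vert i (k \<odot>\<^bsub>F i\<^esub> \<one>\<^bsub>F i\<^esub>)) - frag_of (Vert i (k' \<odot>\<^bsub>F i\<^esub> \<one>\<^bsub>F i\<^esub>)))"
        by (simp add: \<kappa>_def sum_subtractf sum.distrib algebra_simps)
      also have "\<dots> \<in> I"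
      proof (rule sum_in_I)
        fix i assume "i \<in> {..<n}"
        then have i: "i < n" by simp
        interpret Fm: Module.module K "F i" by (rule F_module[OF i])
        interpret Fi: ring "F i" by (rule F_ring[OF i])
        show "frag_of (Vert i ((k \<oplus>\<^bsub>K\<^esub> k') \<odot>\<^bsub>F i\<^esub> \<one>\<^bsub>F i\<^esub>)) -
          frag_of (Vert i (k \<odot>\<^bsub>F i\<^esub> \<one>\<^bsub>F i\<^esub>)) - frag_of (Vert i (k' \<odot>\<^bsub>F i\<^esub> \<one>\<^bsub>F i\<^esub>)) \<in> I"
          using trels_in_I[OF trels.vert_add[of i n "k \<odot>\<^bsub>F i\<^esub> \<one>\<^bsub>F i\<^esub>" F "k' \<odot>\<^bsub>F i\<^esub> \<one>\<^bsub>F i\<^esub>" Q]] that i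
          by (simp add: Fm.smult_l_distr)
      qed
      finally show ?thesis unfolding E_add by (rule E_eqI)
    qed
    show "E (\<kappa> (k \<otimes>\<^bsub>K\<^esub> k')) = E (\<kappa> k) \<otimes>\<^bsub>T\<^esub> E (\<kappa> k')" if k: "k \<in> carrier K" "k' \<in> carrier K" for k k'
    proof -
      have "tmul (\<kappa> k) (\<kappa> k') = (\<Sum>i<n. tmul (\<kappa> k) (frag_of (Vert i (k' \<odot>\<^bsub>F i\<^esub> \<one>\<^bsub>F i\<^esub>))))"
        by (simp only: \<kappa>_def[of k'] tmul_sum_right)
      also have "\<dots> = \<kappa> (k \<otimes>\<^bsub>K\<^esub> k')"
        unfolding \<kappa>_def[of "k \<otimes>\<^bsub>K\<^esub> k'"]
      proof (intro sum.cong refl)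
        fix i assume "i \<in> {..<n}"
        then have i: "i < n" by simp
        interpret Fm: Module.module K "F i" by (rule F_module[OF i])
        interpret Fi: ring "F i" by (rule F_ring[OF i])
        show "tmul (\<kappa> k) (frag_of (Vert i (k' \<odot>\<^bsub>F i\<^esub> \<one>\<^bsub>F i\<^esub>))) = frag_of (Vert i ((k \<otimes>\<^bsub>K\<^esub> k') \<odot>\<^bsub>F i\<^esub> \<one>\<^bsub>F i\<^esub>))"
          using k i by (simp add: \<kappa>_tmul_Vert Fm.smult_assoc1)
      qed
      finally show ?thesis by (simp add: E_mult[OF \<kappa>_closed[OF k(1)] \<kappa>_closed[OF k(2)]])
    qed
    show "E (\<kappa> \<one>\<^bsub>K\<^esub>) = \<one>\<^bsub>T\<^esub>" using one by simp
  qed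
qed

end

section \<open>Nilpotent modules are finite dimensional\<close>

locale modulated_module = modulated K n F Q + M: right_module "tensor_algebra n F Q" M
  for K :: "('k, 'x) ring_scheme" and n and F :: "nat \<Rightarrow> ('k, 'f) module"
    and Q :: "nat \<Rightarrow> nat \<Rightarrow> ('f, 'q) bimodule"
    and M :: "((('f, 'q) tword \<Rightarrow>\<^sub>0 int) set, 'm) module"
begin

sublocale \<phi>: scalar_ring_hom K T "\<lambda>k. E (\<kappa> k)" by (rule scalar_ring_hom_T)

text \<open>The action written for representatives. It respects the relations
  (\<open>\<rho>_cong\<close>), which permits computing with words in place of cosets.\<close>

definition \<rho> :: "(('f, 'q) tword \<Rightarrow>\<^sub>0 int) \<Rightarrow> 'm \<Rightarrow> 'm" where
  "\<rho> u x = E u \<odot>\<^bsub>M\<^esub> x"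

sublocale A: scalar_action K M "\<lambda>k x. \<rho> (\<kappa> k) x"
  unfolding \<rho>_def by (rule \<phi>.scalar_action[OF M.right_module_axioms])

lemma \<rho>_closed: "\<lbrakk>Poly_Mapping.keys u \<subseteq> W; x \<in> carrier M\<rbrakk> \<Longrightarrow> \<rho> u x \<in> carrier M"
  unfolding \<rho>_def by (intro M.act_closed E_closed)

lemma \<rho>_add_left:
  "\<lbrakk>Poly_Mapping.keys u \<subseteq> W; Poly_Mapping.keys v \<subseteq> W; x \<in> carrier M\<rbrakk> \<Longrightarrow> \<rho> (u + v) x = \<rho> u x \<oplus>\<^bsub>M\<^esub> \<rho> v x"
  unfolding \<rho>_def using M.act_add_scalar[of "E u" "E v" x] by (simp add: E_closed E_add)

lemma \<rho>_add_right:
  "\<lbrakk>Poly_Mapping.keys u \<subseteq> W; x \<in> carrier M; y \<in> carrier M\<rbrakk> \<Longrightarrow> \<rho> u (x \<oplus>\<^bsub>M\<^esub> y) = \<rho> u x \<oplus>\<^bsub>M\<^esub> \<rho> u y"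
  unfolding \<rho>_def by (simp add: M.act_add_vector E_closed)

lemma \<rho>_tmul:
  "\<lbrakk>Poly_Mapping.keys u \<subseteq> W; Poly_Mapping.keys v \<subseteq> W; x \<in> carrier M\<rbrakk> \<Longrightarrow> \<rho> (tmul u v) x = \<rho> v (\<rho> u x)"
  unfolding \<rho>_def using M.act_mult[of "E u" "E v" x] by (simp add: E_closed E_mult)

lemma \<rho>_cong: "u - v \<in> I \<Longrightarrow> \<rho> u x = \<rho> v x"
  unfolding \<rho>_def by (simp add: E_eqI)

lemma \<rho>_zero:
  assumes "x \<in> carrier M" shows "\<rho> 0 x = \<zero>\<^bsub>M\<^esub>"
  using \<rho>_add_left[of 0 0 x] \<rho>_closed[of 0 x] assms by (simp add: M.add.l_cancel_one')

lemma \<rho>_Vert_add: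
  assumes "i < n" "f \<in> carrier (F i)" "g \<in> carrier (F i)" "x \<in> carrier M"
  shows "\<rho> (frag_of (Vert i (f \<oplus>\<^bsub>F i\<^esub> g))) x = \<rho> (frag_of (Vert i f)) x \<oplus>\<^bsub>M\<^esub> \<rho> (frag_of (Vert i g)) x"
proof -
  have "frag_of (Vert i (f \<oplus>\<^bsub>F i\<^esub> g)) - (frag_of (Vert i f) + frag_of (Vert i g)) \<in> I"
    using trels_in_I[OF trels.vert_add[of i n f F g Q]] assms(1-3) by (simp only: diff_diff_eq)
  from \<rho>_cong[OF this] show ?thesis using assms by (simp add: \<rho>_add_left Vert_in)
qed

lemma \<rho>_arrow_add:
  assumes "i < n" "j < n" "q \<in> carrier (Q i j)" "q' \<in> carrier (Q i j)" "x \<in> carrier M"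
  shows "\<rho> (frag_of (Path [i, j] [q \<oplus>\<^bsub>Q i j\<^esub> q'])) x =
    \<rho> (frag_of (Path [i, j] [q])) x \<oplus>\<^bsub>M\<^esub> \<rho> (frag_of (Path [i, j] [q'])) x"
proof -
  have "frag_of (Path [i, j] [q \<oplus>\<^bsub>Q i j\<^esub> q']) - (frag_of (Path [i, j] [q]) + frag_of (Path [i, j] [q'])) \<in> I"
    using trels_in_I[OF trels.path_add[OF arrow_in[OF assms(1-3)], of 0 q q' F]] assms by (simp add: diff_diff_eq)
  from \<rho>_cong[OF this] show ?thesis using assms by (simp add: \<rho>_add_left Path_in arrow_in)
qed

lemma F_action: "i < n \<Longrightarrow> scalar_action K (F i) (smult (F i))"
proof -
  assume i: "i < n"
  interpret Module.module K "F i" by (rule F_module[OF i])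
  interpret Fi: ring "F i" by (rule F_ring[OF i])
  show ?thesis
    by (intro scalar_action.intro scalar_action_axioms.intro field_K ring.is_abelian_group[OF F_ring[OF i]])
      (simp_all add: smult_l_distr smult_r_distr smult_assoc1)
qed

lemma F_basis:
  assumes i: "i < n"
  shows "\<exists>X. finite X \<and> X \<subseteq> carrier (F i) \<and> carrier (F i) = scalar_action.kspan K (F i) (smult (F i)) X"
proof -
  interpret Fi: scalar_action K "F i" "smult (F i)" by (rule F_action[OF i])
  have "finitely_spanned K (with_scalars (F i) (smult (F i)))"
    using F_algebra[OF i] unfolding fd_algebra_def finitely_spanned_def finsum_with_scalars
    by (simp add: with_scalars_def)
  then show ?thesis by (simp only: Fi.finitely_spanned_iff_kspan)
qed

lemma Q_action:
  assumes i: "i < n" and j: "j < n"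
  shows "scalar_action K (Q i j) (\<lambda>k. lact (Q i j) (k \<odot>\<^bsub>F i\<^esub> \<one>\<^bsub>F i\<^esub>))"
proof -
  interpret Fm: Module.module K "F i" by (rule F_module[OF i])
  interpret Fi: ring "F i" by (rule F_ring[OF i])
  interpret B: fd_bimodule K "F i" "F j" "Q i j" by (rule Q_bimodule[OF i j])
  have mult: "(k \<otimes>\<^bsub>K\<^esub> k') \<odot>\<^bsub>F i\<^esub> \<one>\<^bsub>F i\<^esub> = (k \<odot>\<^bsub>F i\<^esub> \<one>\<^bsub>F i\<^esub>) \<otimes>\<^bsub>F i\<^esub> (k' \<odot>\<^bsub>F i\<^esub> \<one>\<^bsub>F i\<^esub>)"
    if "k \<in> carrier K" "k' \<in> carrier K" for k k'
    using that by (simp add: F_scalar_mult(1)[OF i] Fm.smult_assoc1)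
  show ?thesis
    by (intro scalar_action.intro scalar_action_axioms.intro field_K B.abelian_group_axioms)
      (simp_all add: B.lact_closed B.lact_add_scalar B.lact_add_vector B.lact_mult B.lact_one mult Fm.smult_l_distr)
qed

lemma Q_basis:
  assumes i: "i < n" and j: "j < n"
  shows "\<exists>X. finite X \<and> X \<subseteq> carrier (Q i j) \<and>
    carrier (Q i j) = scalar_action.kspan K (Q i j) (\<lambda>k. lact (Q i j) (k \<odot>\<^bsub>F i\<^esub> \<one>\<^bsub>F i\<^esub>)) X"
proof -
  interpret B: fd_bimodule K "F i" "F j" "Q i j" by (rule Q_bimodule[OF i j])
  interpret Qij: scalar_action K "Q i j" "\<lambda>k. lact (Q i j) (k \<odot>\<^bsub>F i\<^esub> \<one>\<^bsub>F i\<^esub>)" by (rule Q_action[OF i j])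
  show ?thesis using B.finite_dim by (simp only: Qij.finitely_spanned_iff_kspan)
qed

text \<open>Each \<open>F i\<close> is finite dimensional and its action on \<open>M\<close> is
  bilinear over \<open>K\<close>, since scalars commute with vertices; so finitely many products of
  generators catch the whole image.\<close>

lemma vertex_step:
  assumes Y: "finite Y" "Y \<subseteq> carrier M"
  shows "\<exists>Y'. finite Y' \<and> Y' \<subseteq> carrier M \<and>
    (\<forall>i<n. \<forall>f\<in>carrier (F i). \<forall>x\<in>A.kspan Y. \<rho> (frag_of (Vert i f)) x \<in> A.kspan Y')"
proof -
  obtain X where X: "\<And>i. i < n \<Longrightarrow> finite (X i) \<and> X i \<subseteq> carrier (F i) \<and>
      carrier (F i) = scalar_action.kspan K (F i) (smult (F i)) (X i)"
    using F_basis by metis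
  define Y1 where "Y1 i = (\<lambda>(f, x). \<rho> (frag_of (Vert i f)) x) ` (X i \<times> Y)" for i
  have keys: "Poly_Mapping.keys (frag_of (Vert i f)) \<subseteq> W" if "i < n" "f \<in> carrier (F i)" for i f
    using that by (simp add: Vert_in)
  have Y1: "finite (Y1 i)" "Y1 i \<subseteq> carrier M" if "i < n" for i
    using X[OF that] Y that keys by (auto simp: Y1_def intro!: \<rho>_closed)
  have "\<rho> (frag_of (Vert i f)) x \<in> A.kspan (\<Union>i<n. Y1 i)"
    if i: "i < n" and f: "f \<in> carrier (F i)" and x: "x \<in> A.kspan Y" for i f x
  proof -
    have smult: "\<rho> (frag_of (Vert i (k \<odot>\<^bsub>F i\<^esub> f))) x = \<rho> (\<kappa> k) (\<rho> (frag_of (Vert i f)) x)"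
      "\<rho> (frag_of (Vert i f)) (\<rho> (\<kappa> k) x) = \<rho> (\<kappa> k) (\<rho> (frag_of (Vert i f)) x)"
      if "k \<in> carrier K" "f \<in> carrier (F i)" "x \<in> carrier M" for k f x
      using \<rho>_tmul[of "frag_of (Vert i f)" "\<kappa> k" x] \<rho>_tmul[of "\<kappa> k" "frag_of (Vert i f)" x]
        \<kappa>_tmul_Vert[OF i that(1,2)] keys[OF i that(2)] \<kappa>_closed[OF that(1)] that(3) by simp_all
    have "\<rho> (frag_of (Vert i f)) x \<in> A.kspan (Y1 i)"
      unfolding Y1_def
    proof (rule kspan_bilinear[OF F_action[OF i] A.scalar_action_axioms, where \<beta> = "\<lambda>f x. \<rho> (frag_of (Vert i f)) x"])
      show "f \<in> scalar_action.kspan K (F i) (smult (F i)) (X i)" using f X[OF i] by blast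
    qed (use X[OF i] Y x i keys smult in \<open>auto simp: \<rho>_closed \<rho>_Vert_add \<rho>_add_right\<close>)
    then show ?thesis using A.kspan_mono[of "Y1 i" "\<Union>i<n. Y1 i"] i by blast
  qed
  moreover have "finite (\<Union>i<n. Y1 i)" "(\<Union>i<n. Y1 i) \<subseteq> carrier M" using Y1 by auto
  ultimately show ?thesis by blast
qed

lemma arrow_step:
  assumes Y: "finite Y" "Y \<subseteq> carrier M"
  shows "\<exists>Y'. finite Y' \<and> Y' \<subseteq> carrier M \<and>
    (\<forall>i<n. \<forall>j<n. \<forall>q\<in>carrier (Q i j). \<forall>x\<in>A.kspan Y. \<rho> (frag_of (Path [i, j] [q])) x \<in> A.kspan Y')"
proof -
  obtain X where X: "\<And>i j. \<lbrakk>i < n; j < n\<rbrakk> \<Longrightarrow> finite (X i j) \<and> X i j \<subseteq> carrier (Q i j) \<and>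
      carrier (Q i j) = scalar_action.kspan K (Q i j) (\<lambda>k. lact (Q i j) (k \<odot>\<^bsub>F i\<^esub> \<one>\<^bsub>F i\<^esub>)) (X i j)"
    using Q_basis by metis
  define Y1 where "Y1 i j = (\<lambda>(q, x). \<rho> (frag_of (Path [i, j] [q])) x) ` (X i j \<times> Y)" for i j
  have keys: "Poly_Mapping.keys (frag_of (Path [i, j] [q])) \<subseteq> W" if "i < n" "j < n" "q \<in> carrier (Q i j)" for i j q
    using that by (simp add: Path_in arrow_in)
  have Y1: "finite (Y1 i j)" "Y1 i j \<subseteq> carrier M" if "i < n" "j < n" for i j
    using X[OF that] Y that keys by (auto simp: Y1_def intro!: \<rho>_closed)
  have "\<rho> (frag_of (Path [i, j] [q])) x \<in> A.kspan (\<Union>i<n. \<Union>j<n. Y1 i j)"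
    if i: "i < n" and j: "j < n" and q: "q \<in> carrier (Q i j)" and x: "x \<in> A.kspan Y" for i j q x
  proof -
    have smult: "\<rho> (frag_of (Path [i, j] [lact (Q i j) (k \<odot>\<^bsub>F i\<^esub> \<one>\<^bsub>F i\<^esub>) q])) x = \<rho> (\<kappa> k) (\<rho> (frag_of (Path [i, j] [q])) x)"
      "\<rho> (frag_of (Path [i, j] [q])) (\<rho> (\<kappa> k) x) = \<rho> (\<kappa> k) (\<rho> (frag_of (Path [i, j] [q])) x)"
      if "k \<in> carrier K" "q \<in> carrier (Q i j)" "x \<in> carrier M" for k q x
      using \<rho>_tmul[of "frag_of (Path [i, j] [q])" "\<kappa> k" x] \<rho>_tmul[of "\<kappa> k" "frag_of (Path [i, j] [q])" x]
        \<kappa>_tmul_arrow[OF i j that(1,2)] keys[OF i j that(2)] \<kappa>_closed[OF that(1)] that(3) by simp_all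
    have "\<rho> (frag_of (Path [i, j] [q])) x \<in> A.kspan (Y1 i j)"
      unfolding Y1_def
    proof (rule kspan_bilinear[OF Q_action[OF i j] A.scalar_action_axioms, where \<beta> = "\<lambda>q x. \<rho> (frag_of (Path [i, j] [q])) x"])
      show "q \<in> scalar_action.kspan K (Q i j) (\<lambda>k. lact (Q i j) (k \<odot>\<^bsub>F i\<^esub> \<one>\<^bsub>F i\<^esub>)) (X i j)" using q X[OF i j] by blast
    qed (use X[OF i j] Y x i j keys smult in \<open>auto simp: \<rho>_closed \<rho>_arrow_add \<rho>_add_right\<close>)
    moreover have "Y1 i j \<subseteq> (\<Union>i<n. \<Union>j<n. Y1 i j)" using i j by blast
    ultimately show ?thesis using A.kspan_mono by blast
  qed
  moreover have "finite (\<Union>i<n. \<Union>j<n. Y1 i j)" "(\<Union>i<n. \<Union>j<n. Y1 i j) \<subseteq> carrier M"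
    using Y1 by (auto simp: UN_subset_iff)
  ultimately show ?thesis by blast
qed

lemma path_words_Cons:
  assumes P: "Path js (q # xs) \<in> path_words n Q"
  obtains i j js' where "js = i # j # js'" "i < n" "j < n" "q \<in> carrier (Q i j)"
    "xs \<noteq> [] \<Longrightarrow> Path (j # js') xs \<in> path_words n Q"
proof -
  obtain i j js' where js: "js = i # j # js'"
    using P by (auto simp: path_words_iff length_Suc_conv)
  have q: "q \<in> carrier (Q i j)" using path_bimodule[OF P, of 0] js by simp
  have tl: "Path (j # js') xs \<in> path_words n Q" if "xs \<noteq> []"
  proof -
    have "xs ! r \<in> carrier (Q ((j # js') ! r) ((j # js') ! Suc r))" if "r < length xs" for r
      using path_bimodule[OF P, of "Suc r"] that js by simp
    then show ?thesis using P that js by (simp add: path_words_iff)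
  qed
  show thesis using that[OF js] q tl P js by (simp add: path_words_iff)
qed

lemma \<rho>_path_Cons:
  assumes "i < n" "j < n" "q \<in> carrier (Q i j)" "Path (j # js) xs \<in> path_words n Q" "x \<in> carrier M"
  shows "\<rho> (frag_of (Path (i # j # js) (q # xs))) x = \<rho> (frag_of (Path (j # js) xs)) (\<rho> (frag_of (Path [i, j] [q])) x)"
proof -
  have "tmul (frag_of (Path [i, j] [q])) (frag_of (Path (j # js) xs)) = frag_of (Path (i # j # js) (q # xs))"
    by (simp add: tword_mult.simps)
  then show ?thesis
    using \<rho>_tmul[of "frag_of (Path [i, j] [q])" "frag_of (Path (j # js) xs)" x] assms
    by (simp add: Path_in arrow_in)
qed

text \<open>Nilpotency is stated for sequences of elements of the radical, so a path is split into
  its arrows, each an element of the radical.\<close>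

lemma \<rho>_path_as_product:
  "\<lbrakk>Path js xs \<in> path_words n Q; x \<in> carrier M\<rbrakk> \<Longrightarrow>
     \<exists>rs. length rs = length xs \<and> set rs \<subseteq> tensor_radical n F Q \<and>
       \<rho> (frag_of (Path js xs)) x = foldl (\<lambda>y r. r \<odot>\<^bsub>M\<^esub> y) x rs"
proof (induction xs arbitrary: js x)
  case Nil
  then show ?case by (simp add: path_words_iff)
next
  case (Cons q xs)
  obtain i j js' where js: "js = i # j # js'" and ij: "i < n" "j < n" "q \<in> carrier (Q i j)"
    and tl: "xs \<noteq> [] \<Longrightarrow> Path (j # js') xs \<in> path_words n Q"
    using path_words_Cons[OF Cons.prems(1)] by blast
  define r where "r = E (frag_of (Path [i, j] [q]))"
  have "Poly_Mapping.keys (frag_of (Path [i, j] [q])) \<subseteq> path_words n Q"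
    unfolding keys_frag_of using arrow_in[OF ij] by (intro subsetI) (simp only: singleton_iff)
  then have r: "r \<in> tensor_radical n F Q"
    unfolding r_def tensor_radical_def E_def by blast
  show ?case
  proof (cases "xs = []")
    case True
    then have "js' = []" using Cons.prems(1) js by (simp add: path_words_iff)
    then show ?thesis using True js r by (intro exI[of _ "[r]"]) (simp add: r_def \<rho>_def)
  next
    case False
    have rx: "r \<odot>\<^bsub>M\<^esub> x \<in> carrier M"
      unfolding r_def using Cons.prems(2) arrow_in[OF ij] by (intro M.act_closed E_closed) (simp_all add: Path_in)
    obtain rs where "length rs = length xs" "set rs \<subseteq> tensor_radical n F Q"
      "\<rho> (frag_of (Path (j # js') xs)) (r \<odot>\<^bsub>M\<^esub> x) = foldl (\<lambda>y r. r \<odot>\<^bsub>M\<^esub> y) (r \<odot>\<^bsub>M\<^esub> x) rs"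
      using Cons.IH[OF tl[OF False] rx] by blast
    moreover have "\<rho> (frag_of (Path js (q # xs))) x = \<rho> (frag_of (Path (j # js') xs)) (r \<odot>\<^bsub>M\<^esub> x)"
      using \<rho>_path_Cons[OF ij tl[OF False] Cons.prems(2)] by (simp add: js r_def \<rho>_def)
    ultimately show ?thesis using r by (intro exI[of _ "r # rs"]) simp
  qed
qed

lemma radical_closed: "r \<in> tensor_radical n F Q \<Longrightarrow> r \<in> carrier T"
  unfolding tensor_radical_def using E_closed by (auto simp: E_def twords_def)

lemma foldl_zero:
  "set rs \<subseteq> carrier T \<Longrightarrow> foldl (\<lambda>y r. r \<odot>\<^bsub>M\<^esub> y) \<zero>\<^bsub>M\<^esub> rs = \<zero>\<^bsub>M\<^esub>"
  by (induction rs) (simp_all add: M.act_zero)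

lemma \<rho>_long_path:
  assumes N: "\<And>rs x. \<lbrakk>length rs = N; set rs \<subseteq> tensor_radical n F Q; x \<in> carrier M\<rbrakk> \<Longrightarrow>
      foldl (\<lambda>y r. r \<odot>\<^bsub>M\<^esub> y) x rs = \<zero>\<^bsub>M\<^esub>"
    and P: "Path js xs \<in> path_words n Q" "x \<in> carrier M" "N \<le> length xs"
  shows "\<rho> (frag_of (Path js xs)) x = \<zero>\<^bsub>M\<^esub>"
proof -
  obtain rs where rs: "length rs = length xs" "set rs \<subseteq> tensor_radical n F Q"
    "\<rho> (frag_of (Path js xs)) x = foldl (\<lambda>y r. r \<odot>\<^bsub>M\<^esub> y) x rs"
    using \<rho>_path_as_product[OF P(1,2)] by blast
  \<comment> \<open>Nilpotency concerns exactly \<open>N\<close> factors: the first \<open>N\<close>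
    give zero, and the others keep it zero.\<close>
  have "foldl (\<lambda>y r. r \<odot>\<^bsub>M\<^esub> y) x (take N rs) = \<zero>\<^bsub>M\<^esub>"
    using rs P(3) set_take_subset[of N rs] by (intro N P(2)) auto
  moreover have "foldl (\<lambda>y r. r \<odot>\<^bsub>M\<^esub> y) x rs =
      foldl (\<lambda>y r. r \<odot>\<^bsub>M\<^esub> y) (foldl (\<lambda>y r. r \<odot>\<^bsub>M\<^esub> y) x (take N rs)) (drop N rs)"
    by (simp flip: foldl_append)
  moreover have "set (drop N rs) \<subseteq> carrier T" using rs(2) radical_closed set_drop_subset[of N rs] by blast
  ultimately show ?thesis using rs(3) foldl_zero by simp
qed

text \<open>Starting from generators over the tensor algebra, \<open>Y 0\<close> spans what vertices
  reach, and \<open>Y k\<close> spans what is then reached along paths of length \<open>k\<close>;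
  each step keeps the set finite. Paths of length at least \<open>N\<close> act as zero, so the
  union of finitely many \<open>Y k\<close> spans \<open>M\<close> over \<open>K\<close>.\<close>

lemma nilpotent_finite_dimensional:
  assumes fin: "finitely_spanned T M" and nil: "acts_nilpotently (tensor_radical n F Q) M"
  shows "finitely_spanned K (\<phi>.scalars M)"
proof -
  obtain X where X: "finite X" "X \<subseteq> carrier M"
    "\<And>x. x \<in> carrier M \<Longrightarrow> \<exists>c\<in>X \<rightarrow> carrier T. x = finsum M (\<lambda>y. c y \<odot>\<^bsub>M\<^esub> y) X"
    using fin unfolding finitely_spanned_def by blast
  obtain N where N: "\<And>rs x. \<lbrakk>length rs = N; set rs \<subseteq> tensor_radical n F Q; x \<in> carrier M\<rbrakk> \<Longrightarrow>
      foldl (\<lambda>y r. r \<odot>\<^bsub>M\<^esub> y) x rs = \<zero>\<^bsub>M\<^esub>"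
    using nil unfolding acts_nilpotently_def by blast
  obtain Y0 where Y0: "finite Y0" "Y0 \<subseteq> carrier M"
    "\<And>i f x. \<lbrakk>i < n; f \<in> carrier (F i); x \<in> A.kspan X\<rbrakk> \<Longrightarrow> \<rho> (frag_of (Vert i f)) x \<in> A.kspan Y0"
    using vertex_step[OF X(1,2)] by blast
  obtain step where step: "\<And>Y. \<lbrakk>finite Y; Y \<subseteq> carrier M\<rbrakk> \<Longrightarrow> finite (step Y) \<and> step Y \<subseteq> carrier M \<and>
    (\<forall>i<n. \<forall>j<n. \<forall>q\<in>carrier (Q i j). \<forall>x\<in>A.kspan Y. \<rho> (frag_of (Path [i, j] [q])) x \<in> A.kspan (step Y))"
    using arrow_step by metis
  define Y where "Y k = (step ^^ k) Y0" for k
  have Y: "finite (Y k) \<and> Y k \<subseteq> carrier M" for k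
    by (induction k) (use Y0 step in \<open>auto simp: Y_def\<close>)
  have arrow: "\<rho> (frag_of (Path [i, j] [q])) x \<in> A.kspan (Y (Suc k))"
    if "i < n" "j < n" "q \<in> carrier (Q i j)" "x \<in> A.kspan (Y k)" for i j q x k
    using step[of "Y k"] Y that by (simp add: Y_def)
  have path: "\<rho> (frag_of (Path js xs)) x \<in> A.kspan (Y (k + length xs))"
    if "Path js xs \<in> path_words n Q" "x \<in> A.kspan (Y k)" for js xs x k
    using that
  proof (induction xs arbitrary: js x k)
    case Nil
    then show ?case by (simp add: path_words_iff)
  next
    case (Cons q xs)
    obtain i j js' where js: "js = i # j # js'" and ij: "i < n" "j < n" "q \<in> carrier (Q i j)"
      and tl: "xs \<noteq> [] \<Longrightarrow> Path (j # js') xs \<in> path_words n Q"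
      using path_words_Cons[OF Cons.prems(1)] by blast
    note a = arrow[OF ij Cons.prems(2)]
    show ?case
    proof (cases "xs = []")
      case True
      then have "js' = []" using Cons.prems(1) js by (simp add: path_words_iff)
      then show ?thesis using True js a by simp
    next
      case False
      have "x \<in> carrier M" using A.kspan_carrier Y Cons.prems(2) by blast
      from \<rho>_path_Cons[OF ij tl[OF False] this] Cons.IH[OF tl[OF False] a]
      show ?thesis by (simp add: js)
    qed
  qed
  define Z where "Z = (\<Union>k<Suc N. Y k)"
  have Z: "finite Z" "Z \<subseteq> carrier M" using Y by (auto simp: Z_def)
  have YZ: "A.kspan (Y k) \<subseteq> A.kspan Z" if "k \<le> N" for k
    unfolding Z_def using that by (intro A.kspan_mono UN_upper) simp
  note S = A.subspaceD[OF A.subspace_kspan[OF Z(2)]]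
  have word: "\<rho> (frag_of w) x \<in> A.kspan Z" if w: "w \<in> W" and x: "x \<in> X" for w x
    using w
  proof (cases rule: twords_cases)
    case (Vert i f)
    have "x \<in> A.kspan X" using A.kspan_superset[OF X(2)] x by blast
    then have "\<rho> (frag_of w) x \<in> A.kspan (Y 0)" using Y0(3) Vert by (simp add: Y_def)
    then show ?thesis using YZ[of 0] by blast
  next
    case (Path js xs)
    have 0: "0 < length xs" using Path by (auto simp: path_words_iff)
    let ?i = "js ! 0"
    have i: "?i < n" by (rule path_vertex[OF Path(2)]) simp
    interpret Fi: ring "F ?i" by (rule F_ring[OF i])
    interpret B: fd_bimodule K "F ?i" "F (js ! Suc 0)" "Q ?i (js ! Suc 0)" using path_bimodule[OF Path(2) 0] by simp
    have q: "xs ! 0 \<in> carrier (Q ?i (js ! Suc 0))" using path_bimodule[OF Path(2) 0] by simp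
    have xM: "x \<in> carrier M" using X(2) x by blast
    \<comment> \<open>The idempotent of the first vertex does not change the path, but it moves the
      generator \<open>x\<close> into the span of \<open>Y 0\<close>, from which \<open>path\<close>
      can start.\<close>
    have "tmul (frag_of (Vert ?i \<one>\<^bsub>F ?i\<^esub>)) (frag_of (Path js xs)) = frag_of (Path js xs)"
      using Path(2) q by (simp add: tword_mult_Vert_Path B.lact_one)
    then have eq: "\<rho> (frag_of w) x = \<rho> (frag_of (Path js xs)) (\<rho> (frag_of (Vert ?i \<one>\<^bsub>F ?i\<^esub>)) x)"
      using \<rho>_tmul[of "frag_of (Vert ?i \<one>\<^bsub>F ?i\<^esub>)" "frag_of (Path js xs)" x] Path xM i
      by (simp add: Vert_in Path_in)
    show ?thesis
    proof (cases "N \<le> length xs")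
      case True
      then show ?thesis using \<rho>_long_path[OF N Path(2) xM] Path(1) S(2) by simp
    next
      case False
      have "x \<in> A.kspan X" using A.kspan_superset[OF X(2)] x by blast
      then have "\<rho> (frag_of (Vert ?i \<one>\<^bsub>F ?i\<^esub>)) x \<in> A.kspan (Y 0)" using Y0(3) i by (simp add: Y_def)
      from path[OF Path(2) this] show ?thesis using YZ[of "length xs"] False eq by auto
    qed
  qed
  have all: "\<rho> u x \<in> A.kspan Z" if u: "Poly_Mapping.keys u \<subseteq> W" and x: "x \<in> X" for u x
  proof -
    have xM: "x \<in> carrier M" using X(2) x by blast
    \<comment> \<open>The induction forms differences, and additivity of the action is available for
      supports in \<open>W\<close>; so the support condition is carried along.\<close>
    from u have "Poly_Mapping.keys u \<subseteq> W \<and> \<rho> u x \<in> A.kspan Z"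
    proof (induction u rule: frag_induction)
      case zero
      then show ?case using \<rho>_zero[OF xM] S(2) by simp
    next
      case (one w)
      then show ?case using word[OF one x] by simp
    next
      case (diff u v)
      then have k: "Poly_Mapping.keys (u - v) \<subseteq> W" by (intro keys_diff_W) auto
      have m: "\<rho> (u - v) x \<in> carrier M" "\<rho> v x \<in> carrier M" using k diff xM by (auto intro: \<rho>_closed)
      have "\<rho> u x = \<rho> (u - v) x \<oplus>\<^bsub>M\<^esub> \<rho> v x" using \<rho>_add_left[OF k, of v x] diff xM by simp
      then have "\<rho> u x \<oplus>\<^bsub>M\<^esub> \<ominus>\<^bsub>M\<^esub> \<rho> v x = \<rho> (u - v) x" using m by (simp add: M.a_assoc M.r_neg)
      then have "\<rho> (u - v) x \<in> A.kspan Z" using S(3,5) diff by metis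
      then show ?case using k by simp
    qed
    then show ?thesis by simp
  qed
  have "carrier M \<subseteq> A.kspan Z"
  proof
    fix x assume "x \<in> carrier M"
    then obtain c where c: "c \<in> X \<rightarrow> carrier T" "x = finsum M (\<lambda>y. c y \<odot>\<^bsub>M\<^esub> y) X" using X(3) by blast
    show "x \<in> A.kspan Z" unfolding c(2)
    proof (rule A.finsum_mem[OF X(1) S(1,2,3)])
      show "(\<lambda>y. c y \<odot>\<^bsub>M\<^esub> y) \<in> X \<rightarrow> A.kspan Z"
      proof
        fix y assume y: "y \<in> X"
        then have "c y \<in> carrier T" using c(1) by auto
        then obtain u where u: "Poly_Mapping.keys u \<subseteq> W" "c y = E u" unfolding carrier_T by blast
        show "c y \<odot>\<^bsub>M\<^esub> y \<in> A.kspan Z" using all[OF u(1) y] by (simp add: \<rho>_def u(2))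
      qed
    qed
  qed
  then have "carrier M = A.kspan Z" using S(1) by blast
  then show ?thesis
    unfolding \<phi>.scalars_def using Z A.finitely_spanned_iff_kspan unfolding \<rho>_def by blast
qed

lemma acts_nilpotently_subquotient:
  assumes nil: "acts_nilpotently (tensor_radical n F Q) M" and P: "presents T M A' B Y p"
  shows "acts_nilpotently (tensor_radical n F Q) Y"
proof -
  interpret C: closed_right_module T M by (rule \<phi>.closed_right_module[OF M.right_module_axioms])
  note D = C.presentsD[OF P]
  obtain N where N: "\<And>rs x. \<lbrakk>length rs = N; set rs \<subseteq> tensor_radical n F Q; x \<in> carrier M\<rbrakk> \<Longrightarrow>
      foldl (\<lambda>y r. r \<odot>\<^bsub>M\<^esub> y) x rs = \<zero>\<^bsub>M\<^esub>"
    using nil unfolding acts_nilpotently_def by blast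
  have fold: "foldl (\<lambda>y r. r \<odot>\<^bsub>Y\<^esub> y) (p x) rs = p (foldl (\<lambda>y r. r \<odot>\<^bsub>M\<^esub> y) x rs)"
    if "x \<in> B" "set rs \<subseteq> carrier T" for x rs
    using that
  proof (induction rs arbitrary: x)
    case (Cons r rs)
    then have "r \<odot>\<^bsub>M\<^esub> x \<in> B" "p (r \<odot>\<^bsub>M\<^esub> x) = r \<odot>\<^bsub>Y\<^esub> p x"
      using M.submodule_ofD(6)[OF D(2)] D(7) by auto
    then show ?case using Cons by (simp flip: Cons.IH)
  qed simp
  have "foldl (\<lambda>y r. r \<odot>\<^bsub>Y\<^esub> y) y rs = \<zero>\<^bsub>Y\<^esub>"
    if rs: "length rs = N" "set rs \<subseteq> tensor_radical n F Q" and y: "y \<in> carrier Y" for rs y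
  proof -
    obtain x where x: "x \<in> B" "y = p x" using y D(5) by blast
    have "set rs \<subseteq> carrier T" using rs(2) radical_closed by blast
    then show ?thesis
      using fold[OF x(1)] N[OF rs M.submodule_ofD(3)[OF D(2) x(1)]] D(9) x(2) by simp
  qed
  then show ?thesis unfolding acts_nilpotently_def by blast
qed

end

text \<open>The tensor algebra need not be noetherian, so finite generation does not pass to
  submodules directly. It is obtained for subquotients from finite dimension over \<open>K\<close>,
  which does pass down.\<close>

lemma HN_filtration_modulated_quiver:
  fixes F :: "nat \<Rightarrow> ('k, 'f) module" and Q :: "nat \<Rightarrow> nat \<Rightarrow> ('f, 'q) bimodule"
    and M :: "((('f, 'q) tword \<Rightarrow>\<^sub>0 int) set, 'm) module"
  assumes mq: "modulated_quiver K n F Q" and M: "nilpotent_module n F Q M"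
    and "simple_objects (tensor_algebra n F Q) (nilpotent_module n F Q) n S" "stability_function n Z a b"
      "green (tensor_algebra n F Q) (nilpotent_module n F Q) n S a b" "nonzero_mod M"
  shows "(\<exists>!(ts, Ms). HN_filtration (tensor_algebra n F Q) n S a b M ts Ms) \<and>
     (\<forall>ts Ms. HN_filtration (tensor_algebra n F Q) n S a b M ts Ms \<longrightarrow>
        ts \<noteq> [] \<and> hd ts = first_sub_time (tensor_algebra n F Q) n S a b M)"
proof -
  have M': "right_module (tensor_algebra n F Q) M" "finitely_spanned (tensor_algebra n F Q) M"
    "acts_nilpotently (tensor_radical n F Q) M"
    using M by (simp_all add: nilpotent_module_def)
  interpret modulated_module K n F Q M
    by (intro modulated_module.intro modulated.intro mq M'(1))
  note fin = nilpotent_finite_dimensional[OF M'(2,3)]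
  show ?thesis
  proof (rule \<phi>.HN_filtration_finite_dimensional[OF M'(1) fin _ assms(3-6)])
    fix C B p and Y :: "((('f, 'q) tword \<Rightarrow>\<^sub>0 int) set, (('f, 'q) tword \<Rightarrow>\<^sub>0 int) set univ) module"
    assume P: "presents T M C B Y p"
    then show "nilpotent_module n F Q Y"
      unfolding nilpotent_module_def
      using \<phi>.finitely_spanned_of_scalars[OF \<phi>.finitely_spanned_subquotient[OF M'(1) fin P]]
        acts_nilpotently_subquotient[OF M'(3) P] by (simp add: presents_def)
  qed
qed

theorem theorem2p24:
  fixes K :: "('k, 'x) ring_scheme"
  shows
   "(\<forall>(\<Lambda> :: ('k, 'l) module) n S Z a b (M :: ('l, 'm) module).
       fd_algebra K \<Lambda> \<and>
       simple_objects \<Lambda> (fd_right_module K \<Lambda>) n S \<and>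
       stability_function n Z a b \<and>
       green \<Lambda> (fd_right_module K \<Lambda>) n S a b \<and>
       fd_right_module K \<Lambda> M \<and> nonzero_mod M \<longrightarrow>
         (\<exists>!(ts, Ms). HN_filtration \<Lambda> n S a b M ts Ms) \<and>
         (\<forall>ts Ms. HN_filtration \<Lambda> n S a b M ts Ms \<longrightarrow>
            ts \<noteq> [] \<and> hd ts = first_sub_time \<Lambda> n S a b M))
    \<and>
    (\<forall>(F :: nat \<Rightarrow> ('k, 'f) module) (Q :: nat \<Rightarrow> nat \<Rightarrow> ('f, 'q) bimodule) n S Z a b
       (M :: ((('f, 'q) tword \<Rightarrow>\<^sub>0 int) set, 'm) module).
       modulated_quiver K n F Q \<and>
       simple_objects (tensor_algebra n F Q) (nilpotent_module n F Q) n S \<and>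
       stability_function n Z a b \<and>
       green (tensor_algebra n F Q) (nilpotent_module n F Q) n S a b \<and>
       nilpotent_module n F Q M \<and> nonzero_mod M \<longrightarrow>
         (\<exists>!(ts, Ms). HN_filtration (tensor_algebra n F Q) n S a b M ts Ms) \<and>
         (\<forall>ts Ms. HN_filtration (tensor_algebra n F Q) n S a b M ts Ms \<longrightarrow>
            ts \<noteq> [] \<and> hd ts = first_sub_time (tensor_algebra n F Q) n S a b M))"
  by (rule conjI; intro allI impI; elim conjE;
      rule HN_filtration_fd_algebra HN_filtration_modulated_quiver; assumption)

end
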